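(* Let $2\le n,n'<\infty$ and $m,l\ge1$. Assume that both $z\in(\mathcal{V}_{n,m})_1$ and $y\in(\mathcal{V}_{n',l})_1$ are nonperiodic. Then the following hold: (i) $z*y$ is nonperiodic. (ii) $\tilde{\omega}_z\otimes_\varphi\tilde{\omega}_y=\tilde{\omega}_{z*y}$. Especially, if $m=l$, then $\tilde{\omega}_z\otimes_\varphi\tilde{\omega}_y=\tilde{\omega}_{z\boxtimes y}$.
   Context: $\mathcal{O}_n$ ($2\le n<\infty$) is the Cuntz algebra, the universal C$^*$-algebra generated by $s_1^{(n)},\ldots,s_n^{(n)}$ with $(s_i^{(n)})^*s_j^{(n)}=\delta_{ij}I$ and $\sum_{i=1}^n s_i^{(n)}(s_i^{(n)})^*=I$. For $J=(j_1,\ldots,j_k)\in\{1,\ldots,n\}^k$, $s_J^{(n)}:=s_{j_1}^{(n)}\cdots s_{j_k}^{(n)}$. $\mathcal{V}_{n,m}:=\ell^2(\{1,\ldots,n\}^m)$ is the Hilbert space with orthonormal basis $\{e_J\}$, identified with $(\mathbb{C}^n)^{\otimes m}$ via $e_J\leftrightarrow e_{j_1}\otimes\cdots\otimes e_{j_m}$; $(\mathcal{V}_{n,m})_1$ is the set of unit vectors. For $z\in(\mathcal{V}_{n,m})_1$, a sub-Cuntz state on $\mathcal{O}_n$ by $z$ is a state $\omega$ with $\omega(s_J^{(n)})=\overline{z_J}$ for all $J\in\{1,\ldots,n\}^m$. $z$ is nonperiodic if $z=x^{\otimes p}$ for some $p\ge1$ and some $x\in\bigcup_{k\ge1}\mathcal{V}_{n,k}$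 implies $p=1$; then there is exactly one sub-Cuntz state by $z$, denoted $\tilde{\omega}_z$. $\varphi_{n,n'}:\mathcal{O}_{nn'}\to\mathcal{O}_n\otimes\mathcal{O}_{n'}$ is the unital $*$-embedding with $\varphi_{n,n'}(s^{(nn')}_{n'(i-1)+j})=s_i^{(n)}\otimes s_j^{(n')}$, and $\omega_1\otimes_\varphi\omega_2:=(\omega_1\otimes\omega_2)\circ\varphi_{n,n'}$ for states $\omega_1$ on $\mathcal{O}_n$, $\omega_2$ on $\mathcal{O}_{n'}$. For $J\in\{1,\ldots,n\}^m$, $K\in\{1,\ldots,n'\}^m$, $J\boxtimes K=(l_1,\ldots,l_m)\in\{1,\ldots,nn'\}^m$ with $l_t:=n'(j_t-1)+k_t$; this is a bijection onto $\{1,\ldots,nn'\}^m$. For $z\in\mathcal{V}_{n,m}$, $y\in\mathcal{V}_{n',m}$, $z\boxtimes y\in\mathcal{V}_{nn',m}$ is the vector with coordinates $(z\boxtimes y)_{J\boxtimes K}:=z_Jy_K$. For $z\in\mathcal{V}_{n,m}$, $y\in\mathcal{V}_{n',l}$, $z*y:=z^{\otimes\alpha}\boxtimes y^{\otimes\beta}\in\mathcal{V}_{nn',d}$, where $\alpha,\beta\ge1$ are determined by $d:=\alpha m=\beta l$ being the least common multiple of $m$ and $l$. *)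

theory Defs
  imports Complex_Main "HOL-Library.FuncSet" "HOL-Library.Nonpos_Ints" "HOL-Algebra.Module"
begin

section \<open>Complex *-algebras, C*-seminorms, completion\<close>

record 'a star_algebra = "(complex, 'a) module" +
  adj :: "'a \<Rightarrow> 'a"

record 'a normed_star_algebra = "'a star_algebra" +
  nrm :: "'a \<Rightarrow> real"

definition cstar_seminorm :: "('a, 'm) star_algebra_scheme \<Rightarrow> ('a \<Rightarrow> real) \<Rightarrow> bool" where
  "cstar_seminorm A p \<longleftrightarrow>
     (\<forall>a \<in> carrier A. 0 \<le> p a) \<and>
     (\<forall>a \<in> carrier A. \<forall>b \<in> carrier A. p (a \<oplus>\<^bsub>A\<^esub> b) \<le> p a + p b) \<and>
     (\<forall>c. \<forall>a \<in> carrier A. p (c \<odot>\<^bsub>A\<^esub> a) = cmod c * p a) \<and>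
     (\<forall>a \<in> carrier A. \<forall>b \<in> carrier A. p (a \<otimes>\<^bsub>A\<^esub> b) \<le> p a * p b) \<and>
     (\<forall>a \<in> carrier A. p (adj A a \<otimes>\<^bsub>A\<^esub> a) = (p a)\<^sup>2)"

text \<open>The separated completion of a *-algebra with respect to a seminorm: Cauchy sequences modulo
  null sequences, with the operations induced from the pointwise ones.\<close>

definition cauchy_seqs :: "('a, 'm) star_algebra_scheme \<Rightarrow> ('a \<Rightarrow> real) \<Rightarrow> (nat \<Rightarrow> 'a) set" where
  "cauchy_seqs A p = {X. (\<forall>k. X k \<in> carrier A) \<and>
     (\<forall>e>0. \<exists>N. \<forall>i\<ge>N. \<forall>j\<ge>N. p (X i \<ominus>\<^bsub>A\<^esub> X j) < e)}"

definition cauchy_class ::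
  "('a, 'm) star_algebra_scheme \<Rightarrow> ('a \<Rightarrow> real) \<Rightarrow> (nat \<Rightarrow> 'a) \<Rightarrow> (nat \<Rightarrow> 'a) set" where
  "cauchy_class A p X = {Y \<in> cauchy_seqs A p. (\<lambda>k. p (X k \<ominus>\<^bsub>A\<^esub> Y k)) \<longlonglongrightarrow> 0}"

definition class_rep :: "(nat \<Rightarrow> 'a) set \<Rightarrow> nat \<Rightarrow> 'a" where
  "class_rep C = (SOME X. X \<in> C)"

definition completion ::
  "('a, 'm) star_algebra_scheme \<Rightarrow> ('a \<Rightarrow> real) \<Rightarrow> (nat \<Rightarrow> 'a) set normed_star_algebra" where
  "completion A p =
    \<lparr>carrier = cauchy_class A p ` cauchy_seqs A p,
     mult = (\<lambda>C D. cauchy_class A p (\<lambda>k. class_rep C k \<otimes>\<^bsub>A\<^esub> class_rep D k)),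
     one = cauchy_class A p (\<lambda>k. \<one>\<^bsub>A\<^esub>),
     zero = cauchy_class A p (\<lambda>k. \<zero>\<^bsub>A\<^esub>),
     add = (\<lambda>C D. cauchy_class A p (\<lambda>k. class_rep C k \<oplus>\<^bsub>A\<^esub> class_rep D k)),
     smult = (\<lambda>c C. cauchy_class A p (\<lambda>k. c \<odot>\<^bsub>A\<^esub> class_rep C k)),
     adj = (\<lambda>C. cauchy_class A p (\<lambda>k. adj A (class_rep C k))),
     nrm = (\<lambda>C. lim (\<lambda>k. p (class_rep C k)))\<rparr>"

definition completion_embed ::
  "('a, 'm) star_algebra_scheme \<Rightarrow> ('a \<Rightarrow> real) \<Rightarrow> 'a \<Rightarrow> (nat \<Rightarrow> 'a) set" where
  "completion_embed A p a = cauchy_class A p (\<lambda>k. a)"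

text \<open>The positive linear functionals of norm one. As everywhere below, maps out of a carrier are
  made \<^const>\<open>undefined\<close> outside of it, so that equality of maps is equality on the carrier.\<close>

definition states :: "('a, 'm) normed_star_algebra_scheme \<Rightarrow> ('a \<Rightarrow> complex) set" where
  "states A = {\<omega> \<in> extensional (carrier A).
     (\<forall>a \<in> carrier A. \<forall>b \<in> carrier A. \<omega> (a \<oplus>\<^bsub>A\<^esub> b) = \<omega> a + \<omega> b) \<and>
     (\<forall>c. \<forall>a \<in> carrier A. \<omega> (c \<odot>\<^bsub>A\<^esub> a) = c * \<omega> a) \<and>
     (\<forall>a \<in> carrier A. \<omega> (adj A a \<otimes>\<^bsub>A\<^esub> a) \<in> \<real>\<^sub>\<ge>\<^sub>0) \<and>
     (\<forall>a \<in> carrier A. cmod (\<omega> a) \<le> nrm A a) \<and>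
     \<omega> \<one>\<^bsub>A\<^esub> = 1}"

text \<open>Unital *-homomorphisms. Boundedness is automatic between C*-algebras.\<close>

definition star_hom ::
  "('a, 'm) normed_star_algebra_scheme \<Rightarrow> ('b, 'n) normed_star_algebra_scheme \<Rightarrow> ('a \<Rightarrow> 'b) set" where
  "star_hom A B = {f \<in> ring_hom A B \<inter> extensional (carrier A).
     (\<forall>c. \<forall>a \<in> carrier A. f (c \<odot>\<^bsub>A\<^esub> a) = c \<odot>\<^bsub>B\<^esub> f a) \<and>
     (\<forall>a \<in> carrier A. f (adj A a) = adj B (f a)) \<and>
     (\<exists>C. \<forall>a \<in> carrier A. nrm B (f a) \<le> C * nrm A a)}"

section \<open>*-algebra of a monoid with involution\<close>

record 'w star_monoid = "'w monoid" +
  madj :: "'w \<Rightarrow> 'w"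

text \<open>Formal complex linear combinations, i.e. finitely supported functions.\<close>

definition monoid_algebra :: "'w star_monoid \<Rightarrow> ('w \<Rightarrow> complex) star_algebra" where
  "monoid_algebra M =
    \<lparr>carrier = {f. finite {w. f w \<noteq> 0} \<and> {w. f w \<noteq> 0} \<subseteq> carrier M},
     mult = (\<lambda>f g w. \<Sum>(u, v) \<in> {(u, v). f u \<noteq> 0 \<and> g v \<noteq> 0 \<and> u \<otimes>\<^bsub>M\<^esub> v = w}. f u * g v),
     one = (\<lambda>w. if w = \<one>\<^bsub>M\<^esub> then 1 else 0),
     zero = (\<lambda>w. 0),
     add = (\<lambda>f g w. f w + g w),
     smult = (\<lambda>c f w. c * f w),
     adj = (\<lambda>f w. \<Sum>u \<in> {u. f u \<noteq> 0 \<and> madj M u = w}. cnj (f u))\<rparr>"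

definition single :: "'w \<Rightarrow> 'w \<Rightarrow> complex" where
  "single w = (\<lambda>v. if v = w then 1 else 0)"

section \<open>Cuntz algebras\<close>

text \<open>Words in the letters \<open>s\<^sub>i\<close> (\<open>Gen i\<close>) and \<open>s\<^sub>i\<^sup>*\<close> (\<open>GenAdj i\<close>), \<open>1 \<le> i \<le> n\<close>.\<close>

datatype letter = Gen nat | GenAdj nat

fun letter_adj :: "letter \<Rightarrow> letter" where
  "letter_adj (Gen i) = GenAdj i"
| "letter_adj (GenAdj i) = Gen i"

definition words :: "nat \<Rightarrow> letter list star_monoid" where
  "words n = \<lparr>carrier = lists (Gen ` {1..n} \<union> GenAdj ` {1..n}),
     mult = (@), one = [], madj = (\<lambda>w. rev (map letter_adj w))\<rparr>"

definition free_alg :: "nat \<Rightarrow> (letter list \<Rightarrow> complex) star_algebra" where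
  "free_alg n = monoid_algebra (words n)"

definition free_gen :: "nat \<Rightarrow> letter list \<Rightarrow> complex" where
  "free_gen i = single [Gen i]"

definition cuntz_relations :: "nat \<Rightarrow> (letter list \<Rightarrow> complex) set" where
  "cuntz_relations n = (let F = free_alg n in
     {adj F (free_gen i) \<otimes>\<^bsub>F\<^esub> free_gen j \<ominus>\<^bsub>F\<^esub> (if i = j then \<one>\<^bsub>F\<^esub> else \<zero>\<^bsub>F\<^esub>) | i j.
        i \<in> {1..n} \<and> j \<in> {1..n}} \<union>
     {finsum F (\<lambda>i. free_gen i \<otimes>\<^bsub>F\<^esub> adj F (free_gen i)) {1..n} \<ominus>\<^bsub>F\<^esub> \<one>\<^bsub>F\<^esub>})"

text \<open>The universal C*-algebra of the Cuntz relations: completion of the free *-algebra in the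
  largest C*-seminorm vanishing on the relations. The supremum is over a bounded set because the
  relations force \<open>p (s\<^sub>i) \<le> 1\<close>.\<close>

definition cuntz_norm :: "nat \<Rightarrow> (letter list \<Rightarrow> complex) \<Rightarrow> real" where
  "cuntz_norm n a =
     Sup {p a | p. cstar_seminorm (free_alg n) p \<and> (\<forall>r \<in> cuntz_relations n. p r = 0)}"

type_synonym cuntz_elem = "(nat \<Rightarrow> letter list \<Rightarrow> complex) set"

definition cuntz :: "nat \<Rightarrow> cuntz_elem normed_star_algebra" where
  "cuntz n = completion (free_alg n) (cuntz_norm n)"

definition cuntz_gen :: "nat \<Rightarrow> nat \<Rightarrow> cuntz_elem" where
  "cuntz_gen n i = completion_embed (free_alg n) (cuntz_norm n) (free_gen i)"

definition cuntz_gens :: "nat \<Rightarrow> nat list \<Rightarrow> cuntz_elem" where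
  "cuntz_gens n J = foldr (\<lambda>j a. cuntz_gen n j \<otimes>\<^bsub>cuntz n\<^esub> a) J \<one>\<^bsub>cuntz n\<^esub>"

section \<open>Spatial tensor product\<close>

text \<open>Formal linear combinations of elementary tensors \<open>a \<otimes> b\<close>. Bilinearity is not imposed here: the
  differences of both sides of the bilinearity relations have spatial seminorm 0 and so disappear in
  the completion.\<close>

definition tensor_alg :: "('a, 'm) star_algebra_scheme \<Rightarrow> ('b, 'n) star_algebra_scheme \<Rightarrow>
    ('a \<times> 'b \<Rightarrow> complex) star_algebra" where
  "tensor_alg A B = monoid_algebra
    \<lparr>carrier = carrier A \<times> carrier B,
     mult = (\<lambda>(a, b) (a', b'). (a \<otimes>\<^bsub>A\<^esub> a', b \<otimes>\<^bsub>B\<^esub> b')),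
     one = (\<one>\<^bsub>A\<^esub>, \<one>\<^bsub>B\<^esub>),
     madj = (\<lambda>(a, b). (adj A a, adj B b))\<rparr>"

definition prod_functional ::
  "('a \<Rightarrow> complex) \<Rightarrow> ('b \<Rightarrow> complex) \<Rightarrow> ('a \<times> 'b \<Rightarrow> complex) \<Rightarrow> complex" where
  "prod_functional \<omega>1 \<omega>2 x = (\<Sum>(a, b) \<in> {(a, b). x (a, b) \<noteq> 0}. x (a, b) * (\<omega>1 a * \<omega>2 b))"

text \<open>The supremum over all states \<open>\<omega>\<^sub>1\<close>, \<open>\<omega>\<^sub>2\<close> of the operator norm of
  \<open>(\<pi>\<^sub>1 \<otimes> \<pi>\<^sub>2)(x)\<close>, where \<open>\<pi>\<^sub>i\<close> is the GNS representation of \<open>\<omega>\<^sub>i\<close> with cyclic vector \<open>\<Omega>\<^sub>i\<close>; the operator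
  norm is computed on the unit vectors \<open>(\<pi>\<^sub>1 \<otimes> \<pi>\<^sub>2)(y)(\<Omega>\<^sub>1 \<otimes> \<Omega>\<^sub>2)\<close>, which are dense in the unit sphere.\<close>

definition spatial_norm :: "('a, 'm) normed_star_algebra_scheme \<Rightarrow>
    ('b, 'n) normed_star_algebra_scheme \<Rightarrow> ('a \<times> 'b \<Rightarrow> complex) \<Rightarrow> real" where
  "spatial_norm A B x = (let T = tensor_alg A B in
     Sup {sqrt (Re (prod_functional \<omega>1 \<omega>2 (adj T (x \<otimes>\<^bsub>T\<^esub> y) \<otimes>\<^bsub>T\<^esub> (x \<otimes>\<^bsub>T\<^esub> y)))) | \<omega>1 \<omega>2 y.
       \<omega>1 \<in> states A \<and> \<omega>2 \<in> states B \<and> y \<in> carrier T \<and>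
       prod_functional \<omega>1 \<omega>2 (adj T y \<otimes>\<^bsub>T\<^esub> y) = 1})"

definition tensor :: "('a, 'm) normed_star_algebra_scheme \<Rightarrow> ('b, 'n) normed_star_algebra_scheme \<Rightarrow>
    (nat \<Rightarrow> 'a \<times> 'b \<Rightarrow> complex) set normed_star_algebra" where
  "tensor A B = completion (tensor_alg A B) (spatial_norm A B)"

definition elem_tensor :: "('a, 'm) normed_star_algebra_scheme \<Rightarrow>
    ('b, 'n) normed_star_algebra_scheme \<Rightarrow> 'a \<Rightarrow> 'b \<Rightarrow> (nat \<Rightarrow> 'a \<times> 'b \<Rightarrow> complex) set" where
  "elem_tensor A B a b = completion_embed (tensor_alg A B) (spatial_norm A B) (single (a, b))"

definition prod_state :: "('a, 'm) normed_star_algebra_scheme \<Rightarrow>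
    ('b, 'n) normed_star_algebra_scheme \<Rightarrow> ('a \<Rightarrow> complex) \<Rightarrow> ('b \<Rightarrow> complex) \<Rightarrow>
    (nat \<Rightarrow> 'a \<times> 'b \<Rightarrow> complex) set \<Rightarrow> complex" where
  "prod_state A B \<omega>1 \<omega>2 = (THE \<omega>. \<omega> \<in> states (tensor A B) \<and>
     (\<forall>a \<in> carrier A. \<forall>b \<in> carrier B. \<omega> (elem_tensor A B a b) = \<omega>1 a * \<omega>2 b))"

text \<open>Injectivity of this homomorphism is automatic, as Cuntz algebras are simple.\<close>

definition cuntz_phi ::
  "nat \<Rightarrow> nat \<Rightarrow> cuntz_elem \<Rightarrow> (nat \<Rightarrow> cuntz_elem \<times> cuntz_elem \<Rightarrow> complex) set" where
  "cuntz_phi n n' = (THE f. f \<in> star_hom (cuntz (n * n')) (tensor (cuntz n) (cuntz n')) \<and>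
     (\<forall>i \<in> {1..n}. \<forall>j \<in> {1..n'}. f (cuntz_gen (n * n') (n' * (i - 1) + j)) =
        elem_tensor (cuntz n) (cuntz n') (cuntz_gen n i) (cuntz_gen n' j)))"

definition state_tensor_phi :: "nat \<Rightarrow> nat \<Rightarrow> (cuntz_elem \<Rightarrow> complex) \<Rightarrow>
    (cuntz_elem \<Rightarrow> complex) \<Rightarrow> cuntz_elem \<Rightarrow> complex" where
  "state_tensor_phi n n' \<omega>1 \<omega>2 =
     compose (carrier (cuntz (n * n'))) (prod_state (cuntz n) (cuntz n') \<omega>1 \<omega>2) (cuntz_phi n n')"

section \<open>The spaces \<open>\<V>\<^bsub>n,m\<^esub>\<close> and sub-Cuntz states\<close>

definition multi_indices :: "nat \<Rightarrow> nat \<Rightarrow> nat list set" where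
  "multi_indices n m = {J. set J \<subseteq> {1..n} \<and> length J = m}"

text \<open>Vectors are given by their coordinates, extended by 0.\<close>

definition vecs :: "nat \<Rightarrow> nat \<Rightarrow> (nat list \<Rightarrow> complex) set" where
  "vecs n m = {z. \<forall>J. J \<notin> multi_indices n m \<longrightarrow> z J = 0}"

definition unit_vecs :: "nat \<Rightarrow> nat \<Rightarrow> (nat list \<Rightarrow> complex) set" where
  "unit_vecs n m = {z \<in> vecs n m. (\<Sum>J \<in> multi_indices n m. (cmod (z J))\<^sup>2) = 1}"

text \<open>\<open>x \<otimes> y\<close> for \<open>x\<close> of order \<open>k\<close>, under \<open>e\<^sub>J \<otimes> e\<^sub>K = e\<^bsub>JK\<^esub>\<close>.\<close>

definition vec_tensor ::
  "nat \<Rightarrow> (nat list \<Rightarrow> complex) \<Rightarrow> (nat list \<Rightarrow> complex) \<Rightarrow> nat list \<Rightarrow> complex" where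
  "vec_tensor k x y = (\<lambda>J. x (take k J) * y (drop k J))"

fun vec_power :: "nat \<Rightarrow> (nat list \<Rightarrow> complex) \<Rightarrow> nat \<Rightarrow> nat list \<Rightarrow> complex" where
  "vec_power k x 0 = (\<lambda>J. if J = [] then 1 else 0)"
| "vec_power k x (Suc p) = vec_tensor k x (vec_power k x p)"

definition nonperiodic :: "nat \<Rightarrow> (nat list \<Rightarrow> complex) \<Rightarrow> bool" where
  "nonperiodic n z \<longleftrightarrow>
     (\<forall>p\<ge>1. \<forall>k\<ge>1. \<forall>x \<in> vecs n k. z = vec_power k x p \<longrightarrow> p = 1)"

definition sub_cuntz_state ::
  "nat \<Rightarrow> nat \<Rightarrow> (nat list \<Rightarrow> complex) \<Rightarrow> (cuntz_elem \<Rightarrow> complex) \<Rightarrow> bool" where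
  "sub_cuntz_state n m z \<omega> \<longleftrightarrow> \<omega> \<in> states (cuntz n) \<and>
     (\<forall>J \<in> multi_indices n m. \<omega> (cuntz_gens n J) = cnj (z J))"

definition omega_tilde :: "nat \<Rightarrow> nat \<Rightarrow> (nat list \<Rightarrow> complex) \<Rightarrow> cuntz_elem \<Rightarrow> complex" where
  "omega_tilde n m z = (THE \<omega>. sub_cuntz_state n m z \<omega>)"

definition index_box :: "nat \<Rightarrow> nat list \<Rightarrow> nat list \<Rightarrow> nat list" where
  "index_box n' J K = map2 (\<lambda>j k. n' * (j - 1) + k) J K"

text \<open>The sum has exactly one term for \<open>L \<in> multi_indices (n * n') m\<close> and none otherwise.\<close>

definition vec_box :: "nat \<Rightarrow> nat \<Rightarrow> nat \<Rightarrow> (nat list \<Rightarrow> complex) \<Rightarrow>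
    (nat list \<Rightarrow> complex) \<Rightarrow> nat list \<Rightarrow> complex" where
  "vec_box n n' m z y L =
     (\<Sum>(J, K) \<in> {(J, K). J \<in> multi_indices n m \<and> K \<in> multi_indices n' m \<and> index_box n' J K = L}.
        z J * y K)"

definition vec_star :: "nat \<Rightarrow> nat \<Rightarrow> nat \<Rightarrow> nat \<Rightarrow> (nat list \<Rightarrow> complex) \<Rightarrow>
    (nat list \<Rightarrow> complex) \<Rightarrow> nat list \<Rightarrow> complex" where
  "vec_star n n' m l z y = (let d = lcm m l in
     vec_box n n' d (vec_power m z (d div m)) (vec_power l y (d div l)))"

end

theory Submission
  imports Defs
begin

text \<open>Write \<open>\<Omega>\<close> for the GNS vector of a sub-Cuntz state \<open>\<omega>\<close> by \<open>z\<close>. The prescribed values say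
  \<open>s\<^sub>z \<Omega> = \<Omega>\<close>, hence \<open>s\<^sub>J\<^sup>* \<Omega> = z\<^sub>J \<Omega>\<close> for words of length \<open>m\<close>. A sub-Cuntz state exists because such a
  vector exists in the representation on functions of words that eventually grow by right tensoring
  with \<open>z\<close>. It is unique for nonperiodic \<open>z\<close>: the vector \<open>x\<^sub>J = \<omega> (s\<^sub>J\<^sup>*)\<close>, \<open>0 < |J| < m\<close>, is the contraction
  of \<open>z \<otimes> x\<close> with \<open>z\<close> from the right, so equality in Cauchy--Schwarz gives \<open>z \<otimes> x = x \<otimes> z\<close>; if \<open>x \<noteq> 0\<close>, the
  Euclidean algorithm makes \<open>z\<close> and \<open>x\<close> powers of a common tensor and \<open>z\<close> is periodic.

  If \<open>z * y = w\<^bsup>\<otimes>p\<^esup>\<close> then \<open>w = a \<boxtimes> b\<close>, with \<open>a\<^bsup>\<otimes>p\<^esup>\<close> and \<open>b\<^bsup>\<otimes>p\<^esup>\<close> proportional to powers of \<open>z\<close> and \<open>y\<close>.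
  Common roots show that the orders of \<open>z\<close> and \<open>y\<close> divide that of \<open>w\<close>, so \<open>p = 1\<close>. Finally
  \<open>\<omega>\<^sub>z \<otimes>\<^sub>\<phi> \<omega>\<^sub>y\<close> is a sub-Cuntz state by \<open>z * y\<close>, and uniqueness applies. No Hilbert space is
  completed: the norms are only compared with GNS seminorms of positive functionals, and the spatial
  seminorm is finite by Schur's product theorem.\<close>

section \<open>Complex *-algebras and C*-seminorms\<close>

text \<open>Up to a scalar, homogeneous tensors behave like words in a free monoid: prefixes and
  suffixes cancel, and tensors that commute or share a power have a common root. Factors are
  determined only up to a scalar, while periodicity is an exact equation; so this part works up to
  proportionality, and the scalar is finally absorbed as the \<open>s\<close>-th power of a complex
  number.

  On the analytic side \<open>omega_tilde\<close>, \<open>prod_state\<close> and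
  \<open>cuntz_phi\<close> are definite descriptions, so each one needs existence and uniqueness.
  For existence, a map on formal combinations must be bounded by a norm that is a supremum; one
  exhibits a competitor in that supremum which dominates the map. Uniqueness follows by density from
  the values on words or elementary tensors; for \<open>omega_tilde\<close> these are determined
  only through nonperiodicity, so (i) is an ingredient of (ii). The spatial seminorm ranges over all
  pairs of states, and its finiteness asks for a bound on an elementary tensor that is the same for
  all of them: \<open>nrm A a * nrm B b\<close>, obtained by comparing Gram kernels in one factor at
  a time.\<close>

locale star_alg = ring A for A :: "('a, 'm) star_algebra_scheme" (structure) +
  assumes smult_closed [simp, intro]: "a \<in> carrier A \<Longrightarrow> c \<odot> a \<in> carrier A"
    and smult_l_distr: "a \<in> carrier A \<Longrightarrow> (c + d) \<odot> a = c \<odot> a \<oplus> d \<odot> a"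
    and smult_r_distr: "a \<in> carrier A \<Longrightarrow> b \<in> carrier A \<Longrightarrow> c \<odot> (a \<oplus> b) = c \<odot> a \<oplus> c \<odot> b"
    and smult_smult: "a \<in> carrier A \<Longrightarrow> c \<odot> (d \<odot> a) = (c * d) \<odot> a"
    and smult_one [simp]: "a \<in> carrier A \<Longrightarrow> 1 \<odot> a = a"
    and smult_mult_l: "a \<in> carrier A \<Longrightarrow> b \<in> carrier A \<Longrightarrow> (c \<odot> a) \<otimes> b = c \<odot> (a \<otimes> b)"
    and smult_mult_r: "a \<in> carrier A \<Longrightarrow> b \<in> carrier A \<Longrightarrow> a \<otimes> (c \<odot> b) = c \<odot> (a \<otimes> b)"
    and adj_closed [simp, intro]: "a \<in> carrier A \<Longrightarrow> adj A a \<in> carrier A"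
    and adj_adj [simp]: "a \<in> carrier A \<Longrightarrow> adj A (adj A a) = a"
    and adj_add: "a \<in> carrier A \<Longrightarrow> b \<in> carrier A \<Longrightarrow> adj A (a \<oplus> b) = adj A a \<oplus> adj A b"
    and adj_smult: "a \<in> carrier A \<Longrightarrow> adj A (c \<odot> a) = cnj c \<odot> adj A a"
    and adj_mult: "a \<in> carrier A \<Longrightarrow> b \<in> carrier A \<Longrightarrow> adj A (a \<otimes> b) = adj A b \<otimes> adj A a"
begin

lemma smult_0_left [simp]: "a \<in> carrier A \<Longrightarrow> 0 \<odot> a = \<zero>"
  using smult_l_distr[of a 0 0] by (metis add_0 add.l_cancel_one' smult_closed)

lemma smult_minus: "a \<in> carrier A \<Longrightarrow> (- c) \<odot> a = \<ominus> (c \<odot> a)"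
  using smult_l_distr[of a "- c" c] by (simp add: add.inv_equality)

lemma minus_eq_smult: "a \<in> carrier A \<Longrightarrow> b \<in> carrier A \<Longrightarrow> a \<ominus> b = a \<oplus> (-1) \<odot> b"
  by (simp add: smult_minus a_minus_def)

lemma smult_0_right [simp]: "c \<odot> \<zero> = \<zero>"
proof -
  have "c \<odot> \<zero> = c \<odot> (0 \<odot> \<zero>)" by simp
  also have "\<dots> = \<zero>" by (subst smult_smult) auto
  finally show ?thesis .
qed

lemma adj_zero [simp]: "adj A \<zero> = \<zero>"
  using adj_smult[of \<zero> 0] by simp

lemma adj_one [simp]: "adj A \<one> = \<one>"
  using adj_mult[of "adj A \<one>" \<one>] by simp

lemma adj_minus: "a \<in> carrier A \<Longrightarrow> b \<in> carrier A \<Longrightarrow> adj A (a \<ominus> b) = adj A a \<ominus> adj A b"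
  by (simp add: minus_eq_smult adj_add adj_smult)

lemma smult_diff:
  assumes "a \<in> carrier A" "b \<in> carrier A"
  shows "c \<odot> (a \<ominus> b) = c \<odot> a \<ominus> c \<odot> b"
  using assms by (simp add: minus_eq_smult smult_r_distr smult_smult mult.commute)

lemma add_minus_add:
  assumes "a \<in> carrier A" "b \<in> carrier A" "c \<in> carrier A" "d \<in> carrier A"
  shows "(a \<oplus> b) \<ominus> (c \<oplus> d) = (a \<ominus> c) \<oplus> (b \<ominus> d)"
  using assms by algebra

lemma mult_minus_mult:
  assumes "a \<in> carrier A" "b \<in> carrier A" "c \<in> carrier A" "d \<in> carrier A"
  shows "a \<otimes> b \<ominus> c \<otimes> d = (a \<ominus> c) \<otimes> b \<oplus> c \<otimes> (b \<ominus> d)"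
  using assms by algebra

text \<open>Suprema and limits inherit inequalities, so only these are asked for. Homogeneity
  follows by scaling back with \<open>inverse c\<close>. From \<open>(p a)\<^sup>2 \<le> p (adj A a
  \<otimes> a) \<le> p (adj A a) * p a\<close> the involution is isometric, and this turns the
  C*-inequality into an equality.\<close>

lemma cstar_seminormI:
  assumes nonneg: "\<And>a. a \<in> carrier A \<Longrightarrow> 0 \<le> p a"
    and add: "\<And>a b. a \<in> carrier A \<Longrightarrow> b \<in> carrier A \<Longrightarrow> p (a \<oplus> b) \<le> p a + p b"
    and smult: "\<And>c a. a \<in> carrier A \<Longrightarrow> p (c \<odot> a) \<le> cmod c * p a"
    and mult: "\<And>a b. a \<in> carrier A \<Longrightarrow> b \<in> carrier A \<Longrightarrow> p (a \<otimes> b) \<le> p a * p b"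
    and cstar: "\<And>a. a \<in> carrier A \<Longrightarrow> (p a)\<^sup>2 \<le> p (adj A a \<otimes> a)"
  shows "cstar_seminorm A p"
proof -
  have sm: "p (c \<odot> a) = cmod c * p a" if a: "a \<in> carrier A" for c a
  proof (cases "c = 0")
    case True
    then show ?thesis using smult[OF a, of 0] nonneg[of \<zero>] a by simp
  next
    case False
    have "cmod c * p a = cmod c * p (inverse c \<odot> (c \<odot> a))"
      using False a by (simp add: smult_smult)
    also have "\<dots> \<le> cmod c * (cmod (inverse c) * p (c \<odot> a))"
      using smult[of "c \<odot> a" "inverse c"] a by (intro mult_left_mono) auto
    also have "\<dots> = p (c \<odot> a)" using False by (simp add: norm_inverse)
    finally show ?thesis using smult[OF a, of c] by linarith
  qed
  have adj_ge: "p a \<le> p (adj A a)" if a: "a \<in> carrier A" for a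
  proof (rule ccontr)
    assume "\<not> p a \<le> p (adj A a)"
    then have "p (adj A a) * p a < p a * p a"
      using nonneg[of "adj A a"] a by (intro mult_strict_right_mono) auto
    moreover have "p a * p a \<le> p (adj A a) * p a"
      using cstar[OF a] mult[of "adj A a" a] a by (simp add: power2_eq_square)
    ultimately show False by linarith
  qed
  have adj_eq: "p (adj A a) = p a" if a: "a \<in> carrier A" for a
    using adj_ge[OF a] adj_ge[of "adj A a"] a by simp
  have "p (adj A a \<otimes> a) = (p a)\<^sup>2" if a: "a \<in> carrier A" for a
    using cstar[OF a] mult[of "adj A a" a] a adj_eq[OF a] by (simp add: power2_eq_square)
  then show ?thesis
    unfolding cstar_seminorm_def by (intro conjI ballI allI nonneg add mult sm)
qed

end

locale cstar_seminormed = star_alg A for A :: "('a, 'm) star_algebra_scheme" (structure) +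
  fixes p :: "'a \<Rightarrow> real"
  assumes cstar: "cstar_seminorm A p"
begin

lemma p_nonneg [simp]: "a \<in> carrier A \<Longrightarrow> 0 \<le> p a"
  and p_add: "a \<in> carrier A \<Longrightarrow> b \<in> carrier A \<Longrightarrow> p (a \<oplus> b) \<le> p a + p b"
  and p_smult: "a \<in> carrier A \<Longrightarrow> p (c \<odot> a) = cmod c * p a"
  and p_mult: "a \<in> carrier A \<Longrightarrow> b \<in> carrier A \<Longrightarrow> p (a \<otimes> b) \<le> p a * p b"
  and p_cstar: "a \<in> carrier A \<Longrightarrow> p (adj A a \<otimes> a) = (p a)\<^sup>2"
  using cstar unfolding cstar_seminorm_def by blast+

lemma p_zero [simp]: "p \<zero> = 0"
  using p_smult[of \<zero> 0] by simp

lemma p_minus: "a \<in> carrier A \<Longrightarrow> b \<in> carrier A \<Longrightarrow> p (a \<ominus> b) \<le> p a + p b"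
  using p_add[of a "(-1) \<odot> b"] by (simp add: minus_eq_smult p_smult)

lemma p_minus_commute:
  assumes "a \<in> carrier A" "b \<in> carrier A"
  shows "p (a \<ominus> b) = p (b \<ominus> a)"
proof -
  have "a \<ominus> b = \<ominus> (b \<ominus> a)" using assms by algebra
  also have "\<dots> = (-1) \<odot> (b \<ominus> a)" using assms by (simp add: smult_minus)
  finally show ?thesis using assms by (simp add: p_smult)
qed

lemma p_triangle:
  assumes "a \<in> carrier A" "b \<in> carrier A" "c \<in> carrier A"
  shows "p (a \<ominus> c) \<le> p (a \<ominus> b) + p (b \<ominus> c)"
proof -
  have "a \<ominus> c = (a \<ominus> b) \<oplus> (b \<ominus> c)" using assms by algebra
  then show ?thesis using p_add[of "a \<ominus> b" "b \<ominus> c"] assms by simp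
qed

lemma p_self [simp]: "a \<in> carrier A \<Longrightarrow> p (a \<ominus> a) = 0"
  by (simp add: r_neg a_minus_def)

lemma p_diff:
  assumes "a \<in> carrier A" "b \<in> carrier A"
  shows "\<bar>p a - p b\<bar> \<le> p (a \<ominus> b)"
proof -
  have *: "p a - p b \<le> p (a \<ominus> b)" if "a \<in> carrier A" "b \<in> carrier A" for a b
  proof -
    have "a = (a \<ominus> b) \<oplus> b" using that by algebra
    then show ?thesis using p_add[of "a \<ominus> b" b] that by simp
  qed
  show ?thesis using *[OF assms] *[OF assms(2,1)] p_minus_commute[OF assms] by linarith
qed

lemma p_adj [simp]:
  assumes "a \<in> carrier A"
  shows "p (adj A a) = p a"
proof -
  have *: "p a \<le> p (adj A a)" if a: "a \<in> carrier A" for a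
  proof (rule ccontr)
    assume "\<not> p a \<le> p (adj A a)"
    then have "p (adj A a) * p a < p a * p a"
      using p_nonneg[of "adj A a", OF adj_closed[OF a]] by (intro mult_strict_right_mono) auto
    moreover have "p a * p a \<le> p (adj A a) * p a"
      using p_cstar[OF a] p_mult[of "adj A a" a] a by (simp add: power2_eq_square)
    ultimately show False by linarith
  qed
  from *[OF assms] *[of "adj A a"] assms show ?thesis by simp
qed

text \<open>\<open>p \<one>\<close> is its own square; the value 0 does occur, for the zero
  seminorm.\<close>

lemma p_one_le: "p \<one> \<le> 1"
proof -
  have "p \<one> = (p \<one>)\<^sup>2" using p_cstar[of \<one>] by simp
  then have "p \<one> = 0 \<or> p \<one> = 1" by (simp add: power2_eq_square)
  then show ?thesis by auto
qed

lemma p_minus_zero: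
  assumes "a \<in> carrier A" "b \<in> carrier A" "p (a \<ominus> b) = 0"
  shows "p a = p b"
  using p_diff[OF assms(1,2)] assms(3) by simp

end

lemma (in star_alg) cstar_seminorm_Sup:
  assumes ne: "P \<noteq> {}" and P: "\<And>p. p \<in> P \<Longrightarrow> cstar_seminorm A p"
    and bdd: "\<And>a. a \<in> carrier A \<Longrightarrow> bdd_above {p a | p. p \<in> P}"
  shows "cstar_seminorm A (\<lambda>a. Sup {p a | p. p \<in> P})"
proof -
  define S where "S = (\<lambda>a. Sup {p a | p. p \<in> P})"
  have P': "cstar_seminormed A p" if "p \<in> P" for p
    using P[OF that] by (intro cstar_seminormed.intro star_alg_axioms cstar_seminormed_axioms.intro)
  have upper: "p a \<le> S a" if "p \<in> P" "a \<in> carrier A" for p a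
    unfolding S_def using that by (intro cSup_upper bdd) blast
  have least: "S a \<le> c" if "\<And>p. p \<in> P \<Longrightarrow> p a \<le> c" for a c
    unfolding S_def
  proof (rule cSup_least)
    show "{p a | p. p \<in> P} \<noteq> {}" using ne by blast
  qed (use that in blast)
  obtain p0 where p0: "p0 \<in> P" using ne by blast
  have "cstar_seminorm A S"
  proof (rule cstar_seminormI)
  show nn: "0 \<le> S a" if a: "a \<in> carrier A" for a
    using upper[OF p0 a] cstar_seminormed.p_nonneg[OF P'[OF p0] a] by linarith
  show "S (a \<oplus> b) \<le> S a + S b" if a: "a \<in> carrier A" "b \<in> carrier A" for a b
  proof (rule least)
    fix p assume p: "p \<in> P"
    show "p (a \<oplus> b) \<le> S a + S b"
      using cstar_seminormed.p_add[OF P'[OF p] a] upper[OF p a(1)] upper[OF p a(2)] by linarith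
  qed
  show "S (c \<odot> a) \<le> cmod c * S a" if a: "a \<in> carrier A" for a c
  proof (rule least)
    fix p assume p: "p \<in> P"
    show "p (c \<odot> a) \<le> cmod c * S a"
      unfolding cstar_seminormed.p_smult[OF P'[OF p] a] using upper[OF p a] by (rule mult_left_mono) simp
  qed
  show "S (a \<otimes> b) \<le> S a * S b" if a: "a \<in> carrier A" "b \<in> carrier A" for a b
  proof (rule least)
    fix p assume p: "p \<in> P"
    have "p (a \<otimes> b) \<le> p a * p b" using cstar_seminormed.p_mult[OF P'[OF p] a] .
    also have "\<dots> \<le> S a * S b" using upper[OF p a(1)] upper[OF p a(2)] nn[OF a(1)]
        cstar_seminormed.p_nonneg[OF P'[OF p] a(2)] by (intro mult_mono)
    finally show "p (a \<otimes> b) \<le> S a * S b" .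
  qed
  show "(S a)\<^sup>2 \<le> S (adj A a \<otimes> a)" if a: "a \<in> carrier A" for a
  proof -
    \<comment> \<open>\<open>least\<close> bounds \<open>S a\<close> itself and not its square,
      hence the detour through the root.\<close>
    have "S a \<le> sqrt (S (adj A a \<otimes> a))"
    proof (rule least)
      fix p assume p: "p \<in> P"
      have "(p a)\<^sup>2 \<le> S (adj A a \<otimes> a)"
        using cstar_seminormed.p_cstar[OF P'[OF p] a] upper[OF p, of "adj A a \<otimes> a"] a by simp
      then show "p a \<le> sqrt (S (adj A a \<otimes> a))" by (rule real_le_rsqrt)
    qed
    then have "(S a)\<^sup>2 \<le> (sqrt (S (adj A a \<otimes> a)))\<^sup>2" using nn[OF a] by (rule power_mono)
    also have "\<dots> = S (adj A a \<otimes> a)" using nn[of "adj A a \<otimes> a"] a by simp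
    finally show ?thesis .
  qed
qed
  then show ?thesis by (simp only: S_def)
qed

section \<open>Positive functionals and GNS seminorms\<close>

locale positive_functional = star_alg A for A :: "('a, 'm) star_algebra_scheme" (structure) +
  fixes \<omega> :: "'a \<Rightarrow> complex"
  assumes om_add: "a \<in> carrier A \<Longrightarrow> b \<in> carrier A \<Longrightarrow> \<omega> (a \<oplus> b) = \<omega> a + \<omega> b"
    and om_smult: "a \<in> carrier A \<Longrightarrow> \<omega> (c \<odot> a) = c * \<omega> a"
    and om_pos: "a \<in> carrier A \<Longrightarrow> \<omega> (adj A a \<otimes> a) \<in> \<real>\<^sub>\<ge>\<^sub>0"
begin

lemma om_minus: "a \<in> carrier A \<Longrightarrow> b \<in> carrier A \<Longrightarrow> \<omega> (a \<ominus> b) = \<omega> a - \<omega> b"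
  by (simp add: minus_eq_smult om_add om_smult)

lemma om_zero [simp]: "\<omega> \<zero> = 0"
  using om_smult[of \<zero> 0] by simp

lemma om_pos': "a \<in> carrier A \<Longrightarrow> 0 \<le> Re (\<omega> (adj A a \<otimes> a))"
  "a \<in> carrier A \<Longrightarrow> Im (\<omega> (adj A a \<otimes> a)) = 0"
  using om_pos by (auto simp: complex_nonneg_Reals_iff)

lemma expand_sq:
  assumes "a \<in> carrier A" "b \<in> carrier A"
  shows "\<omega> (adj A (a \<oplus> t \<odot> b) \<otimes> (a \<oplus> t \<odot> b)) = \<omega> (adj A a \<otimes> a) + t * \<omega> (adj A a \<otimes> b)
    + cnj t * \<omega> (adj A b \<otimes> a) + cnj t * t * \<omega> (adj A b \<otimes> b)"
  using assms by (simp add: adj_add adj_smult l_distr r_distr smult_mult_l smult_mult_r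
      smult_smult om_add om_smult algebra_simps)

text \<open>Polarization: the functional is real on the squares of
  \<open>a \<oplus> t \<odot> b\<close>. The choice \<open>t = 1\<close> compares the imaginary
  parts of the two cross terms, and \<open>t = \<i>\<close> their real parts.\<close>

lemma om_herm:
  assumes a: "a \<in> carrier A" and b: "b \<in> carrier A"
  shows "\<omega> (adj A b \<otimes> a) = cnj (\<omega> (adj A a \<otimes> b))"
proof -
  have "Im (\<omega> (adj A (a \<oplus> t \<odot> b) \<otimes> (a \<oplus> t \<odot> b))) = 0" for t
    using a b by (intro om_pos') auto
  from this[of 1] this[of \<i>] show ?thesis
    unfolding expand_sq[OF a b] using om_pos'[OF a] om_pos'[OF b] by (simp add: complex_eq_iff)
qed

lemma om_adj:
  assumes a: "a \<in> carrier A"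
  shows "\<omega> (adj A a) = cnj (\<omega> a)"
  using om_herm[of \<one> a] a by simp

lemma cauchy_schwarz:
  assumes a: "a \<in> carrier A" and b: "b \<in> carrier A"
  shows "(cmod (\<omega> (adj A a \<otimes> b)))\<^sup>2 \<le> Re (\<omega> (adj A a \<otimes> a)) * Re (\<omega> (adj A b \<otimes> b))"
proof -
  define \<alpha> \<beta> \<gamma> where "\<alpha> = Re (\<omega> (adj A a \<otimes> a))" and "\<beta> = Re (\<omega> (adj A b \<otimes> b))"
    and "\<gamma> = \<omega> (adj A a \<otimes> b)"
  have al: "\<omega> (adj A a \<otimes> a) = of_real \<alpha>" and be: "\<omega> (adj A b \<otimes> b) = of_real \<beta>"
    using om_pos'[OF a] om_pos'[OF b] by (simp_all add: \<alpha>_def \<beta>_def complex_eq_iff)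
  have nn: "\<alpha> \<ge> 0" "\<beta> \<ge> 0" using om_pos'(1)[OF a] om_pos'(1)[OF b] by (simp_all add: \<alpha>_def \<beta>_def)
  \<comment> \<open>The multiple \<open>t = - r * cnj \<gamma>\<close> makes both cross terms real
    and equal, which leaves a real quadratic in \<open>r\<close>.\<close>
  have key: "0 \<le> \<alpha> - 2 * r * (cmod \<gamma>)\<^sup>2 + r\<^sup>2 * (cmod \<gamma>)\<^sup>2 * \<beta>" for r :: real
  proof -
    have "0 \<le> Re (\<omega> (adj A (a \<oplus> (- r * cnj \<gamma>) \<odot> b) \<otimes> (a \<oplus> (- r * cnj \<gamma>) \<odot> b)))"
      using a b by (intro om_pos') auto
    also have "\<dots> = \<alpha> - 2 * r * (cmod \<gamma>)\<^sup>2 + r\<^sup>2 * (cmod \<gamma>)\<^sup>2 * \<beta>"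
      unfolding expand_sq[OF a b] om_herm[OF a b] al be \<gamma>_def[symmetric]
      unfolding cmod_power2 by (simp add: power2_eq_square algebra_simps)
    finally show ?thesis .
  qed
  have "(cmod \<gamma>)\<^sup>2 \<le> \<alpha> * \<beta>"
  proof (cases "\<beta> = 0")
    case True
    have "(cmod \<gamma>)\<^sup>2 = 0"
    proof (rule ccontr)
      assume "(cmod \<gamma>)\<^sup>2 \<noteq> 0"
      then have g: "(cmod \<gamma>)\<^sup>2 > 0" by simp
      \<comment> \<open>For this \<open>r\<close> and \<open>\<beta> = 0\<close> the inequality
        \<open>key\<close> would read \<open>0 \<le> -1\<close>.\<close>
      have "2 * ((\<alpha> + 1) / (2 * (cmod \<gamma>)\<^sup>2)) * (cmod \<gamma>)\<^sup>2 = \<alpha> + 1" using g by (simp add: field_simps)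
      then show False using key[of "(\<alpha> + 1) / (2 * (cmod \<gamma>)\<^sup>2)"] True by simp
    qed
    then show ?thesis using True by simp
  next
    case False
    then have "\<beta> > 0" using nn by simp
    then show ?thesis using key[of "1 / \<beta>"] by (simp add: field_simps power2_eq_square)
  qed
  then show ?thesis by (simp add: \<alpha>_def \<beta>_def \<gamma>_def)
qed

definition om_norm :: "'a \<Rightarrow> real" where
  "om_norm a = sqrt (Re (\<omega> (adj A a \<otimes> a)))"

lemma om_norm_nonneg [simp]: "a \<in> carrier A \<Longrightarrow> 0 \<le> om_norm a"
  by (simp add: om_norm_def om_pos')

lemma om_norm_sq: "a \<in> carrier A \<Longrightarrow> (om_norm a)\<^sup>2 = Re (\<omega> (adj A a \<otimes> a))"
  by (simp add: om_norm_def om_pos')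

lemma cauchy_schwarz':
  assumes a: "a \<in> carrier A" and b: "b \<in> carrier A"
  shows "cmod (\<omega> (adj A a \<otimes> b)) \<le> om_norm a * om_norm b"
proof (rule power2_le_imp_le)
  show "(cmod (\<omega> (adj A a \<otimes> b)))\<^sup>2 \<le> (om_norm a * om_norm b)\<^sup>2"
    using cauchy_schwarz[OF a b] unfolding power_mult_distrib om_norm_sq[OF a] om_norm_sq[OF b] .
qed (use a b in simp)

lemma om_norm_add:
  assumes a: "a \<in> carrier A" and b: "b \<in> carrier A"
  shows "om_norm (a \<oplus> b) \<le> om_norm a + om_norm b"
proof (rule power2_le_imp_le)
  have "(om_norm (a \<oplus> b))\<^sup>2 = Re (\<omega> (adj A a \<otimes> a)) + 2 * Re (\<omega> (adj A a \<otimes> b)) + Re (\<omega> (adj A b \<otimes> b))"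
    using expand_sq[OF a b, of 1] om_herm[OF a b] a b by (simp add: om_norm_sq)
  also have "\<dots> \<le> (om_norm a)\<^sup>2 + 2 * (om_norm a * om_norm b) + (om_norm b)\<^sup>2"
    using cauchy_schwarz'[OF a b] complex_Re_le_cmod[of "\<omega> (adj A a \<otimes> b)"] a b by (simp add: om_norm_sq)
  also have "\<dots> = (om_norm a + om_norm b)\<^sup>2" by (simp add: power2_eq_square algebra_simps)
  finally show "(om_norm (a \<oplus> b))\<^sup>2 \<le> (om_norm a + om_norm b)\<^sup>2" .
qed (use a b in simp)

lemma om_norm_smult:
  assumes a: "a \<in> carrier A"
  shows "om_norm (c \<odot> a) = cmod c * om_norm a"
proof -
  have "\<omega> (adj A (c \<odot> a) \<otimes> (c \<odot> a)) = (of_real ((cmod c)\<^sup>2)) * \<omega> (adj A a \<otimes> a)"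
    using a unfolding complex_norm_square
    by (simp add: adj_smult smult_mult_l smult_mult_r om_smult)
  then show ?thesis unfolding om_norm_def
    by (simp del: of_real_power add: real_sqrt_mult)
qed

end

text \<open>This is the operator norm of \<open>x\<close> in the direct sum of the GNS
  representations of the functionals in \<open>F\<close>: the root is the length of the vector that
  \<open>x \<otimes> y\<close> produces from the cyclic vector, and \<open>y\<close> runs through
  the elements producing unit vectors. The representation spaces themselves are never
  formed.\<close>

definition gns_norm :: "('a, 'm) star_algebra_scheme \<Rightarrow> ('a \<Rightarrow> complex) set \<Rightarrow> 'a \<Rightarrow> real" where
  "gns_norm A F x = Sup {sqrt (Re (\<omega> (adj A (x \<otimes>\<^bsub>A\<^esub> y) \<otimes>\<^bsub>A\<^esub> (x \<otimes>\<^bsub>A\<^esub> y)))) | \<omega> y.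
     \<omega> \<in> F \<and> y \<in> carrier A \<and> \<omega> (adj A y \<otimes>\<^bsub>A\<^esub> y) = 1}"

text \<open>One constant serves all of \<open>F\<close>, so that the supremum in
  \<open>gns_norm\<close> is over a bounded set. The squares are kept because the comparison of
  kernels in the tensor product yields an inequality between squares.\<close>

definition gns_bounded :: "('a, 'm) star_algebra_scheme \<Rightarrow> ('a \<Rightarrow> complex) set \<Rightarrow> 'a \<Rightarrow> bool" where
  "gns_bounded A F x \<longleftrightarrow> (\<exists>C\<ge>0. \<forall>\<omega>\<in>F. \<forall>y\<in>carrier A.
     Re (\<omega> (adj A (x \<otimes>\<^bsub>A\<^esub> y) \<otimes>\<^bsub>A\<^esub> (x \<otimes>\<^bsub>A\<^esub> y))) \<le> C\<^sup>2 * Re (\<omega> (adj A y \<otimes>\<^bsub>A\<^esub> y)))"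

locale functional_family = star_alg A for A :: "('a, 'm) star_algebra_scheme" (structure) +
  fixes F :: "('a \<Rightarrow> complex) set"
  assumes fam_pos: "\<omega> \<in> F \<Longrightarrow> positive_functional A \<omega>"
begin

lemma gns_bounded_iff:
  "gns_bounded A F x \<longleftrightarrow> (\<exists>C\<ge>0. \<forall>\<omega>\<in>F. \<forall>y\<in>carrier A.
     positive_functional.om_norm A \<omega> (x \<otimes> y) \<le> C * positive_functional.om_norm A \<omega> y)"
  if x: "x \<in> carrier A"
proof -
  have "Re (\<omega> (adj A (x \<otimes> y) \<otimes> (x \<otimes> y))) \<le> C\<^sup>2 * Re (\<omega> (adj A y \<otimes> y)) \<longleftrightarrow>
     positive_functional.om_norm A \<omega> (x \<otimes> y) \<le> C * positive_functional.om_norm A \<omega> y"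
    if "\<omega> \<in> F" "y \<in> carrier A" "C \<ge> 0" for \<omega> y C
  proof -
    interpret positive_functional A \<omega> using fam_pos that by blast
    have "om_norm (x \<otimes> y) \<le> C * om_norm y \<longleftrightarrow> (om_norm (x \<otimes> y))\<^sup>2 \<le> (C * om_norm y)\<^sup>2"
      using x that by (intro iffI power_mono) (auto intro: power2_le_imp_le)
    then show ?thesis using x that by (simp add: om_norm_sq power_mult_distrib)
  qed
  then show ?thesis unfolding gns_bounded_def by blast
qed

lemma gns_boundedI:
  assumes "x \<in> carrier A" "C \<ge> 0"
    and "\<And>\<omega> y. \<omega> \<in> F \<Longrightarrow> y \<in> carrier A \<Longrightarrow>
      positive_functional.om_norm A \<omega> (x \<otimes> y) \<le> C * positive_functional.om_norm A \<omega> y"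
  shows "gns_bounded A F x"
  unfolding gns_bounded_iff[OF assms(1)] using assms(2,3) by blast

lemma gns_boundedE:
  assumes "gns_bounded A F x" "x \<in> carrier A"
  obtains C where "C \<ge> 0"
    "\<And>\<omega> y. \<omega> \<in> F \<Longrightarrow> y \<in> carrier A \<Longrightarrow>
      positive_functional.om_norm A \<omega> (x \<otimes> y) \<le> C * positive_functional.om_norm A \<omega> y"
  using assms(1) unfolding gns_bounded_iff[OF assms(2)] by blast

lemma gns_bounded_add:
  assumes a: "a \<in> carrier A" and b: "b \<in> carrier A" and "gns_bounded A F a" "gns_bounded A F b"
  shows "gns_bounded A F (a \<oplus> b)"
proof -
  obtain C where C: "C \<ge> 0" and leC: "\<And>\<omega> y. \<omega> \<in> F \<Longrightarrow> y \<in> carrier A \<Longrightarrow>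
      positive_functional.om_norm A \<omega> (a \<otimes> y) \<le> C * positive_functional.om_norm A \<omega> y"
    using gns_boundedE[OF assms(3) a] by blast
  obtain D where D: "D \<ge> 0" and leD: "\<And>\<omega> y. \<omega> \<in> F \<Longrightarrow> y \<in> carrier A \<Longrightarrow>
      positive_functional.om_norm A \<omega> (b \<otimes> y) \<le> D * positive_functional.om_norm A \<omega> y"
    using gns_boundedE[OF assms(4) b] by blast
  have "positive_functional.om_norm A \<omega> ((a \<oplus> b) \<otimes> y) \<le> (C + D) * positive_functional.om_norm A \<omega> y"
    if "\<omega> \<in> F" "y \<in> carrier A" for \<omega> y
  proof -
    interpret positive_functional A \<omega> using fam_pos that by blast
    have "om_norm ((a \<oplus> b) \<otimes> y) \<le> om_norm (a \<otimes> y) + om_norm (b \<otimes> y)"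
      using a b that om_norm_add[of "a \<otimes> y" "b \<otimes> y"] by (simp add: l_distr)
    also have "\<dots> \<le> C * om_norm y + D * om_norm y" using leC[OF that] leD[OF that] by (rule add_mono)
    finally show ?thesis by (simp add: algebra_simps)
  qed
  then show ?thesis using a b C D by (intro gns_boundedI[of _ "C + D"]) auto
qed

lemma gns_bounded_mult:
  assumes a: "a \<in> carrier A" and b: "b \<in> carrier A" and "gns_bounded A F a" "gns_bounded A F b"
  shows "gns_bounded A F (a \<otimes> b)"
proof -
  obtain C where C: "C \<ge> 0" and leC: "\<And>\<omega> y. \<omega> \<in> F \<Longrightarrow> y \<in> carrier A \<Longrightarrow>
      positive_functional.om_norm A \<omega> (a \<otimes> y) \<le> C * positive_functional.om_norm A \<omega> y"
    using gns_boundedE[OF assms(3) a] by blast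
  obtain D where D: "D \<ge> 0" and leD: "\<And>\<omega> y. \<omega> \<in> F \<Longrightarrow> y \<in> carrier A \<Longrightarrow>
      positive_functional.om_norm A \<omega> (b \<otimes> y) \<le> D * positive_functional.om_norm A \<omega> y"
    using gns_boundedE[OF assms(4) b] by blast
  have "positive_functional.om_norm A \<omega> ((a \<otimes> b) \<otimes> y) \<le> (C * D) * positive_functional.om_norm A \<omega> y"
    if "\<omega> \<in> F" "y \<in> carrier A" for \<omega> y
  proof -
    interpret positive_functional A \<omega> using fam_pos that by blast
    have "om_norm ((a \<otimes> b) \<otimes> y) \<le> C * om_norm (b \<otimes> y)"
      using leC[OF that(1), of "b \<otimes> y"] a b that by (simp add: m_assoc)
    also have "\<dots> \<le> C * (D * om_norm y)" using leD[OF that] C by (rule mult_left_mono)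
    finally show ?thesis by (simp add: algebra_simps)
  qed
  then show ?thesis using a b C D by (intro gns_boundedI[of _ "C * D"]) auto
qed

lemma gns_bounded_smult:
  assumes a: "a \<in> carrier A" and "gns_bounded A F a"
  shows "gns_bounded A F (c \<odot> a)"
proof -
  obtain C where C: "C \<ge> 0" and leC: "\<And>\<omega> y. \<omega> \<in> F \<Longrightarrow> y \<in> carrier A \<Longrightarrow>
      positive_functional.om_norm A \<omega> (a \<otimes> y) \<le> C * positive_functional.om_norm A \<omega> y"
    using gns_boundedE[OF assms(2) a] by blast
  have "positive_functional.om_norm A \<omega> ((c \<odot> a) \<otimes> y) \<le> (cmod c * C) * positive_functional.om_norm A \<omega> y"
    if "\<omega> \<in> F" "y \<in> carrier A" for \<omega> y
  proof -
    interpret positive_functional A \<omega> using fam_pos that by blast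
    have "om_norm ((c \<odot> a) \<otimes> y) = cmod c * om_norm (a \<otimes> y)"
      using a that by (simp add: smult_mult_l om_norm_smult)
    also have "\<dots> \<le> cmod c * (C * om_norm y)" using leC[OF that] by (intro mult_left_mono) auto
    finally show ?thesis by (simp add: algebra_simps)
  qed
  then show ?thesis using a C by (intro gns_boundedI[of _ "cmod c * C"]) auto
qed

lemma gns_bounded_zero: "gns_bounded A F \<zero>"
proof -
  have "Re (\<omega> (adj A (\<zero> \<otimes> y) \<otimes> (\<zero> \<otimes> y))) = 0" if "\<omega> \<in> F" "y \<in> carrier A" for \<omega> y
  proof -
    interpret positive_functional A \<omega> using fam_pos that by blast
    show ?thesis using that by simp
  qed
  then show ?thesis unfolding gns_bounded_def by (intro exI[of _ 0]) auto
qed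

end

locale gns_family = functional_family +
  assumes fam_ne: "F \<noteq> {}"
    and fam_one: "\<omega> \<in> F \<Longrightarrow> \<omega> \<one> = 1"
    and fam_bounded: "x \<in> carrier A \<Longrightarrow> gns_bounded A F x"
begin

lemma gns_norm_eq:
  "gns_norm A F x = Sup {positive_functional.om_norm A \<omega> (x \<otimes> y) | \<omega> y.
     \<omega> \<in> F \<and> y \<in> carrier A \<and> \<omega> (adj A y \<otimes> y) = 1}"
proof -
  have "{positive_functional.om_norm A \<omega> (x \<otimes> y) | \<omega> y.
     \<omega> \<in> F \<and> y \<in> carrier A \<and> \<omega> (adj A y \<otimes> y) = 1} =
     {sqrt (Re (\<omega> (adj A (x \<otimes> y) \<otimes> (x \<otimes> y)))) | \<omega> y.
     \<omega> \<in> F \<and> y \<in> carrier A \<and> \<omega> (adj A y \<otimes> y) = 1}"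
    using positive_functional.om_norm_def[OF fam_pos] by (intro Collect_cong) metis
  then show ?thesis by (simp add: gns_norm_def)
qed

lemma om_norm_1: "\<omega> \<in> F \<Longrightarrow> \<omega> (adj A y \<otimes> y) = 1 \<Longrightarrow> positive_functional.om_norm A \<omega> y = 1"
  by (simp add: positive_functional.om_norm_def[OF fam_pos])

text \<open>The supremum tests unit vectors only, so \<open>y\<close> is rescaled. If
  \<open>y\<close> has length 0 there is nothing to rescale; then uniform boundedness shows that
  \<open>x \<otimes> y\<close> has length 0 as well.\<close>

lemma gns_norm_bound:
  assumes x: "x \<in> carrier A" and om: "\<omega> \<in> F" and y: "y \<in> carrier A"
  shows "positive_functional.om_norm A \<omega> (x \<otimes> y) \<le> gns_norm A F x * positive_functional.om_norm A \<omega> y"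
proof -
  obtain C where C: "C \<ge> 0" and le: "\<And>\<omega> y. \<omega> \<in> F \<Longrightarrow> y \<in> carrier A \<Longrightarrow>
      positive_functional.om_norm A \<omega> (x \<otimes> y) \<le> C * positive_functional.om_norm A \<omega> y"
    using gns_boundedE[OF fam_bounded[OF x] x] by blast
  interpret positive_functional A \<omega> using fam_pos om by blast
  show ?thesis
  proof (cases "om_norm y = 0")
    case True
    then have "om_norm (x \<otimes> y) \<le> 0" using le[OF om y] by simp
    then show ?thesis using True by simp
  next
    case False
    then have pos: "om_norm y > 0" using om_norm_nonneg[OF y] by linarith
    define y' where "y' = complex_of_real (1 / om_norm y) \<odot> y"
    have y': "y' \<in> carrier A" using y by (simp add: y'_def)
    have n1: "om_norm y' = 1" using pos y by (simp add: y'_def om_norm_smult norm_divide)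
    have "Re (\<omega> (adj A y' \<otimes> y')) = 1" using om_norm_sq[OF y'] n1 by simp
    then have one: "\<omega> (adj A y' \<otimes> y') = 1" using om_pos'(2)[OF y'] by (simp add: complex_eq_iff)
    have "om_norm (x \<otimes> y') \<le> gns_norm A F x" unfolding gns_norm_eq
    proof (rule cSup_upper)
      show "om_norm (x \<otimes> y') \<in> {positive_functional.om_norm A \<omega> (x \<otimes> y) | \<omega> y.
         \<omega> \<in> F \<and> y \<in> carrier A \<and> \<omega> (adj A y \<otimes> y) = 1}"
        using om y' one by blast
      show "bdd_above {positive_functional.om_norm A \<omega> (x \<otimes> y) | \<omega> y.
         \<omega> \<in> F \<and> y \<in> carrier A \<and> \<omega> (adj A y \<otimes> y) = 1}"
        using le om_norm_1 by (intro bdd_aboveI[of _ C]) force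
    qed
    moreover have "om_norm (x \<otimes> y') = 1 / om_norm y * om_norm (x \<otimes> y)"
      using pos x y by (simp add: y'_def om_norm_smult smult_mult_r norm_divide)
    ultimately show ?thesis using pos by (simp add: field_simps)
  qed
qed

lemma gns_norm_least:
  assumes x: "x \<in> carrier A"
    and le: "\<And>\<omega> y. \<omega> \<in> F \<Longrightarrow> y \<in> carrier A \<Longrightarrow> \<omega> (adj A y \<otimes> y) = 1 \<Longrightarrow>
      positive_functional.om_norm A \<omega> (x \<otimes> y) \<le> c"
  shows "gns_norm A F x \<le> c"
  unfolding gns_norm_eq
proof (rule cSup_least)
  obtain \<omega> where "\<omega> \<in> F" using fam_ne by blast
  then have "\<omega> \<in> F \<and> \<one> \<in> carrier A \<and> \<omega> (adj A \<one> \<otimes> \<one>) = 1" using fam_one by simp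
  then show "{positive_functional.om_norm A \<omega> (x \<otimes> y) | \<omega> y.
         \<omega> \<in> F \<and> y \<in> carrier A \<and> \<omega> (adj A y \<otimes> y) = 1} \<noteq> {}" by blast
qed (use le in blast)

lemma gns_norm_om:
  assumes "x \<in> carrier A" "\<omega> \<in> F"
  shows "positive_functional.om_norm A \<omega> x \<le> gns_norm A F x"
  using gns_norm_bound[OF assms one_closed] fam_one[OF assms(2)] om_norm_1[OF assms(2), of \<one>] assms(1)
  by simp

lemma gns_norm_state:
  assumes x: "x \<in> carrier A" and om: "\<omega> \<in> F"
  shows "cmod (\<omega> x) \<le> gns_norm A F x"
proof -
  interpret positive_functional A \<omega> using fam_pos om by blast
  have "cmod (\<omega> (adj A \<one> \<otimes> x)) \<le> om_norm \<one> * om_norm x"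
    using x by (intro cauchy_schwarz') auto
  then show ?thesis using gns_norm_om[OF x om] x om_norm_1[OF om, of \<one>] fam_one[OF om] by simp
qed

lemma gns_norm_nonneg: "x \<in> carrier A \<Longrightarrow> 0 \<le> gns_norm A F x"
proof -
  assume x: "x \<in> carrier A"
  obtain \<omega> where om: "\<omega> \<in> F" using fam_ne by blast
  show ?thesis using gns_norm_om[OF x om] positive_functional.om_norm_nonneg[OF fam_pos[OF om] x] by linarith
qed

lemma gns_cstar_seminorm: "cstar_seminorm A (gns_norm A F)"
proof (rule cstar_seminormI)
  show "gns_norm A F (a \<oplus> b) \<le> gns_norm A F a + gns_norm A F b" if a: "a \<in> carrier A" "b \<in> carrier A" for a b
  proof (rule gns_norm_least)
    fix \<omega> y assume om: "\<omega> \<in> F" and y: "y \<in> carrier A" "\<omega> (adj A y \<otimes> y) = 1"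
    interpret positive_functional A \<omega> using fam_pos om by blast
    have "om_norm ((a \<oplus> b) \<otimes> y) \<le> om_norm (a \<otimes> y) + om_norm (b \<otimes> y)"
      using a y om_norm_add[of "a \<otimes> y" "b \<otimes> y"] by (simp add: l_distr)
    then show "om_norm ((a \<oplus> b) \<otimes> y) \<le> gns_norm A F a + gns_norm A F b"
      using gns_norm_bound[OF a(1) om y(1)] gns_norm_bound[OF a(2) om y(1)] om_norm_1[OF om y(2)] by simp
  qed (use a in simp)
  show "gns_norm A F (c \<odot> a) \<le> cmod c * gns_norm A F a" if a: "a \<in> carrier A" for a c
  proof (rule gns_norm_least)
    fix \<omega> y assume om: "\<omega> \<in> F" and y: "y \<in> carrier A" "\<omega> (adj A y \<otimes> y) = 1"
    interpret positive_functional A \<omega> using fam_pos om by blast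
    show "om_norm ((c \<odot> a) \<otimes> y) \<le> cmod c * gns_norm A F a"
      using gns_norm_bound[OF a om y(1)] om_norm_1[OF om y(2)] a y
      by (simp add: smult_mult_l om_norm_smult mult_left_mono)
  qed (use a in simp)
  show "gns_norm A F (a \<otimes> b) \<le> gns_norm A F a * gns_norm A F b" if a: "a \<in> carrier A" "b \<in> carrier A" for a b
  proof (rule gns_norm_least)
    fix \<omega> y assume om: "\<omega> \<in> F" and y: "y \<in> carrier A" "\<omega> (adj A y \<otimes> y) = 1"
    interpret positive_functional A \<omega> using fam_pos om by blast
    have "om_norm (a \<otimes> (b \<otimes> y)) \<le> gns_norm A F a * om_norm (b \<otimes> y)"
      using gns_norm_bound[OF a(1) om, of "b \<otimes> y"] a y by simp
    also have "\<dots> \<le> gns_norm A F a * gns_norm A F b"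
      using gns_norm_bound[OF a(2) om y(1)] om_norm_1[OF om y(2)] gns_norm_nonneg[OF a(1)]
      by (intro mult_left_mono) auto
    finally show "om_norm ((a \<otimes> b) \<otimes> y) \<le> gns_norm A F a * gns_norm A F b"
      using a y by (simp add: m_assoc)
  qed (use a in simp)
  show "(gns_norm A F a)\<^sup>2 \<le> gns_norm A F (adj A a \<otimes> a)" if a: "a \<in> carrier A" for a
  proof -
    have "gns_norm A F a \<le> sqrt (gns_norm A F (adj A a \<otimes> a))"
    proof (rule gns_norm_least)
      fix \<omega> y assume om: "\<omega> \<in> F" and y: "y \<in> carrier A" "\<omega> (adj A y \<otimes> y) = 1"
      interpret positive_functional A \<omega> using fam_pos om by blast
      have "(om_norm (a \<otimes> y))\<^sup>2 = Re (\<omega> (adj A y \<otimes> ((adj A a \<otimes> a) \<otimes> y)))"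
        using a y by (simp add: om_norm_sq adj_mult m_assoc)
      also have "\<dots> \<le> cmod (\<omega> (adj A y \<otimes> ((adj A a \<otimes> a) \<otimes> y)))" by (rule complex_Re_le_cmod)
      also have "\<dots> \<le> om_norm y * om_norm ((adj A a \<otimes> a) \<otimes> y)"
        using a y by (intro cauchy_schwarz') auto
      also have "\<dots> \<le> gns_norm A F (adj A a \<otimes> a)"
        using gns_norm_bound[OF _ om y(1), of "adj A a \<otimes> a"] om_norm_1[OF om y(2)] a by simp
      finally show "om_norm (a \<otimes> y) \<le> sqrt (gns_norm A F (adj A a \<otimes> a))" by (rule real_le_rsqrt)
    qed (use a in simp)
    then have "(gns_norm A F a)\<^sup>2 \<le> (sqrt (gns_norm A F (adj A a \<otimes> a)))\<^sup>2"
      using gns_norm_nonneg[OF a] by (rule power_mono)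
    also have "\<dots> = gns_norm A F (adj A a \<otimes> a)" using gns_norm_nonneg[of "adj A a \<otimes> a"] a by simp
    finally show ?thesis .
  qed
qed (rule gns_norm_nonneg)

end

section \<open>Completions\<close>

lemma (in star_alg) minus_minus_minus:
  assumes "a \<in> carrier A" "b \<in> carrier A" "c \<in> carrier A"
  shows "(a \<ominus> c) \<ominus> (b \<ominus> c) = a \<ominus> b"
  using assms by algebra

context cstar_seminormed
begin

abbreviation "CS \<equiv> cauchy_seqs A p"
abbreviation "cl \<equiv> cauchy_class A p"
abbreviation "Q \<equiv> completion A p"
abbreviation "emb \<equiv> completion_embed A p"

lemma cs_closed [simp]: "X \<in> CS \<Longrightarrow> X k \<in> carrier A"
  by (simp add: cauchy_seqs_def)

lemma cs_cauchy: "X \<in> CS \<Longrightarrow> e > 0 \<Longrightarrow> \<exists>N. \<forall>i\<ge>N. \<forall>j\<ge>N. p (X i \<ominus> X j) < e"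
  unfolding cauchy_seqs_def mem_Collect_eq by (drule conjunct2) (drule spec, erule mp)

lemma csI:
  assumes "\<And>k. X k \<in> carrier A" "\<And>e. e > 0 \<Longrightarrow> \<exists>N. \<forall>i\<ge>N. \<forall>j\<ge>N. p (X i \<ominus> X j) < e"
  shows "X \<in> CS"
  unfolding cauchy_seqs_def mem_Collect_eq by (intro conjI allI impI assms)

lemma cs_const [simp]: "a \<in> carrier A \<Longrightarrow> (\<lambda>k. a) \<in> CS"
  by (rule csI) simp_all

lemma cs_combine:
  assumes X: "X \<in> CS" and Y: "Y \<in> CS" and Z: "\<And>k. Z k \<in> carrier A" and C: "0 \<le> C" "0 \<le> D"
    and le: "\<And>i j. p (Z i \<ominus> Z j) \<le> C * p (X i \<ominus> X j) + D * p (Y i \<ominus> Y j)"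
  shows "Z \<in> CS"
proof -
  have "\<exists>N. \<forall>i\<ge>N. \<forall>j\<ge>N. p (Z i \<ominus> Z j) < e" if e: "e > 0" for e
  proof -
    \<comment> \<open>The summand 1 keeps the denominator positive when both coefficients vanish,
      and it makes the final inequality strict.\<close>
    define d where "d = e / (C + D + 1)"
    have d: "d > 0" using e C by (simp add: d_def)
    obtain M N where M: "\<And>i j. i \<ge> M \<Longrightarrow> j \<ge> M \<Longrightarrow> p (X i \<ominus> X j) < d"
      and N: "\<And>i j. i \<ge> N \<Longrightarrow> j \<ge> N \<Longrightarrow> p (Y i \<ominus> Y j) < d"
      using cs_cauchy[OF X d] cs_cauchy[OF Y d] by metis
    have "p (Z i \<ominus> Z j) < e" if ij: "i \<ge> max M N" "j \<ge> max M N" for i j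
    proof -
      have "p (Z i \<ominus> Z j) \<le> C * d + D * d"
        using le[of i j] mult_left_mono[OF less_imp_le[OF M[of i j]] C(1)]
          mult_left_mono[OF less_imp_le[OF N[of i j]] C(2)] ij by simp
      also have "\<dots> < (C + D + 1) * d" using d by (simp add: algebra_simps)
      also have "\<dots> = e" using C by (simp add: d_def)
      finally show ?thesis .
    qed
    then show ?thesis by blast
  qed
  with Z show ?thesis by (rule csI)
qed

lemma cs_p_convergent:
  assumes X: "X \<in> CS"
  shows "convergent (\<lambda>k. p (X k))"
proof -
  have "Cauchy (\<lambda>k. p (X k))"
  proof (rule CauchyI)
    fix e :: real assume "e > 0"
    then obtain N where N: "\<And>i j. i \<ge> N \<Longrightarrow> j \<ge> N \<Longrightarrow> p (X i \<ominus> X j) < e"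
      using cs_cauchy[OF X] by blast
    have "norm (p (X i) - p (X j)) < e" if "i \<ge> N" "j \<ge> N" for i j
      using p_diff[of "X i" "X j"] N[OF that] X by simp
    then show "\<exists>M. \<forall>m\<ge>M. \<forall>n\<ge>M. norm (p (X m) - p (X n)) < e" by blast
  qed
  then show ?thesis by (simp add: Cauchy_convergent_iff)
qed

lemma cs_bounded:
  assumes X: "X \<in> CS"
  obtains M where "M > 0" "\<And>k. p (X k) \<le> M"
proof -
  obtain M where "M > 0" "\<forall>k. norm (p (X k)) \<le> M"
    using convergent_imp_Bseq[OF cs_p_convergent[OF X]] by (auto simp: Bseq_def)
  then show thesis using that by (metis abs_le_D1 real_norm_def)
qed

lemma cs_add: "X \<in> CS \<Longrightarrow> Y \<in> CS \<Longrightarrow> (\<lambda>k. X k \<oplus> Y k) \<in> CS"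
proof (rule cs_combine[of X Y _ 1 1])
  fix i j assume "X \<in> CS" "Y \<in> CS"
  then show "p ((X i \<oplus> Y i) \<ominus> (X j \<oplus> Y j)) \<le> 1 * p (X i \<ominus> X j) + 1 * p (Y i \<ominus> Y j)"
    using p_add[of "X i \<ominus> X j" "Y i \<ominus> Y j"] by (simp add: add_minus_add)
qed simp_all

lemma cs_smult: "X \<in> CS \<Longrightarrow> (\<lambda>k. c \<odot> X k) \<in> CS"
  by (rule cs_combine[of X X _ "cmod c" 0]) (simp_all flip: smult_diff add: p_smult)

lemma cs_adj: "X \<in> CS \<Longrightarrow> (\<lambda>k. adj A (X k)) \<in> CS"
  by (rule cs_combine[of X X _ 1 0]) (simp_all flip: adj_minus)

lemma cs_minus: "X \<in> CS \<Longrightarrow> Y \<in> CS \<Longrightarrow> (\<lambda>k. X k \<ominus> Y k) \<in> CS"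
  using cs_add[OF _ cs_smult[of Y "-1"], of X] by (simp add: minus_eq_smult)

lemma p_mult_minus:
  assumes "a \<in> carrier A" "b \<in> carrier A" "c \<in> carrier A" "d \<in> carrier A"
  shows "p (a \<otimes> b \<ominus> c \<otimes> d) \<le> p b * p (a \<ominus> c) + p c * p (b \<ominus> d)"
proof -
  have "p (a \<otimes> b \<ominus> c \<otimes> d) \<le> p ((a \<ominus> c) \<otimes> b) + p (c \<otimes> (b \<ominus> d))"
    unfolding mult_minus_mult[OF assms] using assms by (intro p_add) simp_all
  then show ?thesis using p_mult[of "a \<ominus> c" b] p_mult[of c "b \<ominus> d"] assms by (simp add: mult.commute)
qed

lemma p_mult_minus_le:
  assumes "a \<in> carrier A" "b \<in> carrier A" "c \<in> carrier A" "d \<in> carrier A" "p b \<le> N" "p c \<le> M"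
  shows "p (a \<otimes> b \<ominus> c \<otimes> d) \<le> N * p (a \<ominus> c) + M * p (b \<ominus> d)"
  using p_mult_minus[OF assms(1-4)] mult_right_mono[OF assms(5) p_nonneg[of "a \<ominus> c"]]
    mult_right_mono[OF assms(6) p_nonneg[of "b \<ominus> d"]] assms(1-4) by simp

lemma cs_mult:
  assumes X: "X \<in> CS" and Y: "Y \<in> CS"
  shows "(\<lambda>k. X k \<otimes> Y k) \<in> CS"
proof -
  obtain M where M: "M > 0" "\<And>k. p (X k) \<le> M" using cs_bounded[OF X] by blast
  obtain N where N: "N > 0" "\<And>k. p (Y k) \<le> N" using cs_bounded[OF Y] by blast
  show ?thesis
    by (rule cs_combine[OF X Y, of _ N M])
      (use M N X Y in \<open>simp_all add: p_mult_minus_le\<close>)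
qed

definition null_diff :: "(nat \<Rightarrow> 'a) \<Rightarrow> (nat \<Rightarrow> 'a) \<Rightarrow> bool" where
  "null_diff X Y \<longleftrightarrow> (\<lambda>k. p (X k \<ominus> Y k)) \<longlonglongrightarrow> 0"

lemma null_combine:
  assumes XY: "null_diff X X'" "null_diff Y Y'"
    and Z: "\<And>k. Z k \<in> carrier A" "\<And>k. Z' k \<in> carrier A"
    and le: "\<And>k. p (Z k \<ominus> Z' k) \<le> C * p (X k \<ominus> X' k) + D * p (Y k \<ominus> Y' k)"
  shows "null_diff Z Z'"
  unfolding null_diff_def
proof (rule tendsto_sandwich)
    show "(\<lambda>k. 0) \<longlonglongrightarrow> (0::real)" by simp
  show "(\<lambda>k. C * p (X k \<ominus> X' k) + D * p (Y k \<ominus> Y' k)) \<longlonglongrightarrow> 0"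
    using tendsto_add[OF tendsto_mult[OF tendsto_const[of C] XY(1)[unfolded null_diff_def]]
        tendsto_mult[OF tendsto_const[of D] XY(2)[unfolded null_diff_def]]] by simp
qed (use le Z in simp_all)

lemma null_sym: "X \<in> CS \<Longrightarrow> Y \<in> CS \<Longrightarrow> null_diff X Y \<Longrightarrow> null_diff Y X"
  unfolding null_diff_def by (simp add: p_minus_commute[of "Y _" "X _"])

lemma null_trans: "X \<in> CS \<Longrightarrow> Y \<in> CS \<Longrightarrow> Z \<in> CS \<Longrightarrow> null_diff X Y \<Longrightarrow> null_diff Y Z \<Longrightarrow> null_diff X Z"
  by (rule null_combine[of X Y Y Z _ _ 1 1]) (simp_all add: p_triangle)

lemma cl_mem: "Y \<in> cl X \<longleftrightarrow> Y \<in> CS \<and> null_diff X Y"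
  by (simp add: cauchy_class_def null_diff_def)

lemma cl_eq_iff:
  assumes X: "X \<in> CS" and Y: "Y \<in> CS"
  shows "cl X = cl Y \<longleftrightarrow> null_diff X Y"
proof
  assume eq: "cl X = cl Y"
  have "Y \<in> cl X" unfolding eq using Y by (simp add: cl_mem null_diff_def)
  then show "null_diff X Y" by (simp add: cl_mem)
next
  assume "null_diff X Y"
  then show "cl X = cl Y"
    using null_trans[OF X Y] null_trans[OF Y X] null_sym[OF X Y] by (auto simp: cl_mem)
qed

text \<open>The operations of \<open>completion\<close> act on chosen representatives. Since the
  chosen one differs from \<open>X\<close> by a null sequence, each operation can afterwards be
  computed on any representative, as \<open>cl_add\<close>, \<open>cl_mult\<close>,
  \<open>cl_smult\<close> and \<open>cl_adj\<close> record.\<close>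

lemma rep_cl:
  assumes X: "X \<in> CS"
  shows "class_rep (cl X) \<in> CS" "null_diff X (class_rep (cl X))"
proof -
  have "X \<in> cl X" using X by (simp add: cl_mem null_diff_def)
  then have "class_rep (cl X) \<in> cl X" unfolding class_rep_def by (rule someI[of "\<lambda>Z. Z \<in> cl X"])
  then show "class_rep (cl X) \<in> CS" "null_diff X (class_rep (cl X))" by (simp_all add: cl_mem)
qed

lemma Q_carrier: "carrier Q = cl ` CS"
  by (simp add: completion_def)

lemma cl_in [simp]: "X \<in> CS \<Longrightarrow> cl X \<in> carrier Q"
  by (simp add: Q_carrier)

lemma Q_zero: "\<zero>\<^bsub>Q\<^esub> = cl (\<lambda>k. \<zero>)" and Q_one: "\<one>\<^bsub>Q\<^esub> = cl (\<lambda>k. \<one>)"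
  by (simp_all add: completion_def)

lemma cl_add:
  assumes X: "X \<in> CS" and Y: "Y \<in> CS"
  shows "cl X \<oplus>\<^bsub>Q\<^esub> cl Y = cl (\<lambda>k. X k \<oplus> Y k)"
proof -
  have "null_diff (\<lambda>k. class_rep (cl X) k \<oplus> class_rep (cl Y) k) (\<lambda>k. X k \<oplus> Y k)"
    using null_sym[OF X rep_cl[OF X]] null_sym[OF Y rep_cl[OF Y]]
  proof (rule null_combine[of _ _ _ _ _ _ 1 1])
    fix k
    show "p ((class_rep (cl X) k \<oplus> class_rep (cl Y) k) \<ominus> (X k \<oplus> Y k))
      \<le> 1 * p (class_rep (cl X) k \<ominus> X k) + 1 * p (class_rep (cl Y) k \<ominus> Y k)"
      using p_add[of "class_rep (cl X) k \<ominus> X k" "class_rep (cl Y) k \<ominus> Y k"] X Y rep_cl(1)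
      by (simp add: add_minus_add)
  qed (use X Y rep_cl(1) in simp_all)
  then show ?thesis using X Y rep_cl(1) cs_add by (simp add: completion_def cl_eq_iff)
qed

lemma cl_mult:
  assumes X: "X \<in> CS" and Y: "Y \<in> CS"
  shows "cl X \<otimes>\<^bsub>Q\<^esub> cl Y = cl (\<lambda>k. X k \<otimes> Y k)"
proof -
  obtain M where M: "M > 0" "\<And>k. p (X k) \<le> M" using cs_bounded[OF X] by blast
  obtain N where N: "N > 0" "\<And>k. p (class_rep (cl Y) k) \<le> N" using cs_bounded[OF rep_cl(1)[OF Y]] by blast
  have "null_diff (\<lambda>k. class_rep (cl X) k \<otimes> class_rep (cl Y) k) (\<lambda>k. X k \<otimes> Y k)"
    by (rule null_combine[OF null_sym[OF X rep_cl[OF X]] null_sym[OF Y rep_cl[OF Y]], of _ _ N M])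
     (use X Y rep_cl(1) M N in \<open>simp_all add: p_mult_minus_le\<close>)
  then show ?thesis using X Y rep_cl(1) cs_mult by (simp add: completion_def cl_eq_iff)
qed

lemma cl_smult:
  assumes X: "X \<in> CS"
  shows "c \<odot>\<^bsub>Q\<^esub> cl X = cl (\<lambda>k. c \<odot> X k)"
proof -
  have "null_diff (\<lambda>k. c \<odot> class_rep (cl X) k) (\<lambda>k. c \<odot> X k)"
    by (rule null_combine[OF null_sym[OF X rep_cl[OF X]] null_sym[OF X rep_cl[OF X]], of _ _ "cmod c" 0])
     (use X rep_cl(1) in \<open>simp_all flip: smult_diff add: p_smult\<close>)
  then show ?thesis using X rep_cl(1) cs_smult by (simp add: completion_def cl_eq_iff)
qed

lemma cl_adj:
  assumes X: "X \<in> CS"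
  shows "adj Q (cl X) = cl (\<lambda>k. adj A (X k))"
proof -
  have "null_diff (\<lambda>k. adj A (class_rep (cl X) k)) (\<lambda>k. adj A (X k))"
    by (rule null_combine[OF null_sym[OF X rep_cl[OF X]] null_sym[OF X rep_cl[OF X]], of _ _ 1 0])
     (use X rep_cl(1) in \<open>simp_all flip: adj_minus\<close>)
  then show ?thesis using X rep_cl(1) cs_adj by (simp add: completion_def cl_eq_iff)
qed

text \<open>Applied to the seminorm itself and to bounded functionals, both of which the completion
  evaluates along a chosen representative. The contraction property makes that sequence of values
  Cauchy and its limit independent of the choice.\<close>

lemma lim_cl:
  fixes f :: "'a \<Rightarrow> 'c :: banach"
  assumes X: "X \<in> CS"
    and f: "\<And>a b. a \<in> carrier A \<Longrightarrow> b \<in> carrier A \<Longrightarrow> norm (f a - f b) \<le> p (a \<ominus> b)"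
  shows "(\<lambda>k. f (X k)) \<longlonglongrightarrow> lim (\<lambda>k. f (class_rep (cl X) k))"
proof -
  let ?Y = "class_rep (cl X)"
  have Y: "?Y \<in> CS" using rep_cl[OF X] by simp
  have "Cauchy (\<lambda>k. f (?Y k))"
  proof (rule CauchyI)
    fix e :: real assume "e > 0"
    then obtain N where N: "\<And>i j. i \<ge> N \<Longrightarrow> j \<ge> N \<Longrightarrow> p (?Y i \<ominus> ?Y j) < e"
      using cs_cauchy[OF Y] by blast
    have "norm (f (?Y i) - f (?Y j)) < e" if "i \<ge> N" "j \<ge> N" for i j
      using f[of "?Y i" "?Y j"] N[OF that] Y by simp
    then show "\<exists>M. \<forall>m\<ge>M. \<forall>n\<ge>M. norm (f (?Y m) - f (?Y n)) < e" by blast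
  qed
  then have 1: "(\<lambda>k. f (?Y k)) \<longlonglongrightarrow> lim (\<lambda>k. f (?Y k))"
    by (simp add: Cauchy_convergent_iff convergent_LIMSEQ_iff)
  have "(\<lambda>k. f (X k) - f (?Y k)) \<longlonglongrightarrow> 0"
  proof (rule tendsto_norm_zero_cancel, rule tendsto_sandwich)
    show "(\<lambda>k. 0) \<longlonglongrightarrow> (0::real)" by simp
    show "(\<lambda>k. p (X k \<ominus> ?Y k)) \<longlonglongrightarrow> 0" using rep_cl(2)[OF X] by (simp add: null_diff_def)
  qed (use f X Y in simp_all)
  from tendsto_add[OF this 1] show ?thesis by simp
qed

lemma nrm_cl:
  assumes X: "X \<in> CS"
  shows "(\<lambda>k. p (X k)) \<longlonglongrightarrow> nrm Q (cl X)"
  using lim_cl[OF X, of p] p_diff by (simp add: completion_def)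

lemma star_alg_completion: "star_alg Q"
proof -
  have ab: "abelian_group Q"
  proof (rule abelian_groupI)
    fix x assume "x \<in> carrier Q"
    then obtain X where X: "X \<in> CS" "x = cl X" by (auto simp: Q_carrier)
    have "cl (\<lambda>k. (-1) \<odot> X k) \<oplus>\<^bsub>Q\<^esub> x = \<zero>\<^bsub>Q\<^esub>"
      using X cs_smult[of X "-1"] by (simp add: cl_add Q_zero smult_minus l_neg)
    then show "\<exists>y\<in>carrier Q. y \<oplus>\<^bsub>Q\<^esub> x = \<zero>\<^bsub>Q\<^esub>" using cs_smult[OF X(1)] cl_in by blast
  qed (auto simp: Q_carrier Q_zero cl_add cs_add a_ac)
  have mo: "monoid Q"
    by (rule monoidI) (auto simp: Q_carrier Q_one cl_mult cs_mult m_assoc)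
  have ri: "ring Q"
    by (rule ringI[OF ab mo]) (auto simp: Q_carrier cl_mult cl_add cs_add cs_mult l_distr r_distr)
  show ?thesis
    by (intro star_alg.intro[OF ri] star_alg_axioms.intro)
      (auto simp: Q_carrier cl_mult cl_add cl_smult cl_adj cs_add cs_mult cs_smult cs_adj
        smult_l_distr smult_r_distr smult_smult smult_mult_l smult_mult_r adj_add adj_smult adj_mult)
qed

sublocale Q: star_alg Q by (rule star_alg_completion)

lemma cl_minus:
  assumes X: "X \<in> CS" and Y: "Y \<in> CS"
  shows "cl X \<ominus>\<^bsub>Q\<^esub> cl Y = cl (\<lambda>k. X k \<ominus> Y k)"
  using X Y cs_smult[OF Y] by (simp add: Q.minus_eq_smult minus_eq_smult cl_smult cl_add)

lemma nrm_eqI: "X \<in> CS \<Longrightarrow> (\<lambda>k. p (X k)) \<longlonglongrightarrow> r \<Longrightarrow> nrm Q (cl X) = r"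
  using nrm_cl LIMSEQ_unique by blast

lemma cstar_seminorm_completion: "cstar_seminorm Q (nrm Q)"
proof (rule Q.cstar_seminormI)
  fix a assume "a \<in> carrier Q"
  then obtain X where X: "X \<in> CS" "a = cl X" by (auto simp: Q_carrier)
  show "0 \<le> nrm Q a"
    unfolding X(2) by (rule LIMSEQ_le_const[OF nrm_cl[OF X(1)]]) (use X in simp)
  show "nrm Q (c \<odot>\<^bsub>Q\<^esub> a) \<le> cmod c * nrm Q a" for c
    using nrm_eqI[OF cs_smult[OF X(1)], of c "cmod c * nrm Q a"] nrm_cl[OF X(1)] X
    by (simp add: cl_smult p_smult tendsto_mult_left)
  have "nrm Q (adj Q a \<otimes>\<^bsub>Q\<^esub> a) = (nrm Q a)\<^sup>2"
    using nrm_eqI[OF cs_mult[OF cs_adj[OF X(1)] X(1)], of "(nrm Q a)\<^sup>2"] nrm_cl[OF X(1)] X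
    by (simp add: cl_adj cl_mult cs_adj p_cstar tendsto_power)
  then show "(nrm Q a)\<^sup>2 \<le> nrm Q (adj Q a \<otimes>\<^bsub>Q\<^esub> a)" by simp
next
  fix a b assume "a \<in> carrier Q" "b \<in> carrier Q"
  then obtain X Y where X: "X \<in> CS" "a = cl X" and Y: "Y \<in> CS" "b = cl Y"
    by (auto simp: Q_carrier)
  show "nrm Q (a \<oplus>\<^bsub>Q\<^esub> b) \<le> nrm Q a + nrm Q b"
    unfolding X(2) Y(2) cl_add[OF X(1) Y(1)]
    by (rule LIMSEQ_le[OF nrm_cl[OF cs_add[OF X(1) Y(1)]] tendsto_add[OF nrm_cl[OF X(1)] nrm_cl[OF Y(1)]]])
      (use X Y in \<open>simp add: p_add\<close>)
  show "nrm Q (a \<otimes>\<^bsub>Q\<^esub> b) \<le> nrm Q a * nrm Q b"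
    unfolding X(2) Y(2) cl_mult[OF X(1) Y(1)]
    by (rule LIMSEQ_le[OF nrm_cl[OF cs_mult[OF X(1) Y(1)]] tendsto_mult[OF nrm_cl[OF X(1)] nrm_cl[OF Y(1)]]])
      (use X Y in \<open>simp add: p_mult\<close>)
qed

lemma cstar_seminormed_completion: "cstar_seminormed Q (nrm Q)"
  by (intro cstar_seminormed.intro star_alg_completion cstar_seminormed_axioms.intro cstar_seminorm_completion)

lemma nrm_definite:
  assumes "a \<in> carrier Q" "b \<in> carrier Q" "nrm Q (a \<ominus>\<^bsub>Q\<^esub> b) = 0"
  shows "a = b"
proof -
  obtain X Y where X: "X \<in> CS" "a = cl X" and Y: "Y \<in> CS" "b = cl Y"
    using assms(1,2) by (auto simp: Q_carrier)
  have "null_diff X Y"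
    using nrm_cl[OF cs_minus[OF X(1) Y(1)]] assms(3) X Y by (simp add: null_diff_def cl_minus)
  then show ?thesis using X Y by (simp add: cl_eq_iff)
qed

lemma emb_closed [simp]: "a \<in> carrier A \<Longrightarrow> emb a \<in> carrier Q"
  by (simp add: completion_embed_def)

lemma emb_add: "a \<in> carrier A \<Longrightarrow> b \<in> carrier A \<Longrightarrow> emb (a \<oplus> b) = emb a \<oplus>\<^bsub>Q\<^esub> emb b"
  and emb_mult: "a \<in> carrier A \<Longrightarrow> b \<in> carrier A \<Longrightarrow> emb (a \<otimes> b) = emb a \<otimes>\<^bsub>Q\<^esub> emb b"
  and emb_minus: "a \<in> carrier A \<Longrightarrow> b \<in> carrier A \<Longrightarrow> emb (a \<ominus> b) = emb a \<ominus>\<^bsub>Q\<^esub> emb b"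
  and emb_smult: "a \<in> carrier A \<Longrightarrow> emb (c \<odot> a) = c \<odot>\<^bsub>Q\<^esub> emb a"
  and emb_adj: "a \<in> carrier A \<Longrightarrow> emb (adj A a) = adj Q (emb a)"
  and emb_one: "emb \<one> = \<one>\<^bsub>Q\<^esub>"
  and emb_zero: "emb \<zero> = \<zero>\<^bsub>Q\<^esub>"
  by (simp_all add: completion_embed_def cl_add cl_mult cl_minus cl_smult cl_adj Q_one Q_zero)

lemma nrm_emb: "a \<in> carrier A \<Longrightarrow> nrm Q (emb a) = p a"
  unfolding completion_embed_def by (rule nrm_eqI) simp_all

lemma emb_eqI: "a \<in> carrier A \<Longrightarrow> b \<in> carrier A \<Longrightarrow> p (a \<ominus> b) = 0 \<Longrightarrow> emb a = emb b"
  by (rule nrm_definite) (simp_all flip: emb_minus add: nrm_emb)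

lemma emb_dense:
  assumes "a \<in> carrier Q" "e > 0"
  obtains x where "x \<in> carrier A" "nrm Q (a \<ominus>\<^bsub>Q\<^esub> emb x) \<le> e"
proof -
  obtain X where X: "X \<in> CS" "a = cl X" using assms by (auto simp: Q_carrier)
  obtain N where N: "\<And>i j. i \<ge> N \<Longrightarrow> j \<ge> N \<Longrightarrow> p (X i \<ominus> X j) < e"
    using cs_cauchy[OF X(1) assms(2)] by blast
  have "nrm Q (cl X \<ominus>\<^bsub>Q\<^esub> emb (X N)) \<le> e"
  proof (rule LIMSEQ_le_const2)
    show "(\<lambda>k. p (X k \<ominus> X N)) \<longlonglongrightarrow> nrm Q (cl X \<ominus>\<^bsub>Q\<^esub> emb (X N))"
      using X nrm_cl[OF cs_minus[OF X(1) cs_const[of "X N"]]] by (simp add: completion_embed_def cl_minus)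
    show "\<exists>M. \<forall>k\<ge>M. p (X k \<ominus> X N) \<le> e"
      using N by (meson less_imp_le order_refl)
  qed
  then show thesis using that[of "X N"] X by simp
qed

section \<open>Extension of functionals to the completion\<close>

definition ext_functional :: "('a \<Rightarrow> complex) \<Rightarrow> (nat \<Rightarrow> 'a) set \<Rightarrow> complex" where
  "ext_functional f = (\<lambda>C\<in>carrier Q. lim (\<lambda>k. f (class_rep C k)))"

lemma ext_functional:
  assumes "positive_functional A f" and bdd: "\<And>a. a \<in> carrier A \<Longrightarrow> cmod (f a) \<le> p a" and f1: "f \<one> = 1"
  shows "ext_functional f \<in> states Q"
    and "\<And>a. a \<in> carrier A \<Longrightarrow> ext_functional f (emb a) = f a"
proof -
  interpret f: positive_functional A f by fact
  have lim: "(\<lambda>k. f (X k)) \<longlonglongrightarrow> ext_functional f (cl X)" if "X \<in> CS" for X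
    using lim_cl[OF that, of f] bdd that by (simp add: ext_functional_def flip: f.om_minus)
  have eqI: "ext_functional f (cl X) = r" if "X \<in> CS" "(\<lambda>k. f (X k)) \<longlonglongrightarrow> r" for X r
    using lim[OF that(1)] that(2) LIMSEQ_unique by blast
  show *: "ext_functional f (emb a) = f a" if "a \<in> carrier A" for a
    unfolding completion_embed_def by (rule eqI) (use that in simp_all)
  have add: "ext_functional f (a \<oplus>\<^bsub>Q\<^esub> b) = ext_functional f a + ext_functional f b"
    if ab: "a \<in> carrier Q" "b \<in> carrier Q" for a b
  proof -
    obtain X Y where X: "X \<in> CS" "a = cl X" and Y: "Y \<in> CS" "b = cl Y"
      using ab by (auto simp: Q_carrier)
    show ?thesis using X Y tendsto_add[OF lim[OF X(1)] lim[OF Y(1)]]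
      by (simp add: cl_add f.om_add eqI cs_add)
  qed
  have "ext_functional f (c \<odot>\<^bsub>Q\<^esub> a) = c * ext_functional f a \<and>
    ext_functional f (adj Q a \<otimes>\<^bsub>Q\<^esub> a) \<in> \<real>\<^sub>\<ge>\<^sub>0 \<and> cmod (ext_functional f a) \<le> nrm Q a"
    if a: "a \<in> carrier Q" for a c
  proof -
    obtain X where X: "X \<in> CS" "a = cl X" using a by (auto simp: Q_carrier)
    have 1: "ext_functional f (c \<odot>\<^bsub>Q\<^esub> a) = c * ext_functional f a"
      using X tendsto_mult_left[OF lim[OF X(1)]] by (simp add: cl_smult f.om_smult eqI cs_smult)
    have l: "(\<lambda>k. f (adj A (X k) \<otimes> X k)) \<longlonglongrightarrow> ext_functional f (adj Q a \<otimes>\<^bsub>Q\<^esub> a)"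
      using lim[OF cs_mult[OF cs_adj[OF X(1)] X(1)]] X by (simp add: cl_adj cl_mult cs_adj)
    have "0 \<le> Re (ext_functional f (adj Q a \<otimes>\<^bsub>Q\<^esub> a))"
      by (rule LIMSEQ_le_const[OF tendsto_Re[OF l]]) (use X f.om_pos' in simp)
    moreover have "(\<lambda>k. Im (f (adj A (X k) \<otimes> X k))) = (\<lambda>k. 0)"
      using X f.om_pos' by simp
    then have "Im (ext_functional f (adj Q a \<otimes>\<^bsub>Q\<^esub> a)) = 0"
      using tendsto_Im[OF l] by (simp add: LIMSEQ_const_iff)
    moreover have "cmod (ext_functional f a) \<le> nrm Q a"
      unfolding X(2)
      by (rule LIMSEQ_le[OF tendsto_norm[OF lim[OF X(1)]] nrm_cl[OF X(1)]]) (use X bdd in simp)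
    ultimately show ?thesis using 1 by (simp add: complex_nonneg_Reals_iff)
  qed
  moreover have "ext_functional f \<one>\<^bsub>Q\<^esub> = 1" using *[of \<one>] f1 by (simp add: emb_one)
  moreover have "ext_functional f \<in> extensional (carrier Q)" by (simp add: ext_functional_def)
  ultimately show "ext_functional f \<in> states Q" using add unfolding states_def by simp
qed

lemma states_positive: "\<omega> \<in> states Q \<Longrightarrow> positive_functional Q \<omega>"
  by (intro positive_functional.intro star_alg_completion positive_functional_axioms.intro)
    (simp_all add: states_def)

text \<open>States are dominated by the norm, so agreement on the dense image of \<open>A\<close> is
  enough on the carrier; outside of it both are \<open>undefined\<close> by extensionality.\<close>

lemma states_eqI:
  assumes "\<omega> \<in> states Q" "\<omega>' \<in> states Q" and eq: "\<And>x. x \<in> carrier A \<Longrightarrow> \<omega> (emb x) = \<omega>' (emb x)"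
  shows "\<omega> = \<omega>'"
proof (rule extensionalityI[of _ "carrier Q"])
  show "\<omega> \<in> extensional (carrier Q)" "\<omega>' \<in> extensional (carrier Q)" using assms by (auto simp: states_def)
  fix a assume a: "a \<in> carrier Q"
  interpret o1: positive_functional Q \<omega> using states_positive assms by blast
  interpret o2: positive_functional Q \<omega>' using states_positive assms by blast
  have "cmod (\<omega> a - \<omega>' a) \<le> 0 + e" if e: "e > 0" for e
  proof -
    obtain x where x: "x \<in> carrier A" "nrm Q (a \<ominus>\<^bsub>Q\<^esub> emb x) \<le> e / 2"
      using emb_dense[OF a half_gt_zero[OF e]] by blast
    let ?d = "a \<ominus>\<^bsub>Q\<^esub> emb x"
    have "\<omega> a - \<omega>' a = \<omega> ?d - \<omega>' ?d"
      using a x eq by (simp add: o1.om_minus o2.om_minus)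
    also have "cmod \<dots> \<le> cmod (\<omega> ?d) + cmod (\<omega>' ?d)" by (rule norm_triangle_ineq4)
    also have "\<dots> \<le> e / 2 + e / 2"
      using assms x a by (intro add_mono order.trans[OF _ x(2)]) (simp_all add: states_def)
    finally show ?thesis by simp
  qed
  then have "cmod (\<omega> a - \<omega>' a) \<le> 0" by (rule field_le_epsilon)
  then show "\<omega> a = \<omega>' a" by simp
qed

end

section \<open>Homomorphisms and their extension to completions\<close>

locale star_alg_hom = A: star_alg A + B: star_alg B
  for A :: "('a, 'm) star_algebra_scheme" (structure) and B :: "('b, 'k) star_algebra_scheme" (structure) +
  fixes \<Phi> :: "'a \<Rightarrow> 'b"
  assumes hom_closed [simp]: "a \<in> carrier A \<Longrightarrow> \<Phi> a \<in> carrier B"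
    and hom_add: "a \<in> carrier A \<Longrightarrow> b \<in> carrier A \<Longrightarrow> \<Phi> (a \<oplus>\<^bsub>A\<^esub> b) = \<Phi> a \<oplus>\<^bsub>B\<^esub> \<Phi> b"
    and hom_mult: "a \<in> carrier A \<Longrightarrow> b \<in> carrier A \<Longrightarrow> \<Phi> (a \<otimes>\<^bsub>A\<^esub> b) = \<Phi> a \<otimes>\<^bsub>B\<^esub> \<Phi> b"
    and hom_smult: "a \<in> carrier A \<Longrightarrow> \<Phi> (c \<odot>\<^bsub>A\<^esub> a) = c \<odot>\<^bsub>B\<^esub> \<Phi> a"
    and hom_adj: "a \<in> carrier A \<Longrightarrow> \<Phi> (adj A a) = adj B (\<Phi> a)"
    and hom_one: "\<Phi> \<one>\<^bsub>A\<^esub> = \<one>\<^bsub>B\<^esub>"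
begin

lemma hom_minus: "a \<in> carrier A \<Longrightarrow> b \<in> carrier A \<Longrightarrow> \<Phi> (a \<ominus>\<^bsub>A\<^esub> b) = \<Phi> a \<ominus>\<^bsub>B\<^esub> \<Phi> b"
  by (simp add: A.minus_eq_smult B.minus_eq_smult hom_add hom_smult)

lemma hom_zero: "\<Phi> \<zero>\<^bsub>A\<^esub> = \<zero>\<^bsub>B\<^esub>"
  using hom_smult[of "\<zero>\<^bsub>A\<^esub>" 0] by simp

lemma hom_finsum:
  assumes "finite I" "\<And>i. i \<in> I \<Longrightarrow> f i \<in> carrier A"
  shows "\<Phi> (finsum A f I) = finsum B (\<lambda>i. \<Phi> (f i)) I"
  using assms
proof (induction I)
  case empty
  then show ?case by (simp add: hom_zero)
next
  case (insert i I)
  then have "f \<in> I \<rightarrow> carrier A" by auto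
  then show ?case using insert by (simp add: A.finsum_insert B.finsum_insert Pi_def hom_add)
qed

lemma pullback_cstar_seminorm:
  assumes "cstar_seminorm B q"
  shows "cstar_seminorm A (\<lambda>a. q (\<Phi> a))"
proof -
  interpret B: cstar_seminormed B q
    by (intro cstar_seminormed.intro B.star_alg_axioms cstar_seminormed_axioms.intro assms)
  show ?thesis
    by (rule A.cstar_seminormI)
      (simp_all add: hom_add hom_mult hom_smult hom_adj B.p_add B.p_mult B.p_smult B.p_cstar)
qed

end

lemma (in cstar_seminormed) star_alg_hom_emb: "star_alg_hom A Q emb"
  by (intro star_alg_hom.intro star_alg_axioms star_alg_completion star_alg_hom_axioms.intro)
    (simp_all add: emb_add emb_mult emb_smult emb_adj emb_one)

locale contractive_hom = star_alg_hom A B \<Phi> + A: cstar_seminormed A p + B: cstar_seminormed B q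
  for A :: "('a, 'm) star_algebra_scheme" (structure) and B :: "('b, 'k) star_algebra_scheme" (structure)
    and \<Phi> :: "'a \<Rightarrow> 'b" and p q +
  assumes contr: "a \<in> carrier A \<Longrightarrow> q (\<Phi> a) \<le> p a"
begin

definition ext_hom :: "(nat \<Rightarrow> 'a) set \<Rightarrow> (nat \<Rightarrow> 'b) set" where
  "ext_hom = (\<lambda>C\<in>carrier A.Q. B.cl (\<lambda>k. \<Phi> (class_rep C k)))"

lemma cs_image:
  assumes X: "X \<in> A.CS"
  shows "(\<lambda>k. \<Phi> (X k)) \<in> B.CS"
proof -
  have "q (\<Phi> (X i) \<ominus>\<^bsub>B\<^esub> \<Phi> (X j)) \<le> p (X i \<ominus>\<^bsub>A\<^esub> X j)" for i j
    using contr[of "X i \<ominus>\<^bsub>A\<^esub> X j"] X by (simp add: hom_minus)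
  then have "\<exists>N. \<forall>i\<ge>N. \<forall>j\<ge>N. q (\<Phi> (X i) \<ominus>\<^bsub>B\<^esub> \<Phi> (X j)) < e" if "e > 0" for e
    using A.cs_cauchy[OF X that] order.strict_trans1 by meson
  then show ?thesis using X by (intro B.csI) simp_all
qed

lemma ext_hom_cl:
  assumes X: "X \<in> A.CS"
  shows "ext_hom (A.cl X) = B.cl (\<lambda>k. \<Phi> (X k))"
proof -
  let ?Y = "class_rep (A.cl X)"
  have Y: "?Y \<in> A.CS" "A.null_diff X ?Y" using A.rep_cl[OF X] by auto
  have "B.null_diff (\<lambda>k. \<Phi> (X k)) (\<lambda>k. \<Phi> (?Y k))"
    unfolding B.null_diff_def
  proof (rule tendsto_sandwich)
    show "(\<lambda>k. 0) \<longlonglongrightarrow> (0::real)" by simp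
    show "(\<lambda>k. p (X k \<ominus>\<^bsub>A\<^esub> ?Y k)) \<longlonglongrightarrow> 0" using Y(2) by (simp add: A.null_diff_def)
    show "\<forall>\<^sub>F k in sequentially. q (\<Phi> (X k) \<ominus>\<^bsub>B\<^esub> \<Phi> (?Y k)) \<le> p (X k \<ominus>\<^bsub>A\<^esub> ?Y k)"
      using contr[of "X _ \<ominus>\<^bsub>A\<^esub> ?Y _"] X Y(1) by (simp add: hom_minus)
  qed (use X Y in simp)
  then show ?thesis
    using X Y B.null_sym[OF cs_image[OF X] cs_image[OF Y(1)]] by (simp add: ext_hom_def B.cl_eq_iff cs_image)
qed

lemma ext_hom_contr: "a \<in> carrier A.Q \<Longrightarrow> nrm B.Q (ext_hom a) \<le> nrm A.Q a"
proof -
  assume "a \<in> carrier A.Q"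
  then obtain X where X: "X \<in> A.CS" "a = A.cl X" by (auto simp: A.Q_carrier)
  show ?thesis unfolding X(2) ext_hom_cl[OF X(1)]
    by (rule LIMSEQ_le[OF B.nrm_cl[OF cs_image[OF X(1)]] A.nrm_cl[OF X(1)]]) (use X contr in simp)
qed

lemma ext_hom_star_hom: "ext_hom \<in> star_hom A.Q B.Q"
proof -
  have "ext_hom \<in> ring_hom A.Q B.Q"
    by (rule ring_hom_memI)
      (auto simp: A.Q_carrier A.cl_mult A.cl_add B.cl_mult B.cl_add A.cs_add A.cs_mult A.Q_one B.Q_one
         ext_hom_cl cs_image hom_add hom_mult hom_one)
  moreover have "ext_hom \<in> extensional (carrier A.Q)" by (simp add: ext_hom_def)
  moreover have "\<forall>c. \<forall>a\<in>carrier A.Q. ext_hom (c \<odot>\<^bsub>A.Q\<^esub> a) = c \<odot>\<^bsub>B.Q\<^esub> ext_hom a"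
    by (auto simp: A.Q_carrier A.cl_smult B.cl_smult A.cs_smult ext_hom_cl cs_image hom_smult)
  moreover have "\<forall>a\<in>carrier A.Q. ext_hom (adj A.Q a) = adj B.Q (ext_hom a)"
    by (auto simp: A.Q_carrier A.cl_adj B.cl_adj A.cs_adj ext_hom_cl cs_image hom_adj)
  moreover have "\<exists>C. \<forall>a\<in>carrier A.Q. nrm B.Q (ext_hom a) \<le> C * nrm A.Q a"
    using ext_hom_contr by (intro exI[of _ 1]) simp
  ultimately show ?thesis unfolding star_hom_def by simp
qed

lemma ext_hom_emb: "a \<in> carrier A \<Longrightarrow> ext_hom (A.emb a) = B.emb (\<Phi> a)"
  by (simp add: completion_embed_def ext_hom_cl)

end

lemma star_hom_imp_star_alg_hom:
  assumes "f \<in> star_hom A B" "star_alg A" "star_alg B"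
  shows "star_alg_hom A B f"
  using assms unfolding star_hom_def
  by (intro star_alg_hom.intro star_alg_hom_axioms.intro)
    (auto simp: ring_hom_closed ring_hom_add ring_hom_mult ring_hom_one)

lemma star_hom_eqI:
  assumes "cstar_seminormed A p" "cstar_seminormed B q"
    and f: "f \<in> star_hom (completion A p) (completion B q)"
    and g: "g \<in> star_hom (completion A p) (completion B q)"
    and eq: "\<And>x. x \<in> carrier A \<Longrightarrow> f (completion_embed A p x) = g (completion_embed A p x)"
  shows "f = g"
proof (rule extensionalityI[of _ "carrier (completion A p)"])
  interpret A: cstar_seminormed A p by fact
  interpret B: cstar_seminormed B q by fact
  interpret f: star_alg_hom A.Q B.Q f
    by (rule star_hom_imp_star_alg_hom[OF f A.star_alg_completion B.star_alg_completion])
  interpret g: star_alg_hom A.Q B.Q g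
    by (rule star_hom_imp_star_alg_hom[OF g A.star_alg_completion B.star_alg_completion])
  show "f \<in> extensional (carrier A.Q)" "g \<in> extensional (carrier A.Q)" using f g by (auto simp: star_hom_def)
  interpret AQ: cstar_seminormed A.Q "nrm A.Q" by (rule A.cstar_seminormed_completion)
  interpret BQ: cstar_seminormed B.Q "nrm B.Q" by (rule B.cstar_seminormed_completion)
  obtain C where C: "\<And>a. a \<in> carrier A.Q \<Longrightarrow> nrm B.Q (f a) \<le> C * nrm A.Q a" using f unfolding star_hom_def by blast
  obtain D where D: "\<And>a. a \<in> carrier A.Q \<Longrightarrow> nrm B.Q (g a) \<le> D * nrm A.Q a" using g unfolding star_hom_def by blast
  fix a assume a: "a \<in> carrier A.Q"
  have "nrm B.Q (f a \<ominus>\<^bsub>B.Q\<^esub> g a) \<le> 0 + e" if e: "e > 0" for e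
  proof -
    \<comment> \<open>The two bounds are unrelated and may be negative, hence the absolute values;
      the summand 1 keeps the denominator positive.\<close>
    define d where "d = e / (\<bar>C\<bar> + \<bar>D\<bar> + 1)"
    have d: "d > 0" using e by (simp add: d_def add_nonneg_pos)
    obtain x where x: "x \<in> carrier A" "nrm A.Q (a \<ominus>\<^bsub>A.Q\<^esub> A.emb x) \<le> d"
      using A.emb_dense[OF a d] by blast
    let ?r = "a \<ominus>\<^bsub>A.Q\<^esub> A.emb x"
    have r: "?r \<in> carrier A.Q" using a x by simp
    \<comment> \<open>\<open>f\<close> and \<open>g\<close> agree at the approximant
      \<open>A.emb x\<close>, so its common image can be subtracted from both values.\<close>
    have "f a \<ominus>\<^bsub>B.Q\<^esub> g a = (f a \<ominus>\<^bsub>B.Q\<^esub> f (A.emb x)) \<ominus>\<^bsub>B.Q\<^esub> (g a \<ominus>\<^bsub>B.Q\<^esub> f (A.emb x))"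
    proof -
      show ?thesis using a x by (simp add: B.Q.minus_minus_minus)
    qed
    also have "\<dots> = f ?r \<ominus>\<^bsub>B.Q\<^esub> g ?r" using a x eq by (simp add: f.hom_minus g.hom_minus)
    also have "nrm B.Q \<dots> \<le> nrm B.Q (f ?r) + nrm B.Q (g ?r)" using r by (intro BQ.p_minus) simp_all
    also have "\<dots> \<le> C * nrm A.Q ?r + D * nrm A.Q ?r" using C[OF r] D[OF r] by simp
    also have "\<dots> \<le> \<bar>C\<bar> * nrm A.Q ?r + \<bar>D\<bar> * nrm A.Q ?r"
      using AQ.p_nonneg[OF r] by (intro add_mono mult_right_mono) simp_all
    also have "\<dots> = (\<bar>C\<bar> + \<bar>D\<bar>) * nrm A.Q ?r" by (simp add: algebra_simps)
    also have "\<dots> \<le> (\<bar>C\<bar> + \<bar>D\<bar>) * d" using x(2) by (intro mult_left_mono) simp_all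
    also have "\<dots> \<le> (\<bar>C\<bar> + \<bar>D\<bar> + 1) * d" using d by simp
    also have "\<dots> = e"
    proof -
      have "\<bar>C\<bar> + \<bar>D\<bar> + 1 \<noteq> 0" using abs_ge_zero[of C] abs_ge_zero[of D] by linarith
      then show ?thesis by (simp add: d_def)
    qed
    finally show ?thesis by simp
  qed
  then have "nrm B.Q (f a \<ominus>\<^bsub>B.Q\<^esub> g a) \<le> 0" by (rule field_le_epsilon)
  moreover have "0 \<le> nrm B.Q (f a \<ominus>\<^bsub>B.Q\<^esub> g a)"
    using a by (intro BQ.p_nonneg) simp
  ultimately show "f a = g a" using a
    by (intro B.nrm_definite) (simp_all del: BQ.p_nonneg)
qed

lemma states_compose_star_hom:
  assumes "star_alg A" "star_alg B" and om: "\<omega> \<in> states B" and f: "f \<in> star_hom A B"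
    and le: "\<And>a. a \<in> carrier A \<Longrightarrow> nrm B (f a) \<le> nrm A a"
  shows "compose (carrier A) \<omega> f \<in> states A"
proof -
  interpret star_alg_hom A B f using star_hom_imp_star_alg_hom[OF f] assms by blast
  have "cmod (\<omega> (f a)) \<le> nrm A a" if "a \<in> carrier A" for a
    using om le[OF that] that by (intro order.trans[OF _ le[OF that]]) (simp add: states_def)
  moreover have "compose (carrier A) \<omega> f \<in> extensional (carrier A)" by (rule compose_extensional)
  ultimately show ?thesis using om unfolding states_def
    by (simp add: compose_def hom_add hom_smult hom_mult hom_adj hom_one)
qed

section \<open>Monoid algebras\<close>

text \<open>Algebra identities in a monoid algebra are proved by evaluating both sides under every \<open>lin \<phi>\<close>.\<close>

definition lin :: "('w \<Rightarrow> complex) \<Rightarrow> ('w \<Rightarrow> complex) \<Rightarrow> complex" where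
  "lin \<phi> f = (\<Sum>w | f w \<noteq> 0. f w * \<phi> w)"

lemma lin_superset:
  assumes "finite S" "{w. f w \<noteq> 0} \<subseteq> S"
  shows "lin \<phi> f = (\<Sum>w\<in>S. f w * \<phi> w)"
  unfolding lin_def by (rule sum.mono_neutral_left) (use assms in auto)

lemma lin_add:
  assumes "finite {w. f w \<noteq> 0}" "finite {w. g w \<noteq> 0}"
  shows "lin \<phi> (\<lambda>w. f w + g w) = lin \<phi> f + lin \<phi> g"
proof -
  let ?S = "{w. f w \<noteq> 0} \<union> {w. g w \<noteq> 0}"
  have "lin \<phi> (\<lambda>w. f w + g w) = (\<Sum>w\<in>?S. (f w + g w) * \<phi> w)"
    by (rule lin_superset) (use assms in auto)
  moreover have "lin \<phi> f = (\<Sum>w\<in>?S. f w * \<phi> w)" by (rule lin_superset) (use assms in auto)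
  moreover have "lin \<phi> g = (\<Sum>w\<in>?S. g w * \<phi> w)" by (rule lin_superset) (use assms in auto)
  ultimately show ?thesis by (simp add: sum.distrib distrib_right)
qed

lemma lin_smult:
  assumes "finite {w. f w \<noteq> 0}"
  shows "lin \<phi> (\<lambda>w. c * f w) = c * lin \<phi> f"
proof -
  have "lin \<phi> (\<lambda>w. c * f w) = (\<Sum>w\<in>{w. f w \<noteq> 0}. (c * f w) * \<phi> w)"
    by (rule lin_superset) (use assms in auto)
  then show ?thesis by (simp add: lin_def sum_distrib_left mult.assoc)
qed

lemma lin_zero [simp]: "lin \<phi> (\<lambda>w. 0) = 0"
  by (simp add: lin_def)

lemma lin_single [simp]: "lin \<phi> (single w) = \<phi> w"
proof -
  have "lin \<phi> (single w) = (\<Sum>v\<in>{w}. single w v * \<phi> v)"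
    by (rule lin_superset) (auto simp: single_def)
  then show ?thesis by (simp add: single_def)
qed

lemma lin_add_fun: "lin (\<lambda>w. \<phi> w + \<psi> w) f = lin \<phi> f + lin \<psi> f"
  by (simp add: lin_def sum.distrib distrib_left)

lemma lin_smult_fun: "lin (\<lambda>w. c * \<phi> w) f = c * lin \<phi> f"
  by (simp add: lin_def sum_distrib_left mult_ac)

lemma lin_sum_fun: "lin (\<lambda>w. \<Sum>i\<in>I. \<phi> i w) f = (\<Sum>i\<in>I. lin (\<phi> i) f)"
  unfolding lin_def by (subst sum.swap) (simp add: sum_distrib_left)

lemma lin_cong: "(\<And>w. f w \<noteq> 0 \<Longrightarrow> \<phi> w = \<psi> w) \<Longrightarrow> lin \<phi> f = lin \<psi> f"
  by (simp add: lin_def)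

lemma lin_indicator:
  assumes "finite {w. f w \<noteq> 0}"
  shows "lin (\<lambda>v. if v = w then 1 else 0) f = f w"
proof -
  have "lin (\<lambda>v. if v = w then 1 else 0) f = (\<Sum>v\<in>insert w {v. f v \<noteq> 0}. f v * (if v = w then 1 else 0))"
    by (rule lin_superset) (use assms in auto)
  then show ?thesis using assms by (simp add: if_distrib cong: if_cong)
qed

lemma lin_eqI:
  assumes "finite {w. f w \<noteq> 0}" "finite {w. g w \<noteq> 0}" "\<And>\<phi>. lin \<phi> f = lin \<phi> g"
  shows "f = g"
  using assms(3) lin_indicator[OF assms(1)] lin_indicator[OF assms(2)] by (metis ext)

text \<open>Product, involution and \<open>push\<close> all add up coefficients over the fibres of a
  map between basis elements; this evaluates the three of them at once and bounds their
  supports.\<close>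

lemma lin_fiber_sums:
  assumes S: "finite S"
  shows "lin \<phi> (\<lambda>w. \<Sum>u\<in>{u \<in> S. h u = w}. F u) = (\<Sum>u\<in>S. F u * \<phi> (h u))"
    and "{w. (\<Sum>u\<in>{u \<in> S. h u = w}. F u) \<noteq> 0} \<subseteq> h ` S"
proof -
  show sub: "{w. (\<Sum>u\<in>{u \<in> S. h u = w}. F u) \<noteq> 0} \<subseteq> h ` S"
  proof
    fix w assume "w \<in> {w. (\<Sum>u\<in>{u \<in> S. h u = w}. F u) \<noteq> 0}"
    then have "{u \<in> S. h u = w} \<noteq> {}" by (metis (mono_tags, lifting) mem_Collect_eq sum.empty)
    then show "w \<in> h ` S" by blast
  qed
  have "lin \<phi> (\<lambda>w. \<Sum>u\<in>{u \<in> S. h u = w}. F u) = (\<Sum>w\<in>h ` S. (\<Sum>u\<in>{u \<in> S. h u = w}. F u) * \<phi> w)"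
    using S sub by (intro lin_superset) auto
  also have "\<dots> = (\<Sum>w\<in>h ` S. \<Sum>u\<in>{u \<in> S. h u = w}. F u * \<phi> (h u))"
    unfolding sum_distrib_right by (intro sum.cong refl) auto
  also have "\<dots> = (\<Sum>u\<in>S. F u * \<phi> (h u))" using S by (intro sum.group) auto
  finally show "lin \<phi> (\<lambda>w. \<Sum>u\<in>{u \<in> S. h u = w}. F u) = (\<Sum>u\<in>S. F u * \<phi> (h u))" .
qed

lemma monoid_algebra_ops:
  "\<one>\<^bsub>monoid_algebra M\<^esub> = single \<one>\<^bsub>M\<^esub>" "\<zero>\<^bsub>monoid_algebra M\<^esub> = (\<lambda>w. 0)"
  "f \<oplus>\<^bsub>monoid_algebra M\<^esub> g = (\<lambda>w. f w + g w)" "c \<odot>\<^bsub>monoid_algebra M\<^esub> f = (\<lambda>w. c * f w)"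
  by (simp_all add: monoid_algebra_def single_def)

lemma monoid_algebra_mult: "f \<otimes>\<^bsub>monoid_algebra M\<^esub> g =
    (\<lambda>w. \<Sum>uv\<in>{uv \<in> {u. f u \<noteq> 0} \<times> {v. g v \<noteq> 0}. fst uv \<otimes>\<^bsub>M\<^esub> snd uv = w}. f (fst uv) * g (snd uv))"
  unfolding monoid_algebra_def by (auto intro!: ext sum.cong)

lemma monoid_algebra_adj:
  "adj (monoid_algebra M) f = (\<lambda>w. \<Sum>u\<in>{u \<in> {u. f u \<noteq> 0}. madj M u = w}. cnj (f u))"
  by (simp add: monoid_algebra_def)

locale involutive_monoid = monoid M for M :: "'w star_monoid" (structure) +
  assumes madj_closed [simp, intro]: "u \<in> carrier M \<Longrightarrow> madj M u \<in> carrier M"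
    and madj_madj [simp]: "u \<in> carrier M \<Longrightarrow> madj M (madj M u) = u"
    and madj_mult: "u \<in> carrier M \<Longrightarrow> v \<in> carrier M \<Longrightarrow> madj M (u \<otimes> v) = madj M v \<otimes> madj M u"
begin

abbreviation "MA \<equiv> monoid_algebra M"

lemma MA_carrier: "f \<in> carrier MA \<longleftrightarrow> finite {w. f w \<noteq> 0} \<and> {w. f w \<noteq> 0} \<subseteq> carrier M"
  by (simp add: monoid_algebra_def)

lemma MA_finite [simp]: "f \<in> carrier MA \<Longrightarrow> finite {w. f w \<noteq> 0}"
  by (simp add: MA_carrier)

lemma MA_supp: "f \<in> carrier MA \<Longrightarrow> f w \<noteq> 0 \<Longrightarrow> w \<in> carrier M"
  by (auto simp: MA_carrier)

lemma MA_lin_cong: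
  assumes "f \<in> carrier MA" "\<And>w. w \<in> carrier M \<Longrightarrow> \<phi> w = \<psi> w"
  shows "lin \<phi> f = lin \<psi> f"
  using assms MA_supp by (intro lin_cong) auto

lemma MA_mult_closed:
  assumes f: "f \<in> carrier MA" and g: "g \<in> carrier MA"
  shows "f \<otimes>\<^bsub>MA\<^esub> g \<in> carrier MA"
proof -
  let ?S = "{u. f u \<noteq> 0} \<times> {v. g v \<noteq> 0}"
  have S: "finite ?S" using f g by simp
  have "{w. (f \<otimes>\<^bsub>MA\<^esub> g) w \<noteq> 0} \<subseteq> (\<lambda>uv. fst uv \<otimes> snd uv) ` ?S"
    unfolding monoid_algebra_mult by (rule lin_fiber_sums(2)[OF S])
  moreover have "(\<lambda>uv. fst uv \<otimes> snd uv) ` ?S \<subseteq> carrier M" using MA_supp[OF f] MA_supp[OF g] by auto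
  ultimately show ?thesis unfolding MA_carrier using finite_imageI[OF S] finite_subset by blast
qed

lemma lin_mult:
  assumes f: "f \<in> carrier MA" and g: "g \<in> carrier MA"
  shows "lin \<phi> (f \<otimes>\<^bsub>MA\<^esub> g) = lin (\<lambda>u. lin (\<lambda>v. \<phi> (u \<otimes> v)) g) f"
proof -
  let ?S = "{u. f u \<noteq> 0} \<times> {v. g v \<noteq> 0}"
  have S: "finite ?S" using f g by simp
  show ?thesis unfolding monoid_algebra_mult lin_fiber_sums(1)[OF S]
    by (simp add: lin_def sum.cartesian_product sum_distrib_left mult.assoc case_prod_beta)
qed

lemma MA_adj_closed:
  assumes f: "f \<in> carrier MA"
  shows "adj MA f \<in> carrier MA"
proof -
  have S: "finite {u. f u \<noteq> 0}" using f by simp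
  have "{w. adj MA f w \<noteq> 0} \<subseteq> madj M ` {u. f u \<noteq> 0}"
    unfolding monoid_algebra_adj by (rule lin_fiber_sums(2)[OF S])
  moreover have "madj M ` {u. f u \<noteq> 0} \<subseteq> carrier M" using MA_supp[OF f] by auto
  ultimately show ?thesis unfolding MA_carrier using finite_imageI[OF S] finite_subset by blast
qed

lemma lin_adj:
  assumes f: "f \<in> carrier MA"
  shows "lin \<phi> (adj MA f) = cnj (lin (\<lambda>u. cnj (\<phi> (madj M u))) f)"
proof -
  have S: "finite {u. f u \<noteq> 0}" using f by simp
  show ?thesis unfolding monoid_algebra_adj lin_fiber_sums(1)[OF S] by (simp add: lin_def)
qed

lemma single_closed [simp]: "w \<in> carrier M \<Longrightarrow> single w \<in> carrier MA"
  by (auto simp: MA_carrier single_def)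

lemma MA_add_closed: "f \<in> carrier MA \<Longrightarrow> g \<in> carrier MA \<Longrightarrow> f \<oplus>\<^bsub>MA\<^esub> g \<in> carrier MA"
proof -
  assume f: "f \<in> carrier MA" and g: "g \<in> carrier MA"
  have "{w. f w + g w \<noteq> 0} \<subseteq> {w. f w \<noteq> 0} \<union> {w. g w \<noteq> 0}" by auto
  then show ?thesis using f g unfolding MA_carrier monoid_algebra_ops by (meson finite_Un finite_subset le_sup_iff order_trans)
qed

lemma MA_smult_closed: "f \<in> carrier MA \<Longrightarrow> c \<odot>\<^bsub>MA\<^esub> f \<in> carrier MA"
proof -
  assume f: "f \<in> carrier MA"
  have "{w. c * f w \<noteq> 0} \<subseteq> {w. f w \<noteq> 0}" by auto
  then show ?thesis using f unfolding MA_carrier monoid_algebra_ops by (meson finite_subset order_trans)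
qed

lemma lin_MA_add: "f \<in> carrier MA \<Longrightarrow> g \<in> carrier MA \<Longrightarrow> lin \<phi> (f \<oplus>\<^bsub>MA\<^esub> g) = lin \<phi> f + lin \<phi> g"
  by (simp add: monoid_algebra_ops lin_add)

lemma lin_MA_smult: "f \<in> carrier MA \<Longrightarrow> lin \<phi> (c \<odot>\<^bsub>MA\<^esub> f) = c * lin \<phi> f"
  by (simp add: monoid_algebra_ops lin_smult)

lemma lin_MA_zero: "lin \<phi> \<zero>\<^bsub>MA\<^esub> = 0" and lin_MA_one: "lin \<phi> \<one>\<^bsub>MA\<^esub> = \<phi> \<one>"
  by (simp_all add: monoid_algebra_ops)

lemma MA_zero_closed: "\<zero>\<^bsub>MA\<^esub> \<in> carrier MA" and MA_one_closed: "\<one>\<^bsub>MA\<^esub> \<in> carrier MA"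
  by (simp_all add: monoid_algebra_ops) (simp add: MA_carrier)

lemmas MA_closed = MA_mult_closed MA_adj_closed MA_add_closed MA_smult_closed MA_zero_closed MA_one_closed

lemma MA_eqI: "f \<in> carrier MA \<Longrightarrow> g \<in> carrier MA \<Longrightarrow> (\<And>\<phi>. lin \<phi> f = lin \<phi> g) \<Longrightarrow> f = g"
  by (rule lin_eqI) simp_all

lemmas lin_MA = lin_MA_add lin_MA_smult lin_MA_zero lin_MA_one lin_mult lin_adj

lemma star_alg_MA: "star_alg MA"
proof -
  have "abelian_group MA"
  proof (rule abelian_groupI)
    fix f assume f: "f \<in> carrier MA"
    have "(-1) \<odot>\<^bsub>MA\<^esub> f \<oplus>\<^bsub>MA\<^esub> f = \<zero>\<^bsub>MA\<^esub>" by (simp add: monoid_algebra_ops)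
    then show "\<exists>g\<in>carrier MA. g \<oplus>\<^bsub>MA\<^esub> f = \<zero>\<^bsub>MA\<^esub>" using MA_smult_closed[OF f] by blast
  qed (simp_all add: MA_closed, simp_all add: monoid_algebra_ops add_ac)
  moreover have "monoid MA"
  proof (rule monoidI)
    fix f g h assume c: "f \<in> carrier MA" "g \<in> carrier MA" "h \<in> carrier MA"
    show "f \<otimes>\<^bsub>MA\<^esub> g \<otimes>\<^bsub>MA\<^esub> h = f \<otimes>\<^bsub>MA\<^esub> (g \<otimes>\<^bsub>MA\<^esub> h)"
    proof (rule MA_eqI)
      fix \<phi>
      show "lin \<phi> (f \<otimes>\<^bsub>MA\<^esub> g \<otimes>\<^bsub>MA\<^esub> h) = lin \<phi> (f \<otimes>\<^bsub>MA\<^esub> (g \<otimes>\<^bsub>MA\<^esub> h))"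
        unfolding lin_mult[OF MA_mult_closed[OF c(1,2)] c(3)] lin_mult[OF c(1,2)]
          lin_mult[OF c(1) MA_mult_closed[OF c(2,3)]] lin_mult[OF c(2,3)]
        using c by (intro MA_lin_cong) (auto simp: m_assoc)
    qed (use c in \<open>simp_all add: MA_closed\<close>)
  next
    fix f assume f: "f \<in> carrier MA"
    show "\<one>\<^bsub>MA\<^esub> \<otimes>\<^bsub>MA\<^esub> f = f"
      by (rule MA_eqI) (use f in \<open>auto simp: MA_closed lin_MA intro!: MA_lin_cong\<close>)
    show "f \<otimes>\<^bsub>MA\<^esub> \<one>\<^bsub>MA\<^esub> = f"
      by (rule MA_eqI) (use f in \<open>auto simp: MA_closed lin_MA intro!: MA_lin_cong\<close>)
  qed (simp_all add: MA_closed)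
  ultimately have "ring MA"
  proof (rule ringI)
    fix f g h assume c: "f \<in> carrier MA" "g \<in> carrier MA" "h \<in> carrier MA"
    show "(f \<oplus>\<^bsub>MA\<^esub> g) \<otimes>\<^bsub>MA\<^esub> h = f \<otimes>\<^bsub>MA\<^esub> h \<oplus>\<^bsub>MA\<^esub> g \<otimes>\<^bsub>MA\<^esub> h"
      by (rule MA_eqI) (use c in \<open>simp_all add: MA_closed lin_MA\<close>)
    show "h \<otimes>\<^bsub>MA\<^esub> (f \<oplus>\<^bsub>MA\<^esub> g) = h \<otimes>\<^bsub>MA\<^esub> f \<oplus>\<^bsub>MA\<^esub> h \<otimes>\<^bsub>MA\<^esub> g"
      by (rule MA_eqI) (use c in \<open>simp_all add: MA_closed lin_MA lin_add_fun\<close>)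
  qed
  moreover have "star_alg_axioms MA"
  proof (rule star_alg_axioms.intro)
    fix f g c d assume f: "f \<in> carrier MA"
    show "c \<odot>\<^bsub>MA\<^esub> f \<in> carrier MA" "adj MA f \<in> carrier MA" using f by (simp_all add: MA_closed)
    show "(c + d) \<odot>\<^bsub>MA\<^esub> f = c \<odot>\<^bsub>MA\<^esub> f \<oplus>\<^bsub>MA\<^esub> d \<odot>\<^bsub>MA\<^esub> f"
      "c \<odot>\<^bsub>MA\<^esub> (d \<odot>\<^bsub>MA\<^esub> f) = (c * d) \<odot>\<^bsub>MA\<^esub> f"
      "c \<odot>\<^bsub>MA\<^esub> (f \<oplus>\<^bsub>MA\<^esub> g) = c \<odot>\<^bsub>MA\<^esub> f \<oplus>\<^bsub>MA\<^esub> c \<odot>\<^bsub>MA\<^esub> g"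
      "1 \<odot>\<^bsub>MA\<^esub> f = f"
      by (simp_all add: monoid_algebra_ops algebra_simps)
    show "adj MA (adj MA f) = f"
      by (rule MA_eqI) (use f in \<open>auto simp: MA_closed lin_MA intro!: MA_lin_cong\<close>)
    show "adj MA (c \<odot>\<^bsub>MA\<^esub> f) = cnj c \<odot>\<^bsub>MA\<^esub> adj MA f"
      by (rule MA_eqI) (use f in \<open>simp_all add: MA_closed lin_MA\<close>)
    assume g: "g \<in> carrier MA"
    show "adj MA (f \<oplus>\<^bsub>MA\<^esub> g) = adj MA f \<oplus>\<^bsub>MA\<^esub> adj MA g"
      by (rule MA_eqI) (use f g in \<open>simp_all add: MA_closed lin_MA\<close>)
    show "(c \<odot>\<^bsub>MA\<^esub> f) \<otimes>\<^bsub>MA\<^esub> g = c \<odot>\<^bsub>MA\<^esub> (f \<otimes>\<^bsub>MA\<^esub> g)"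
      by (rule MA_eqI) (use f g in \<open>simp_all add: MA_closed lin_MA\<close>)
    show "f \<otimes>\<^bsub>MA\<^esub> (c \<odot>\<^bsub>MA\<^esub> g) = c \<odot>\<^bsub>MA\<^esub> (f \<otimes>\<^bsub>MA\<^esub> g)"
      by (rule MA_eqI) (use f g in \<open>simp_all add: MA_closed lin_MA lin_smult_fun\<close>)
    show "adj MA (f \<otimes>\<^bsub>MA\<^esub> g) = adj MA g \<otimes>\<^bsub>MA\<^esub> adj MA f"
    proof (rule MA_eqI)
      fix \<phi>
      have "lin \<phi> (adj MA (f \<otimes>\<^bsub>MA\<^esub> g)) = cnj (lin (\<lambda>u. lin (\<lambda>v. cnj (\<phi> (madj M (u \<otimes> v)))) g) f)"
        using f g by (simp add: lin_MA MA_closed)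
      also have "\<dots> = cnj (lin (\<lambda>u. lin (\<lambda>v. cnj (\<phi> (madj M v \<otimes> madj M u))) g) f)"
        using f g madj_mult by (intro arg_cong[of _ _ cnj] MA_lin_cong) auto
      also have "\<dots> = (\<Sum>u | f u \<noteq> 0. \<Sum>v | g v \<noteq> 0. cnj (f u) * cnj (g v) * \<phi> (madj M v \<otimes> madj M u))"
        by (simp add: lin_def sum_distrib_left mult.assoc)
      also have "\<dots> = (\<Sum>v | g v \<noteq> 0. \<Sum>u | f u \<noteq> 0. cnj (f u) * cnj (g v) * \<phi> (madj M v \<otimes> madj M u))"
        by (rule sum.swap)
      also have "\<dots> = lin \<phi> (adj MA g \<otimes>\<^bsub>MA\<^esub> adj MA f)"
        using f g by (simp add: lin_MA MA_closed) (simp add: lin_def sum_distrib_left mult_ac)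
      finally show "lin \<phi> (adj MA (f \<otimes>\<^bsub>MA\<^esub> g)) = lin \<phi> (adj MA g \<otimes>\<^bsub>MA\<^esub> adj MA f)" .
    qed (use f g in \<open>simp_all add: MA_closed\<close>)
  qed
  ultimately show ?thesis by (rule star_alg.intro)
qed

sublocale MA: star_alg MA by (rule star_alg_MA)

lemma single_mult: "u \<in> carrier M \<Longrightarrow> v \<in> carrier M \<Longrightarrow> single u \<otimes>\<^bsub>MA\<^esub> single v = single (u \<otimes> v)"
  by (rule MA_eqI) (simp_all add: lin_mult)

lemma single_adj: "u \<in> carrier M \<Longrightarrow> adj MA (single u) = single (madj M u)"
  by (rule MA_eqI) (simp_all add: lin_adj)

lemma MA_induct [consumes 1, case_names zero add]:
  assumes f: "f \<in> carrier MA" and zero: "P \<zero>\<^bsub>MA\<^esub>"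
    and add: "\<And>g c w. g \<in> carrier MA \<Longrightarrow> w \<in> carrier M \<Longrightarrow> P g \<Longrightarrow> P (g \<oplus>\<^bsub>MA\<^esub> c \<odot>\<^bsub>MA\<^esub> single w)"
  shows "P f"
  using f
proof (induction "card {w. f w \<noteq> 0}" arbitrary: f rule: less_induct)
  case less
  show ?case
  proof (cases "{w. f w \<noteq> 0} = {}")
    case True
    then have "f = \<zero>\<^bsub>MA\<^esub>" by (auto simp: monoid_algebra_ops)
    then show ?thesis using zero by simp
  next
    case False
    then obtain w where w: "f w \<noteq> 0" by blast
    define g where "g = f(w := 0)"
    have supp: "{v. g v \<noteq> 0} = {v. f v \<noteq> 0} - {w}" by (auto simp: g_def)
    have g: "g \<in> carrier MA" using less.prems unfolding MA_carrier supp by auto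
    have "card {v. g v \<noteq> 0} < card {v. f v \<noteq> 0}"
      unfolding supp using w less.prems by (intro card_Diff1_less) simp_all
    from add[OF g MA_supp[OF less.prems w] less.hyps[OF this g], of "f w"]
    have "P (g \<oplus>\<^bsub>MA\<^esub> f w \<odot>\<^bsub>MA\<^esub> single w)" .
    moreover have "g \<oplus>\<^bsub>MA\<^esub> f w \<odot>\<^bsub>MA\<^esub> single w = f" by (auto simp: monoid_algebra_ops g_def single_def)
    ultimately show ?thesis by simp
  qed
qed


end

section \<open>Algebra homomorphisms induced by monoid homomorphisms\<close>

definition push :: "('v \<Rightarrow> 'w) \<Rightarrow> ('v \<Rightarrow> complex) \<Rightarrow> 'w \<Rightarrow> complex" where
  "push h f = (\<lambda>w. \<Sum>u\<in>{u \<in> {u. f u \<noteq> 0}. h u = w}. f u)"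

locale involutive_monoid_hom = M: involutive_monoid M + N: involutive_monoid N
  for M :: "'v star_monoid" (structure) and N :: "'w star_monoid" (structure) +
  fixes h :: "'v \<Rightarrow> 'w"
  assumes h_closed [simp]: "u \<in> carrier M \<Longrightarrow> h u \<in> carrier N"
    and h_mult: "u \<in> carrier M \<Longrightarrow> v \<in> carrier M \<Longrightarrow> h (u \<otimes>\<^bsub>M\<^esub> v) = h u \<otimes>\<^bsub>N\<^esub> h v"
    and h_one: "h \<one>\<^bsub>M\<^esub> = \<one>\<^bsub>N\<^esub>"
    and h_madj: "u \<in> carrier M \<Longrightarrow> h (madj M u) = madj N (h u)"
begin

lemma lin_push: "f \<in> carrier M.MA \<Longrightarrow> lin \<phi> (push h f) = lin (\<lambda>u. \<phi> (h u)) f"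
  unfolding push_def by (subst lin_fiber_sums(1)) (simp_all add: lin_def)

lemma push_closed [simp]: "f \<in> carrier M.MA \<Longrightarrow> push h f \<in> carrier N.MA"
proof -
  assume f: "f \<in> carrier M.MA"
  have "{w. push h f w \<noteq> 0} \<subseteq> h ` {u. f u \<noteq> 0}"
    unfolding push_def using f by (intro lin_fiber_sums(2)) simp
  moreover have "h ` {u. f u \<noteq> 0} \<subseteq> carrier N" using M.MA_supp[OF f] by auto
  ultimately show ?thesis unfolding N.MA_carrier using finite_imageI[OF M.MA_finite[OF f]] finite_subset by blast
qed

lemma push_single: "u \<in> carrier M \<Longrightarrow> push h (single u) = single (h u)"
  by (rule N.MA_eqI) (simp_all add: lin_push)

lemma push_star_alg_hom: "star_alg_hom M.MA N.MA (push h)"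
proof (intro star_alg_hom.intro star_alg_hom_axioms.intro M.star_alg_MA N.star_alg_MA)
  fix f g c assume f: "f \<in> carrier M.MA"
  show "push h f \<in> carrier N.MA" using f by simp
  show "push h (c \<odot>\<^bsub>M.MA\<^esub> f) = c \<odot>\<^bsub>N.MA\<^esub> push h f"
    by (rule N.MA_eqI) (use f in \<open>simp_all add: lin_push M.lin_MA N.lin_MA\<close>)
  show "push h (adj M.MA f) = adj N.MA (push h f)"
    by (rule N.MA_eqI)
      (use f in \<open>auto simp: lin_push M.lin_MA N.lin_MA h_madj intro!: M.MA_lin_cong\<close>)
  assume g: "g \<in> carrier M.MA"
  show "push h (f \<oplus>\<^bsub>M.MA\<^esub> g) = push h f \<oplus>\<^bsub>N.MA\<^esub> push h g"
    by (rule N.MA_eqI) (use f g in \<open>simp_all add: lin_push M.lin_MA N.lin_MA\<close>)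
  show "push h (f \<otimes>\<^bsub>M.MA\<^esub> g) = push h f \<otimes>\<^bsub>N.MA\<^esub> push h g"
    by (rule N.MA_eqI)
      (use f g in \<open>auto simp: lin_push M.lin_MA N.lin_MA h_mult intro!: M.MA_lin_cong\<close>)
next
  show "push h \<one>\<^bsub>M.MA\<^esub> = \<one>\<^bsub>N.MA\<^esub>" by (simp add:  monoid_algebra_ops push_single h_one)
qed

end

section \<open>Cuntz algebras\<close>

definition letters :: "nat \<Rightarrow> letter set" where
  "letters n = Gen ` {1..n} \<union> GenAdj ` {1..n}"

lemma words_simps [simp]:
  "carrier (words n) = lists (letters n)" "u \<otimes>\<^bsub>words n\<^esub> v = u @ v" "\<one>\<^bsub>words n\<^esub> = []"
  "madj (words n) w = rev (map letter_adj w)"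
  by (simp_all add: words_def letters_def)

lemma letter_adj_adj [simp]: "letter_adj (letter_adj l) = l"
  by (cases l) simp_all

lemma letters_simps [simp]:
  "Gen i \<in> letters n \<longleftrightarrow> i \<in> {1..n}" "GenAdj i \<in> letters n \<longleftrightarrow> i \<in> {1..n}"
  "letter_adj l \<in> letters n \<longleftrightarrow> l \<in> letters n"
  by (auto simp: letters_def image_iff) (cases l; auto)+

interpretation words: involutive_monoid "words n" for n
proof (intro involutive_monoid.intro involutive_monoid_axioms.intro)
  show "monoid (words n)" by (rule monoidI) auto
qed (auto simp: in_lists_conv_set rev_map comp_def)

interpretation free_alg: star_alg "free_alg n" for n
  unfolding free_alg_def by (rule words.star_alg_MA)

lemmas free_alg_single_closed [simp] = words.single_closed[folded free_alg_def]
lemmas free_alg_single_mult = words.single_mult[folded free_alg_def]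
lemmas free_alg_single_adj = words.single_adj[folded free_alg_def]
lemmas free_alg_induct [consumes 1, case_names zero add] = words.MA_induct[folded free_alg_def]
lemmas free_alg_lin = words.lin_MA_add[folded free_alg_def] words.lin_MA_smult[folded free_alg_def]
  words.lin_MA_zero[folded free_alg_def] words.lin_MA_one[folded free_alg_def]
  words.lin_mult[folded free_alg_def] words.lin_adj[folded free_alg_def]
lemmas free_alg_lin_cong = words.MA_lin_cong[folded free_alg_def]

lemma free_alg_one: "\<one>\<^bsub>free_alg n\<^esub> = single []"
  by (simp add: free_alg_def monoid_algebra_ops)

lemma free_gen_closed [simp]: "i \<in> {1..n} \<Longrightarrow> free_gen i \<in> carrier (free_alg n)"
  by (simp add: free_gen_def)

lemma free_gen_adj: "i \<in> {1..n} \<Longrightarrow> adj (free_alg n) (free_gen i) = single [GenAdj i]"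
  by (simp add: free_gen_def free_alg_single_adj)

definition orth_rel :: "nat \<Rightarrow> nat \<Rightarrow> nat \<Rightarrow> letter list \<Rightarrow> complex" where
  "orth_rel n i j = adj (free_alg n) (free_gen i) \<otimes>\<^bsub>free_alg n\<^esub> free_gen j
     \<ominus>\<^bsub>free_alg n\<^esub> (if i = j then \<one>\<^bsub>free_alg n\<^esub> else \<zero>\<^bsub>free_alg n\<^esub>)"

definition sum_rel :: "nat \<Rightarrow> letter list \<Rightarrow> complex" where
  "sum_rel n = finsum (free_alg n) (\<lambda>i. free_gen i \<otimes>\<^bsub>free_alg n\<^esub> adj (free_alg n) (free_gen i)) {1..n}
     \<ominus>\<^bsub>free_alg n\<^esub> \<one>\<^bsub>free_alg n\<^esub>"

lemma cuntz_relations_eq: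
  "cuntz_relations n = {orth_rel n i j | i j. i \<in> {1..n} \<and> j \<in> {1..n}} \<union> {sum_rel n}"
  unfolding cuntz_relations_def Let_def orth_rel_def sum_rel_def by simp

definition cuntz_seminorms :: "nat \<Rightarrow> ((letter list \<Rightarrow> complex) \<Rightarrow> real) set" where
  "cuntz_seminorms n = {p. cstar_seminorm (free_alg n) p \<and> (\<forall>r \<in> cuntz_relations n. p r = 0)}"

lemma cuntz_norm_eq: "cuntz_norm n = (\<lambda>a. Sup {p a | p. p \<in> cuntz_seminorms n})"
  unfolding cuntz_norm_def cuntz_seminorms_def by simp

lemma orth_rel_closed [simp]: "i \<in> {1..n} \<Longrightarrow> j \<in> {1..n} \<Longrightarrow> orth_rel n i j \<in> carrier (free_alg n)"
  unfolding orth_rel_def by (intro free_alg.minus_closed) auto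

lemma sum_rel_closed [simp]: "sum_rel n \<in> carrier (free_alg n)"
  unfolding sum_rel_def by (intro free_alg.minus_closed free_alg.finsum_closed) auto

lemma lin_finsum:
  assumes "finite I" "\<And>i. i \<in> I \<Longrightarrow> f i \<in> carrier (free_alg n)"
  shows "lin \<psi> (finsum (free_alg n) f I) = (\<Sum>i\<in>I. lin \<psi> (f i))"
  using assms
proof (induction I)
  case (insert i I)
  then have "f \<in> I \<rightarrow> carrier (free_alg n)" by auto
  then show ?case using insert by (simp add: free_alg.finsum_insert free_alg_lin)
qed (simp add: free_alg_lin)

lemma lin_orth_rel:
  assumes "i \<in> {1..n}" "j \<in> {1..n}"
  shows "lin \<psi> (orth_rel n i j) = \<psi> [GenAdj i, Gen j] - (if i = j then \<psi> [] else 0)"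
  using assms by (simp add: orth_rel_def free_alg.minus_eq_smult free_alg_lin free_gen_adj)
    (simp add: free_gen_def free_alg_single_mult free_alg_one)

lemma lin_sum_rel: "lin \<psi> (sum_rel n) = (\<Sum>i\<in>{1..n}. \<psi> [Gen i, GenAdj i]) - \<psi> []"
proof -
  let ?q = "\<lambda>i. free_gen i \<otimes>\<^bsub>free_alg n\<^esub> adj (free_alg n) (free_gen i)"
  have "lin \<psi> (finsum (free_alg n) ?q {1..n}) = (\<Sum>i\<in>{1..n}. lin \<psi> (?q i))"
    by (rule lin_finsum) auto
  also have "\<dots> = (\<Sum>i\<in>{1..n}. \<psi> [Gen i, GenAdj i])"
    by (intro sum.cong refl) (simp add: free_gen_adj, simp add: free_gen_def free_alg_single_mult)
  finally have "lin \<psi> (finsum (free_alg n) ?q {1..n}) = (\<Sum>i\<in>{1..n}. \<psi> [Gen i, GenAdj i])" .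
  moreover have "finsum (free_alg n) ?q {1..n} \<in> carrier (free_alg n)"
    by (rule free_alg.finsum_closed) auto
  ultimately show ?thesis by (simp add: sum_rel_def free_alg.minus_eq_smult free_alg_lin)
qed

lemma zero_cuntz_seminorm: "(\<lambda>a. 0) \<in> cuntz_seminorms n"
  by (simp add: cuntz_seminorms_def cstar_seminorm_def)

lemma cuntz_seminormsD: "p \<in> cuntz_seminorms n \<Longrightarrow> cstar_seminormed (free_alg n) p"
  by (intro cstar_seminormed.intro free_alg.star_alg_axioms cstar_seminormed_axioms.intro)
    (simp add: cuntz_seminorms_def)

text \<open>The relation \<open>s_i^* s_i = 1\<close> gives
  \<open>(p s_i)\<^sup>2 = p \<one> \<le> 1\<close>, and submultiplicativity passes this on to
  words. The bound does not depend on \<open>p\<close>, which makes the supremum in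
  \<open>cuntz_norm\<close> finite.\<close>

lemma cuntz_seminorm_word_le:
  assumes p: "p \<in> cuntz_seminorms n" and w: "w \<in> lists (letters n)"
  shows "p (single w) \<le> 1"
proof -
  interpret p: cstar_seminormed "free_alg n" p by (rule cuntz_seminormsD[OF p])
  have gen: "p (single [Gen i]) \<le> 1" if i: "i \<in> {1..n}" for i
  proof -
    let ?s = "adj (free_alg n) (free_gen i) \<otimes>\<^bsub>free_alg n\<^esub> free_gen i"
    have "orth_rel n i i \<in> cuntz_relations n" unfolding cuntz_relations_eq using i by blast
    then have "p (?s \<ominus>\<^bsub>free_alg n\<^esub> \<one>\<^bsub>free_alg n\<^esub>) = 0"
      using p by (auto simp: cuntz_seminorms_def orth_rel_def)
    then have "p ?s \<le> 1" using p.p_minus_zero[of ?s "\<one>\<^bsub>free_alg n\<^esub>"] p.p_one_le i by simp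
    then have "(p (free_gen i))\<^sup>2 \<le> 1\<^sup>2" using p.p_cstar[of "free_gen i"] i by simp
    then have "p (free_gen i) \<le> 1" by (rule power2_le_imp_le) simp
    then show ?thesis by (simp add: free_gen_def)
  qed
  have let1: "p (single [l]) \<le> 1" if "l \<in> letters n" for l
  proof (cases l)
    case (GenAdj i)
    then have "p (single [l]) = p (adj (free_alg n) (free_gen i))" using that by (simp add: free_gen_adj)
    also have "\<dots> = p (single [Gen i])" using that GenAdj by (subst p.p_adj) (simp_all add: free_gen_def)
    finally show ?thesis using gen that GenAdj by simp
  qed (use that gen in simp)
  show ?thesis using w
  proof (induction w)
    case Nil
    then show ?case using p.p_one_le by (simp add: free_alg_one)
  next
    case (Cons l w)
    have "p (single (l # w)) = p (single [l] \<otimes>\<^bsub>free_alg n\<^esub> single w)"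
      using Cons by (simp add: free_alg_single_mult)
    also have "\<dots> \<le> p (single [l]) * p (single w)" using Cons by (intro p.p_mult) simp_all
    also have "\<dots> \<le> 1 * 1" using Cons let1[of l] by (intro mult_mono) simp_all
    finally show ?case by simp
  qed
qed

lemma cuntz_seminorms_bdd:
  assumes "f \<in> carrier (free_alg n)"
  shows "bdd_above {p f | p. p \<in> cuntz_seminorms n}"
proof -
  have "\<exists>C. \<forall>p \<in> cuntz_seminorms n. p f \<le> C" using assms
  proof (induction rule: free_alg_induct)
    case zero
    have "p \<zero>\<^bsub>free_alg n\<^esub> = 0" if "p \<in> cuntz_seminorms n" for p
    proof -
      interpret p: cstar_seminormed "free_alg n" p by (rule cuntz_seminormsD[OF that])
      show ?thesis by simp
    qed
    then show ?case by (metis order_refl)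
  next
    case (add g c w)
    then obtain C where C: "\<And>p. p \<in> cuntz_seminorms n \<Longrightarrow> p g \<le> C" by blast
    have w: "w \<in> lists (letters n)" using add by simp
    have "p (g \<oplus>\<^bsub>free_alg n\<^esub> c \<odot>\<^bsub>free_alg n\<^esub> single w) \<le> C + cmod c" if "p \<in> cuntz_seminorms n" for p
    proof -
      interpret p: cstar_seminormed "free_alg n" p by (rule cuntz_seminormsD[OF that])
      have "p (g \<oplus>\<^bsub>free_alg n\<^esub> c \<odot>\<^bsub>free_alg n\<^esub> single w) \<le> p g + cmod c * p (single w)"
        using p.p_add[of g "c \<odot>\<^bsub>free_alg n\<^esub> single w"] add.hyps(1) w by (simp add: p.p_smult)
      also have "\<dots> \<le> C + cmod c * 1"
        using C[OF that] cuntz_seminorm_word_le[OF that w] by (intro add_mono mult_left_mono) simp_all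
      finally show ?thesis by simp
    qed
    then show ?case by blast
  qed
  then show ?thesis unfolding bdd_above_def by blast
qed

lemma cuntz_norm_upper:
  assumes "p \<in> cuntz_seminorms n" "f \<in> carrier (free_alg n)"
  shows "p f \<le> cuntz_norm n f"
  unfolding cuntz_norm_eq using assms by (intro cSup_upper cuntz_seminorms_bdd) blast

lemma cuntz_norm_relation:
  assumes "r \<in> cuntz_relations n"
  shows "cuntz_norm n r = 0"
proof -
  have "p r = 0" if "p \<in> cuntz_seminorms n" for p using that assms by (simp add: cuntz_seminorms_def)
  then have "{p r | p. p \<in> cuntz_seminorms n} = {0}" using zero_cuntz_seminorm[of n] by auto
  then show ?thesis by (simp add: cuntz_norm_eq)
qed

interpretation cuntz_norm: cstar_seminormed "free_alg n" "cuntz_norm n" for n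
proof (intro cstar_seminormed.intro free_alg.star_alg_axioms cstar_seminormed_axioms.intro)
  show "cstar_seminorm (free_alg n) (cuntz_norm n)"
    unfolding cuntz_norm_eq using zero_cuntz_seminorm[of n] cuntz_seminorms_bdd
    by (intro free_alg.cstar_seminorm_Sup) (auto simp: cuntz_seminorms_def)
qed

interpretation cuntz: cstar_seminormed "cuntz n" "nrm (cuntz n)" for n
  unfolding cuntz_def by (rule cuntz_norm.cstar_seminormed_completion)

abbreviation cuntz_emb :: "nat \<Rightarrow> (letter list \<Rightarrow> complex) \<Rightarrow> cuntz_elem" where
  "cuntz_emb n \<equiv> completion_embed (free_alg n) (cuntz_norm n)"

interpretation cuntz_emb: star_alg_hom "free_alg n" "cuntz n" "cuntz_emb n" for n
  unfolding cuntz_def by (rule cuntz_norm.star_alg_hom_emb)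

text \<open>Isolates the Cuntz relations from the completion: the computations with words below use
  nothing else about the algebra.\<close>

locale cuntz_family = star_alg A for A :: "('a, 'm) star_algebra_scheme" (structure) +
  fixes n :: nat and s :: "nat \<Rightarrow> 'a"
  assumes s_closed [simp]: "i \<in> {1..n} \<Longrightarrow> s i \<in> carrier A"
    and s_orth: "i \<in> {1..n} \<Longrightarrow> j \<in> {1..n} \<Longrightarrow> adj A (s i) \<otimes> s j = (if i = j then \<one> else \<zero>)"
    and s_sum: "(\<Oplus>i\<in>{1..n}. s i \<otimes> adj A (s i)) = \<one>"

lemma cuntz_emb_relation:
  assumes "a \<in> carrier (free_alg n)" "b \<in> carrier (free_alg n)" "a \<ominus>\<^bsub>free_alg n\<^esub> b \<in> cuntz_relations n"
  shows "cuntz_emb n a = cuntz_emb n b"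
  by (rule cuntz_norm.emb_eqI) (use assms cuntz_norm_relation in simp_all)

lemma cuntz_gen_family: "cuntz_family (cuntz n) n (cuntz_gen n)"
proof (intro cuntz_family.intro cuntz.star_alg_axioms cuntz_family_axioms.intro)
  fix i assume i: "i \<in> {1..n}"
  show "cuntz_gen n i \<in> carrier (cuntz n)" using i by (simp add: cuntz_gen_def)
  fix j assume j: "j \<in> {1..n}"
  have "orth_rel n i j \<in> cuntz_relations n" unfolding cuntz_relations_eq using i j by blast
  then have "cuntz_emb n (adj (free_alg n) (free_gen i) \<otimes>\<^bsub>free_alg n\<^esub> free_gen j)
      = cuntz_emb n (if i = j then \<one>\<^bsub>free_alg n\<^esub> else \<zero>\<^bsub>free_alg n\<^esub>)"
    using i j by (intro cuntz_emb_relation) (simp_all add: orth_rel_def)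
  then show "adj (cuntz n) (cuntz_gen n i) \<otimes>\<^bsub>cuntz n\<^esub> cuntz_gen n j
      = (if i = j then \<one>\<^bsub>cuntz n\<^esub> else \<zero>\<^bsub>cuntz n\<^esub>)"
    using i j cuntz_emb.hom_one cuntz_emb.hom_zero
    by (simp add: cuntz_gen_def cuntz_emb.hom_mult cuntz_emb.hom_adj split: if_splits)
next
  let ?f = "\<lambda>i. free_gen i \<otimes>\<^bsub>free_alg n\<^esub> adj (free_alg n) (free_gen i)"
  have "sum_rel n \<in> cuntz_relations n" unfolding cuntz_relations_eq by blast
  then have "cuntz_emb n (finsum (free_alg n) ?f {1..n}) = cuntz_emb n \<one>\<^bsub>free_alg n\<^esub>"
    by (intro cuntz_emb_relation free_alg.finsum_closed) (auto simp: sum_rel_def)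
  moreover have "cuntz_emb n (finsum (free_alg n) ?f {1..n}) = finsum (cuntz n) (\<lambda>i. cuntz_emb n (?f i)) {1..n}"
    by (intro cuntz_emb.hom_finsum) auto
  moreover have "\<dots> = (\<Oplus>\<^bsub>cuntz n\<^esub>i\<in>{1..n}. cuntz_gen n i \<otimes>\<^bsub>cuntz n\<^esub> adj (cuntz n) (cuntz_gen n i))"
    by (intro cuntz.finsum_cong')
      (auto simp: cuntz_gen_def cuntz_emb.hom_mult cuntz_emb.hom_adj)
  ultimately show "(\<Oplus>\<^bsub>cuntz n\<^esub>i\<in>{1..n}. cuntz_gen n i \<otimes>\<^bsub>cuntz n\<^esub> adj (cuntz n) (cuntz_gen n i)) = \<one>\<^bsub>cuntz n\<^esub>"
    by (simp add: cuntz_emb.hom_one)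
qed

section \<open>Evaluation of words in a star-algebra\<close>

fun word_eval :: "('a, 'm) star_algebra_scheme \<Rightarrow> (nat \<Rightarrow> 'a) \<Rightarrow> letter list \<Rightarrow> 'a" where
  "word_eval A s [] = \<one>\<^bsub>A\<^esub>"
| "word_eval A s (Gen i # w) = s i \<otimes>\<^bsub>A\<^esub> word_eval A s w"
| "word_eval A s (GenAdj i # w) = adj A (s i) \<otimes>\<^bsub>A\<^esub> word_eval A s w"

context star_alg
begin

lemma word_eval_closed:
  assumes "\<And>i. i \<in> {1..n} \<Longrightarrow> s i \<in> carrier A" "w \<in> lists (letters n)"
  shows "word_eval A s w \<in> carrier A"
  using assms(2)
proof (induction w)
  case (Cons l w)
  then show ?case using assms(1) by (cases l) simp_all
qed simp

lemma word_eval_append: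
  assumes s: "\<And>i. i \<in> {1..n} \<Longrightarrow> s i \<in> carrier A" and "u \<in> lists (letters n)" "v \<in> lists (letters n)"
  shows "word_eval A s (u @ v) = word_eval A s u \<otimes> word_eval A s v"
  using assms(2)
proof (induction u)
  case Nil
  then show ?case using word_eval_closed[of n s v] s assms(3) by simp
next
  case (Cons l u)
  then show ?case using s word_eval_closed[of n s u] word_eval_closed[of n s v] assms(3)
    by (cases l) (simp_all add: m_assoc)
qed

lemma word_eval_adj:
  assumes s: "\<And>i. i \<in> {1..n} \<Longrightarrow> s i \<in> carrier A" and "w \<in> lists (letters n)"
  shows "word_eval A s (rev (map letter_adj w)) = adj A (word_eval A s w)"
  using assms(2)
proof (induction w)
  case (Cons l w)
  have c: "rev (map letter_adj w) \<in> lists (letters n)" using Cons by (auto simp: in_lists_conv_set)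
  have "word_eval A s (rev (map letter_adj (l # w))) = adj A (word_eval A s w) \<otimes> word_eval A s [letter_adj l]"
    using Cons c s word_eval_append[of n s "rev (map letter_adj w)" "[letter_adj l]"] by simp
  also have "\<dots> = adj A (word_eval A s (l # w))"
    using Cons s word_eval_closed[of n s w] by (cases l) (simp_all add: adj_mult)
  finally show ?case .
qed simp

end

lemma cuntz_gens_word_eval: "cuntz_gens n J = word_eval (cuntz n) (cuntz_gen n) (map Gen J)"
  by (induction J) (simp_all add: cuntz_gens_def)

lemma cuntz_emb_single:
  "w \<in> lists (letters n) \<Longrightarrow> cuntz_emb n (single w) = word_eval (cuntz n) (cuntz_gen n) w"
proof (induction w)
  case Nil
  then show ?case using cuntz_emb.hom_one by (simp add: free_alg_one)
next
  case (Cons l w)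
  have "single (l # w) = single [l] \<otimes>\<^bsub>free_alg n\<^esub> single w"
    using Cons by (simp add: free_alg_single_mult)
  then have "cuntz_emb n (single (l # w)) = cuntz_emb n (single [l]) \<otimes>\<^bsub>cuntz n\<^esub> cuntz_emb n (single w)"
    using Cons by (simp add: cuntz_emb.hom_mult)
  moreover have "cuntz_emb n (single [GenAdj i]) = adj (cuntz n) (cuntz_gen n i)" if "i \<in> {1..n}" for i
    using cuntz_emb.hom_adj[of "free_gen i" n] free_gen_adj[OF that] that by (simp add: cuntz_gen_def)
  ultimately show ?case using Cons
    by (cases l) (simp_all add: cuntz_gen_def free_gen_def)
qed

text \<open>A word function that respects the Cuntz relations in every context, and is positive, extends to
  a state: its GNS seminorm is one of those over which \<^const>\<open>cuntz_norm\<close> is the supremum.\<close>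

locale cuntz_word_functional =
  fixes n :: nat and \<phi> :: "letter list \<Rightarrow> complex"
  assumes phi_pos: "f \<in> carrier (free_alg n) \<Longrightarrow> lin \<phi> (adj (free_alg n) f \<otimes>\<^bsub>free_alg n\<^esub> f) \<in> \<real>\<^sub>\<ge>\<^sub>0"
    and phi_one: "\<phi> [] = 1"
    and phi_orth: "u \<in> lists (letters n) \<Longrightarrow> v \<in> lists (letters n) \<Longrightarrow> i \<in> {1..n} \<Longrightarrow> j \<in> {1..n} \<Longrightarrow>
      \<phi> (u @ [GenAdj i, Gen j] @ v) = (if i = j then \<phi> (u @ v) else 0)"
    and phi_sum: "u \<in> lists (letters n) \<Longrightarrow> v \<in> lists (letters n) \<Longrightarrow>
      (\<Sum>i\<in>{1..n}. \<phi> (u @ [Gen i, GenAdj i] @ v)) = \<phi> (u @ v)"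
begin

abbreviation "FA \<equiv> free_alg n"

sublocale pf: positive_functional FA "lin \<phi>"
  by (intro positive_functional.intro free_alg.star_alg_axioms positive_functional_axioms.intro phi_pos)
    (simp_all add: free_alg_lin)

text \<open>The left factor is tested one word \<open>u\<close> at a time. What remains is a
  function of the middle word \<open>w\<close>, and its value on a relation is given by
  \<open>lin_orth_rel\<close> or \<open>lin_sum_rel\<close>.\<close>

lemma lin_context:
  assumes a: "a \<in> carrier FA" and b: "b \<in> carrier FA" and r: "r \<in> carrier FA"
    and eq: "\<And>u. u \<in> lists (letters n) \<Longrightarrow> lin (\<lambda>w. lin (\<lambda>v. \<phi> (u @ w @ v)) b) r = 0"
  shows "lin \<phi> (a \<otimes>\<^bsub>FA\<^esub> (r \<otimes>\<^bsub>FA\<^esub> b)) = 0"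
proof -
  have "lin \<phi> (a \<otimes>\<^bsub>FA\<^esub> (r \<otimes>\<^bsub>FA\<^esub> b)) = lin (\<lambda>u. lin (\<lambda>w. lin (\<lambda>v. \<phi> (u @ w @ v)) b) r) a"
    using a b r by (simp add: free_alg_lin)
  also have "\<dots> = lin (\<lambda>u. 0) a" using a eq by (intro free_alg_lin_cong) auto
  also have "\<dots> = 0" by (simp add: lin_def)
  finally show ?thesis .
qed

lemma orth_rel_vanish:
  assumes a: "a \<in> carrier FA" and b: "b \<in> carrier FA" and ij: "i \<in> {1..n}" "j \<in> {1..n}"
  shows "lin \<phi> (a \<otimes>\<^bsub>FA\<^esub> (orth_rel n i j \<otimes>\<^bsub>FA\<^esub> b)) = 0"
proof (rule lin_context)
  fix u assume u: "u \<in> lists (letters n)"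
  define \<psi> where "\<psi> = (\<lambda>w. lin (\<lambda>v. \<phi> (u @ w @ v)) b)"
  have "\<psi> [GenAdj i, Gen j] = lin (\<lambda>v. if i = j then \<phi> (u @ v) else 0) b"
    unfolding \<psi>_def by (rule free_alg_lin_cong[OF b], rule phi_orth[OF u _ ij]) simp
  also have "\<dots> = (if i = j then \<psi> [] else 0)" by (simp add: \<psi>_def) (simp add: lin_def)
  finally have "\<psi> [GenAdj i, Gen j] = (if i = j then \<psi> [] else 0)" .
  then show "lin (\<lambda>w. lin (\<lambda>v. \<phi> (u @ w @ v)) b) (orth_rel n i j) = 0"
    using lin_orth_rel[OF ij, of \<psi>] by (simp add: \<psi>_def)
qed (use a b ij in simp_all)

lemma sum_rel_vanish:
  assumes a: "a \<in> carrier FA" and b: "b \<in> carrier FA"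
  shows "lin \<phi> (a \<otimes>\<^bsub>FA\<^esub> (sum_rel n \<otimes>\<^bsub>FA\<^esub> b)) = 0"
proof (rule lin_context)
  fix u assume u: "u \<in> lists (letters n)"
  define \<psi> where "\<psi> = (\<lambda>w. lin (\<lambda>v. \<phi> (u @ w @ v)) b)"
  have "(\<Sum>i\<in>{1..n}. \<psi> [Gen i, GenAdj i]) = lin (\<lambda>v. \<Sum>i\<in>{1..n}. \<phi> (u @ [Gen i, GenAdj i] @ v)) b"
    by (simp add: \<psi>_def lin_sum_fun)
  also have "\<dots> = \<psi> []" unfolding \<psi>_def append_Nil
    by (rule free_alg_lin_cong[OF b], rule phi_sum[OF u]) simp
  finally have "(\<Sum>i\<in>{1..n}. \<psi> [Gen i, GenAdj i]) = \<psi> []" .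
  then show "lin (\<lambda>w. lin (\<lambda>v. \<phi> (u @ w @ v)) b) (sum_rel n) = 0"
    using lin_sum_rel[of \<psi> n] by (simp add: \<psi>_def)
qed (use a b in simp_all)

lemma om_norm_gen:
  assumes i: "i \<in> {1..n}" and y: "y \<in> carrier FA"
  shows "pf.om_norm (free_gen i \<otimes>\<^bsub>FA\<^esub> y) = pf.om_norm y"
proof -
  let ?g = "free_gen i"
  have "lin \<phi> (adj FA y \<otimes>\<^bsub>FA\<^esub> ((adj FA ?g \<otimes>\<^bsub>FA\<^esub> ?g) \<otimes>\<^bsub>FA\<^esub> y)) - lin \<phi> (adj FA y \<otimes>\<^bsub>FA\<^esub> y)
     = lin \<phi> (adj FA y \<otimes>\<^bsub>FA\<^esub> (orth_rel n i i \<otimes>\<^bsub>FA\<^esub> y))"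
    using i y by (simp add: orth_rel_def free_alg.minus_eq_smult free_alg.l_distr free_alg.r_distr
      free_alg.smult_mult_l free_alg.smult_mult_r pf.om_add pf.om_smult)
  then have "lin \<phi> (adj FA y \<otimes>\<^bsub>FA\<^esub> ((adj FA ?g \<otimes>\<^bsub>FA\<^esub> ?g) \<otimes>\<^bsub>FA\<^esub> y)) = lin \<phi> (adj FA y \<otimes>\<^bsub>FA\<^esub> y)"
    using orth_rel_vanish[of "adj FA y" y i i] i y by simp
  then show ?thesis using i y by (simp add: pf.om_norm_def free_alg.adj_mult free_alg.m_assoc)
qed

text \<open>By the sum relation the squared lengths of the vectors \<open>s_i^* y\<close> add up to
  that of \<open>y\<close>, and one summand is at most the sum.\<close>

lemma om_norm_gen_adj:
  assumes i: "i \<in> {1..n}" and y: "y \<in> carrier FA"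
  shows "pf.om_norm (adj FA (free_gen i) \<otimes>\<^bsub>FA\<^esub> y) \<le> pf.om_norm y"
proof -
  let ?q = "\<lambda>i. free_gen i \<otimes>\<^bsub>FA\<^esub> adj FA (free_gen i)"
  let ?s = "\<lambda>i. Re (lin \<phi> (adj FA (adj FA (free_gen i) \<otimes>\<^bsub>FA\<^esub> y) \<otimes>\<^bsub>FA\<^esub> (adj FA (free_gen i) \<otimes>\<^bsub>FA\<^esub> y)))"
  have S: "finsum FA ?q {1..n} \<in> carrier FA" by (rule free_alg.finsum_closed) auto
  have fin: "finsum FA f I \<otimes>\<^bsub>FA\<^esub> y = finsum FA (\<lambda>i. f i \<otimes>\<^bsub>FA\<^esub> y) I \<and>
      adj FA y \<otimes>\<^bsub>FA\<^esub> finsum FA f I = finsum FA (\<lambda>i. adj FA y \<otimes>\<^bsub>FA\<^esub> f i) I"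
    if "finite I" "\<And>i. i \<in> I \<Longrightarrow> f i \<in> carrier FA" for I :: "nat set" and f
    using that
  proof (induction I)
    case (insert i I)
    then have "f \<in> I \<rightarrow> carrier FA" by auto
    then show ?case using insert y by (simp add: free_alg.finsum_insert Pi_def free_alg.l_distr free_alg.r_distr free_alg.finsum_closed)
  qed (use y in simp)
  have "lin \<phi> (adj FA y \<otimes>\<^bsub>FA\<^esub> (finsum FA ?q {1..n} \<otimes>\<^bsub>FA\<^esub> y)) - lin \<phi> (adj FA y \<otimes>\<^bsub>FA\<^esub> y)
     = lin \<phi> (adj FA y \<otimes>\<^bsub>FA\<^esub> (sum_rel n \<otimes>\<^bsub>FA\<^esub> y))"
    using y S by (simp add: sum_rel_def free_alg.minus_eq_smult free_alg.l_distr free_alg.r_distr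
      free_alg.smult_mult_l free_alg.smult_mult_r pf.om_add pf.om_smult)
  then have "lin \<phi> (adj FA y \<otimes>\<^bsub>FA\<^esub> y) = lin \<phi> (adj FA y \<otimes>\<^bsub>FA\<^esub> (finsum FA ?q {1..n} \<otimes>\<^bsub>FA\<^esub> y))"
    using sum_rel_vanish[of "adj FA y" y] y by simp
  also have "\<dots> = lin \<phi> (finsum FA (\<lambda>i. adj FA y \<otimes>\<^bsub>FA\<^esub> (?q i \<otimes>\<^bsub>FA\<^esub> y)) {1..n})"
    using fin[of "{1..n}" ?q] fin[of "{1..n}" "\<lambda>i. ?q i \<otimes>\<^bsub>FA\<^esub> y"] y by simp
  also have "\<dots> = (\<Sum>i\<in>{1..n}. lin \<phi> (adj FA y \<otimes>\<^bsub>FA\<^esub> (?q i \<otimes>\<^bsub>FA\<^esub> y)))"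
    using y by (intro lin_finsum) auto
  finally have "Re (lin \<phi> (adj FA y \<otimes>\<^bsub>FA\<^esub> y)) = (\<Sum>i\<in>{1..n}. ?s i)"
    using y by (simp add: free_alg.adj_mult free_alg.m_assoc)
  moreover have "?s i \<le> (\<Sum>i\<in>{1..n}. ?s i)"
    using i y pf.om_pos' by (intro member_le_sum) auto
  ultimately show ?thesis unfolding pf.om_norm_def by simp
qed

text \<open>Every letter acts as a contraction by the two preceding lemmas, and boundedness passes
  to products and linear combinations.\<close>

sublocale gf: gns_family FA "{lin \<phi>}"
proof -
  interpret ff: functional_family FA "{lin \<phi>}"
    by (intro functional_family.intro free_alg.star_alg_axioms functional_family_axioms.intro)
      (simp add: pf.positive_functional_axioms)
  have gen: "gns_bounded FA {lin \<phi>} (single [l])" if "l \<in> letters n" for l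
  proof (rule ff.gns_boundedI[of _ 1])
    fix \<omega> y assume "\<omega> \<in> {lin \<phi>}" "y \<in> carrier FA"
    then show "positive_functional.om_norm FA \<omega> (single [l] \<otimes>\<^bsub>FA\<^esub> y) \<le> 1 * positive_functional.om_norm FA \<omega> y"
      using that om_norm_gen[of _ y] om_norm_gen_adj[of _ y]
      by (cases l) (auto simp: free_gen_adj, auto simp: free_gen_def)
  qed (use that in simp_all)
  have word: "gns_bounded FA {lin \<phi>} (single w)" if "w \<in> lists (letters n)" for w
    using that
  proof (induction w)
    case Nil
    show ?case unfolding free_alg_one[of n, symmetric] by (rule ff.gns_boundedI[of _ 1]) auto
  next
    case (Cons l w)
    have "single (l # w) = single [l] \<otimes>\<^bsub>FA\<^esub> single w" using Cons by (simp add: free_alg_single_mult)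
    moreover have "gns_bounded FA {lin \<phi>} (single [l] \<otimes>\<^bsub>FA\<^esub> single w)"
      using Cons gen by (intro ff.gns_bounded_mult) simp_all
    ultimately show ?case by simp
  qed
  have "gns_bounded FA {lin \<phi>} x" if "x \<in> carrier FA" for x
    using that
  proof (induction rule: free_alg_induct)
    case zero
    then show ?case by (rule ff.gns_bounded_zero)
  next
    case (add g c w)
    then show ?case using word by (intro ff.gns_bounded_add ff.gns_bounded_smult) auto
  qed
  then show "gns_family FA {lin \<phi>}"
    by (intro gns_family.intro ff.functional_family_axioms gns_family_axioms.intro)
      (simp_all add: free_alg_lin phi_one)
qed

lemma gns_norm_cuntz: "gns_norm FA {lin \<phi>} \<in> cuntz_seminorms n"
proof -
  have "gns_norm FA {lin \<phi>} r = 0" if r: "r \<in> cuntz_relations n" for r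
  proof -
    have rc: "r \<in> carrier FA" using r unfolding cuntz_relations_eq by auto
    have "lin \<phi> (a \<otimes>\<^bsub>FA\<^esub> (r \<otimes>\<^bsub>FA\<^esub> b)) = 0" if "a \<in> carrier FA" "b \<in> carrier FA" for a b
      using r that orth_rel_vanish sum_rel_vanish unfolding cuntz_relations_eq by auto
    then have "gns_norm FA {lin \<phi>} r \<le> 0"
      using rc by (intro gf.gns_norm_least) (auto simp: pf.om_norm_def)
    then show ?thesis using gf.gns_norm_nonneg[OF rc] by simp
  qed
  then show ?thesis using gf.gns_cstar_seminorm by (simp add: cuntz_seminorms_def)
qed

lemma cuntz_word_state:
  obtains \<omega> where "\<omega> \<in> states (cuntz n)"
    "\<And>w. w \<in> lists (letters n) \<Longrightarrow> \<omega> (word_eval (cuntz n) (cuntz_gen n) w) = \<phi> w"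
proof
  have le: "cmod (lin \<phi> a) \<le> cuntz_norm n a" if "a \<in> carrier FA" for a
    using gf.gns_norm_state[OF that, of "lin \<phi>"] cuntz_norm_upper[OF gns_norm_cuntz that] by simp
  have one: "lin \<phi> \<one>\<^bsub>FA\<^esub> = 1" by (simp add: free_alg_lin phi_one)
  note ext = cuntz_norm.ext_functional[OF pf.positive_functional_axioms le one]
  show "cuntz_norm.ext_functional n (lin \<phi>) \<in> states (cuntz n)"
    using ext(1) by (simp add: cuntz_def)
  show "cuntz_norm.ext_functional n (lin \<phi>) (word_eval (cuntz n) (cuntz_gen n) w) = \<phi> w"
    if "w \<in> lists (letters n)" for w
    using ext(2)[of "single w"] that by (simp flip: cuntz_emb_single)
qed

end

section \<open>Homogeneous tensors\<close>

lemma multi_indices_append: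
  assumes "length J = k"
  shows "J @ K \<in> multi_indices n (k + j) \<longleftrightarrow> J \<in> multi_indices n k \<and> K \<in> multi_indices n j"
  using assms by (auto simp: multi_indices_def)

lemma multi_indices_split:
  "L \<in> multi_indices n (k + j) \<longleftrightarrow> take k L \<in> multi_indices n k \<and> drop k L \<in> multi_indices n j" (is "_ = ?r")
proof
  assume "L \<in> multi_indices n (k + j)"
  then show ?r by (auto simp: multi_indices_def dest: in_set_takeD in_set_dropD)
next
  assume r: ?r
  then have "length (take k L) = k" by (simp add: multi_indices_def)
  from multi_indices_append[OF this, of "drop k L" n j] r show "L \<in> multi_indices n (k + j)" by simp
qed

lemma multi_indices_0 [simp]: "multi_indices n 0 = {[]}"
  by (auto simp: multi_indices_def)

lemma finite_multi_indices [simp]: "finite (multi_indices n m)"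
  unfolding multi_indices_def by (rule finite_lists_length_eq) simp

lemma multi_indices_length: "J \<in> multi_indices n m \<Longrightarrow> length J = m"
  by (simp add: multi_indices_def)

lemma sum_multi_indices_add:
  fixes f :: "nat list \<Rightarrow> 'a :: comm_monoid_add"
  shows "(\<Sum>L\<in>multi_indices n (k + j). f L) = (\<Sum>J\<in>multi_indices n k. \<Sum>K\<in>multi_indices n j. f (J @ K))"
proof -
  have "(\<Sum>L\<in>multi_indices n (k + j). f L) = (\<Sum>(J, K)\<in>multi_indices n k \<times> multi_indices n j. f (J @ K))"
  proof (rule sum.reindex_bij_witness[where i = "\<lambda>(J, K). J @ K" and j = "\<lambda>L. (take k L, drop k L)"])
    fix L assume "L \<in> multi_indices n (k + j)"
    then show "(take k L, drop k L) \<in> multi_indices n k \<times> multi_indices n j"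
      using multi_indices_split by auto
  qed (auto simp: multi_indices_append multi_indices_length)
  then show ?thesis by (simp add: sum.cartesian_product)
qed

lemma sum_multi_indices_1:
  "(\<Sum>L\<in>multi_indices n 1. f L) = (\<Sum>i\<in>{1..n}. f [i])"
  by (rule sum.reindex_bij_witness[where i = "\<lambda>i. [i]" and j = hd])
    (auto simp: multi_indices_def length_Suc_conv)

lemma vecs_eqI:
  assumes "x \<in> vecs n k" "y \<in> vecs n k" "\<And>J. J \<in> multi_indices n k \<Longrightarrow> x J = y J"
  shows "x = y"
  using assms unfolding vecs_def by (intro ext) (metis (mono_tags, lifting) mem_Collect_eq)

lemma vecs_outside: "x \<in> vecs n k \<Longrightarrow> J \<notin> multi_indices n k \<Longrightarrow> x J = 0"
  by (simp add: vecs_def)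

lemma vecs_nonzero:
  assumes "x \<in> vecs n k" "x \<noteq> (\<lambda>_. 0)"
  obtains J where "J \<in> multi_indices n k" "x J \<noteq> 0"
  using assms by (metis ext vecs_outside)

lemma vecs_smult: "x \<in> vecs n k \<Longrightarrow> (\<lambda>J. c * x J) \<in> vecs n k"
  by (simp add: vecs_def)

lemma vec_tensor_append [simp]: "length J = k \<Longrightarrow> vec_tensor k x y (J @ K) = x J * y K"
  by (simp add: vec_tensor_def)

lemma vec_tensor_vecs: "x \<in> vecs n k \<Longrightarrow> y \<in> vecs n j \<Longrightarrow> vec_tensor k x y \<in> vecs n (k + j)"
  by (auto simp: vecs_def vec_tensor_def multi_indices_split)

lemma vec_tensor_assoc:
  "vec_tensor (k + j) (vec_tensor k x y) w = vec_tensor k x (vec_tensor j y w)"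
  by (rule ext) (simp add: vec_tensor_def take_drop add.commute)

lemma vec_tensor_nonzero:
  assumes "x \<in> vecs n k" "x \<noteq> (\<lambda>_. 0)" "y \<noteq> (\<lambda>_. 0)"
  shows "vec_tensor k x y \<noteq> (\<lambda>_. 0)"
proof -
  obtain J where J: "J \<in> multi_indices n k" "x J \<noteq> 0" using vecs_nonzero[OF assms(1,2)] .
  obtain K where "y K \<noteq> 0" using assms(3) by blast
  with J have "vec_tensor k x y (J @ K) \<noteq> 0" by (simp add: multi_indices_length)
  then show ?thesis by metis
qed

lemma vec_power_vecs: "x \<in> vecs n k \<Longrightarrow> vec_power k x p \<in> vecs n (p * k)"
  by (induction p) (auto simp: vec_tensor_vecs, simp add: vecs_def)

lemma vec_power_0_tensor [simp]: "vec_tensor 0 (\<lambda>J. if J = [] then 1 else 0) y = y"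
  by (rule ext) (simp add: vec_tensor_def)

lemma vec_power_add:
  "vec_power k x (p + q) = vec_tensor (p * k) (vec_power k x p) (vec_power k x q)"
proof (induction p)
  case (Suc p)
  then show ?case by (simp add: vec_tensor_assoc)
qed simp

lemma vec_power_1 [simp]: "x \<in> vecs n k \<Longrightarrow> vec_power k x (Suc 0) = x"
  by (rule ext) (auto simp: vec_tensor_def vecs_def multi_indices_def)

lemma vec_power_smult: "vec_power k (\<lambda>J. c * x J) p = (\<lambda>J. c ^ p * vec_power k x p J)"
  by (induction p) (auto simp: vec_tensor_def algebra_simps)

lemma vec_power_nonzero:
  assumes "x \<in> vecs n k" "x \<noteq> (\<lambda>_. 0)"
  shows "vec_power k x p \<noteq> (\<lambda>_. 0)"
proof (induction p)
  case 0
  then show ?case by (auto simp: fun_eq_iff)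
next
  case (Suc p)
  then show ?case using vec_tensor_nonzero[OF assms] by simp
qed

lemma unit_vecs_nonzero: "x \<in> unit_vecs n k \<Longrightarrow> x \<noteq> (\<lambda>_. 0)"
  by (auto simp: unit_vecs_def)

lemma unit_vecs_vecs: "x \<in> unit_vecs n k \<Longrightarrow> x \<in> vecs n k"
  by (simp add: unit_vecs_def)

lemma unit_vecs_sum: "x \<in> unit_vecs n k \<Longrightarrow> (\<Sum>J\<in>multi_indices n k. (cmod (x J))\<^sup>2) = 1"
  by (simp add: unit_vecs_def)

lemma unit_vecs_tensor:
  assumes "x \<in> unit_vecs n k" "y \<in> unit_vecs n j"
  shows "vec_tensor k x y \<in> unit_vecs n (k + j)"
proof -
  have "(\<Sum>L\<in>multi_indices n (k + j). (cmod (vec_tensor k x y L))\<^sup>2)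
     = (\<Sum>J\<in>multi_indices n k. \<Sum>K\<in>multi_indices n j. (cmod (x J))\<^sup>2 * (cmod (y K))\<^sup>2)"
    unfolding sum_multi_indices_add
    by (intro sum.cong refl) (simp add: multi_indices_length norm_mult power_mult_distrib)
  also have "\<dots> = 1" using unit_vecs_sum[OF assms(1)] unit_vecs_sum[OF assms(2)]
    by (simp flip: sum_distrib_left)
  finally show ?thesis using assms vec_tensor_vecs by (simp add: unit_vecs_def)
qed

lemma unit_vecs_power: "x \<in> unit_vecs n k \<Longrightarrow> vec_power k x p \<in> unit_vecs n (p * k)"
proof (induction p)
  case 0
  then show ?case by (simp add: unit_vecs_def vecs_def)
next
  case (Suc p)
  then show ?case using unit_vecs_tensor[of x n k] by simp
qed

section \<open>Tensors up to a scalar, cancellation and common roots\<close>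

definition proportional :: "('a \<Rightarrow> complex) \<Rightarrow> ('a \<Rightarrow> complex) \<Rightarrow> bool" where
  "proportional x y \<longleftrightarrow> (\<exists>c. c \<noteq> 0 \<and> x = (\<lambda>J. c * y J))"

lemma proportional_refl [simp]: "proportional x x"
  unfolding proportional_def by (rule exI[of _ 1]) simp

lemma proportional_sym: "proportional x y \<Longrightarrow> proportional y x"
  unfolding proportional_def by (elim exE conjE, rule_tac x = "inverse c" in exI) auto

lemma proportional_tensor:
  "proportional x x' \<Longrightarrow> proportional y y' \<Longrightarrow> proportional (vec_tensor k x y) (vec_tensor k x' y')"
  unfolding proportional_def
  by (elim exE conjE, rule_tac x = "c * ca" in exI) (auto simp: vec_tensor_def)

text \<open>Fixing a suffix on which \<open>y\<close> does not vanish leaves a nonzero multiple of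
  \<open>x\<close> on one side and a multiple of \<open>x'\<close> on the other.\<close>

lemma proportional_prefix:
  assumes x: "x \<in> vecs n k" "x' \<in> vecs n k" and nz: "x \<noteq> (\<lambda>_. 0)" "y \<noteq> (\<lambda>_. 0)"
    and eq: "proportional (vec_tensor k x y) (vec_tensor k x' y')"
  shows "proportional x x'"
proof -
  obtain c where c: "c \<noteq> 0" "vec_tensor k x y = (\<lambda>J. c * vec_tensor k x' y' J)"
    using eq by (auto simp: proportional_def)
  obtain K where K: "y K \<noteq> 0" using nz by blast
  define a where "a = c * y' K / y K"
  have "x = (\<lambda>J. a * x' J)"
  proof (rule vecs_eqI[OF x(1) vecs_smult[OF x(2)]])
    fix J assume "J \<in> multi_indices n k"
    then have "x J * y K = c * (x' J * y' K)"
      using fun_cong[OF c(2), of "J @ K"] by (simp add: multi_indices_length)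
    then show "x J = a * x' J" using K by (simp add: a_def field_simps)
  qed
  moreover from this nz have "a \<noteq> 0" by auto
  ultimately show ?thesis by (auto simp: proportional_def)
qed

lemma proportional_suffix:
  assumes x: "x \<in> vecs n k" and nz: "x \<noteq> (\<lambda>_. 0)" "y \<noteq> (\<lambda>_. 0)"
    and eq: "proportional (vec_tensor k x y) (vec_tensor k x' y')"
  shows "proportional y y'"
proof -
  obtain c where c: "c \<noteq> 0" "vec_tensor k x y = (\<lambda>J. c * vec_tensor k x' y' J)"
    using eq by (auto simp: proportional_def)
  obtain J where J: "J \<in> multi_indices n k" "x J \<noteq> 0" using vecs_nonzero[OF x nz(1)] .
  define a where "a = c * x' J / x J"
  have "y = (\<lambda>K. a * y' K)"
  proof
    fix K
    have "x J * y K = c * (x' J * y' K)"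
      using fun_cong[OF c(2), of "J @ K"] J by (simp add: multi_indices_length)
    then show "y K = a * y' K" using J by (simp add: a_def field_simps)
  qed
  moreover from this nz have "a \<noteq> 0" by auto
  ultimately show ?thesis by (auto simp: proportional_def)
qed

text \<open>Fixing a suffix \<open>K\<close> with \<open>v K \<noteq> 0\<close> exhibits
  \<open>u\<close> as a slice of a multiple of \<open>x \<otimes> y\<close>. The suffix lies within
  the part that belongs to \<open>y\<close>, so the slice still begins with
  \<open>x\<close>.\<close>

lemma proportional_factor:
  assumes x: "x \<in> vecs n k" and u: "u \<in> vecs n (k + j)" and nz: "v \<noteq> (\<lambda>_. 0)"
    and eq: "proportional (vec_tensor k x y) (vec_tensor (k + j) u v)"
  obtains u' where "u' \<in> vecs n j" "u = vec_tensor k x u'"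
proof -
  obtain c where c: "vec_tensor (k + j) u v = (\<lambda>J. c * vec_tensor k x y J)"
    using proportional_sym[OF eq] by (auto simp: proportional_def)
  obtain K where K: "v K \<noteq> 0" using nz by blast
  define u' where "u' = (\<lambda>L. if L \<in> multi_indices n j then c * y (L @ K) / v K else 0)"
  have u': "u' \<in> vecs n j" by (simp add: vecs_def u'_def)
  have "u = vec_tensor k x u'"
  proof (rule vecs_eqI[OF u vec_tensor_vecs[OF x u']])
    fix L assume L: "L \<in> multi_indices n (k + j)"
    then have "u L * v K = c * (x (take k L) * y (drop k L @ K))"
      using fun_cong[OF c, of "L @ K"] by (simp add: vec_tensor_def multi_indices_length)
    then show "u L = vec_tensor k x u' L"
      using K L multi_indices_split[of L n k j] by (simp add: u'_def vec_tensor_def field_simps)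
  qed
  with u' show thesis by (rule that)
qed

text \<open>The Euclidean algorithm: of two vectors commuting up to a scalar, the one of lower order
  splits off the other one.\<close>

lemma commuting_common_root:
  assumes "x \<in> vecs n a" "y \<in> vecs n b" "a \<ge> 1" "b \<ge> 1" "x \<noteq> (\<lambda>_. 0)" "y \<noteq> (\<lambda>_. 0)"
    and "proportional (vec_tensor a x y) (vec_tensor b y x)"
  shows "\<exists>k w s t. k \<ge> 1 \<and> w \<in> vecs n k \<and> a = s * k \<and> b = t * k \<and>
    proportional x (vec_power k w s) \<and> proportional y (vec_power k w t)"
  using assms
proof (induction "a + b" arbitrary: a b x y rule: less_induct)
  case less
  \<comment> \<open>Stated for fresh names with the tensor of lower order first, so that both strict
    cases are instances.\<close>
  have step: "\<exists>k w s t. k \<ge> 1 \<and> w \<in> vecs n k \<and> a' = s * k \<and> b' = t * k \<and>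
      proportional x (vec_power k w s) \<and> proportional y (vec_power k w t)"
    if sz: "a' + b' = a + b" "a' < b'" and x: "x \<in> vecs n a'" "x \<noteq> (\<lambda>_. 0)" and y: "y \<in> vecs n b'" "y \<noteq> (\<lambda>_. 0)"
      and pos: "a' \<ge> 1" and pr: "proportional (vec_tensor a' x y) (vec_tensor b' y x)" for a' b' x y
  proof -
    obtain j where j: "b' = a' + j" "j \<ge> 1"
      using sz(2) by (metis less_imp_add_positive Suc_leI One_nat_def)
    obtain y' where y': "y' \<in> vecs n j" "y = vec_tensor a' x y'"
      using proportional_factor[OF x(1) y(1)[unfolded j] x(2) pr[unfolded j]] by blast
    have nz: "y' \<noteq> (\<lambda>_. 0)" using y(2) y'(2) by (auto simp: vec_tensor_def)
    \<comment> \<open>Substituting \<open>y = x \<otimes> y'\<close> gives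
      \<open>x \<otimes> x \<otimes> y'\<close> and \<open>x \<otimes> y' \<otimes> x\<close>; after
      cancelling the leading \<open>x\<close>, the tensors \<open>x\<close> and \<open>y'\<close>
      commute up to a scalar and have smaller total order.\<close>
    have "proportional (vec_tensor a' x (vec_tensor a' x y')) (vec_tensor a' x (vec_tensor j y' x))"
      using pr by (simp add: y' j vec_tensor_assoc)
    then have "proportional (vec_tensor a' x y') (vec_tensor j y' x)"
      by (rule proportional_suffix[OF x y(2)[unfolded y'(2)]])
    then obtain k w s t where k: "k \<ge> 1" "w \<in> vecs n k" "a' = s * k" "j = t * k"
      "proportional x (vec_power k w s)" "proportional y' (vec_power k w t)"
      using less.hyps[of a' j x y'] sz j pos x y' nz by auto
    have "proportional y (vec_power k w (s + t))"
      unfolding y'(2) vec_power_add using k by (simp add: proportional_tensor)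
    moreover have "b' = (s + t) * k" using j k by (simp add: algebra_simps)
    ultimately show ?thesis using k by blast
  qed
  consider "a < b" | "b < a" | "a = b" by linarith
  then show ?case
  proof cases
    case 1
    then show ?thesis using step[of a b x y] less.prems by simp
  next
    case 2
    then show ?thesis using step[of b a y x] less.prems proportional_sym by (metis add.commute)
  next
    case 3
    have "proportional y x"
      using less.prems 3 proportional_prefix[of y n b x x y] proportional_sym by blast
    then show ?thesis using less.prems 3
      by (rule_tac exI[of _ a], rule_tac exI[of _ x], rule_tac exI[of _ 1], rule_tac exI[of _ 1])
        (simp del: vec_power.simps)
  qed
qed

lemma vec_power_commute: "vec_tensor k x (vec_power k x p) = vec_tensor (p * k) (vec_power k x p) x"
  if "x \<in> vecs n k"
  using vec_power_add[of k x 1 p] vec_power_add[of k x p 1] that by (simp del: vec_power.simps)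

text \<open>The analogue of the fact that two words with a common power are powers of one word. If
  neither exponent is 1, the common power is long enough to show both \<open>x \<otimes> y\<close>
  and \<open>y \<otimes> x\<close> as its prefix, so \<open>x\<close> and \<open>y\<close> commute
  up to a scalar; otherwise one of them is itself a power of the other.\<close>

lemma powers_common_root:
  assumes x: "x \<in> vecs n a" "x \<noteq> (\<lambda>_. 0)" and y: "y \<in> vecs n b" "y \<noteq> (\<lambda>_. 0)"
    and pos: "a \<ge> 1" "b \<ge> 1" "p \<ge> 1" "q \<ge> 1" and deg: "p * a = q * b"
    and pr: "proportional (vec_power a x p) (vec_power b y q)"
  shows "\<exists>k w s t. k \<ge> 1 \<and> w \<in> vecs n k \<and> a = s * k \<and> b = t * k \<and>
    proportional x (vec_power k w s) \<and> proportional y (vec_power k w t)"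
proof (cases "p = 1 \<or> q = 1")
  case True
  then show ?thesis
  proof
    assume "p = 1"
    then show ?thesis using assms
      by (rule_tac exI[of _ b], rule_tac exI[of _ y], rule_tac exI[of _ q], rule_tac exI[of _ 1])
        (simp del: vec_power.simps)
  next
    assume "q = 1"
    then show ?thesis using assms
      by (rule_tac exI[of _ a], rule_tac exI[of _ x], rule_tac exI[of _ 1], rule_tac exI[of _ p])
        (simp add: proportional_sym del: vec_power.simps)
  qed
next
  case False
  then obtain p' q' where p': "p = Suc p'" "p' \<ge> 1" and q': "q = Suc q'" "q' \<ge> 1"
    using pos by (metis One_nat_def Suc_le_D Suc_leI neq0_conv)
  let ?X = "vec_power a x p'" and ?Y = "vec_power b y q'"
  have X: "?X \<in> vecs n (p' * a)" "?X \<noteq> (\<lambda>_. 0)" and Y: "?Y \<in> vecs n (q' * b)" "?Y \<noteq> (\<lambda>_. 0)"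
    using x y by (simp_all add: vec_power_vecs vec_power_nonzero)
  have base: "proportional (vec_tensor a x ?X) (vec_tensor b y ?Y)" using pr by (simp add: p' q')
  \<comment> \<open>Both exponents are at least 2, so the common order is at least
    \<open>2 * a\<close> and \<open>2 * b\<close>, hence at least \<open>a + b\<close>.\<close>
  have "a \<le> q' * b \<and> b \<le> p' * a"
  proof -
    have "2 * b \<le> q * b" "2 * a \<le> p * a" using p' q' by (auto intro!: mult_le_mono1)
    moreover have "q * b = b + q' * b" "p * a = a + p' * a" by (simp_all add: p' q')
    ultimately show ?thesis using deg by linarith
  qed
  then obtain i j where i: "q' * b = a + i" and j: "p' * a = b + j"
    using le_Suc_ex by blast
  \<comment> \<open>From \<open>x X \<sim> y Y\<close>, the powers \<open>X = y X'\<close> and \<open>Y = x Y'\<close> split, so that \<open>x y X' \<sim> y x Y'\<close>.\<close>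
  have rotX: "vec_tensor a x ?X = vec_tensor (p' * a) ?X x" by (rule vec_power_commute[OF x(1)])
  have rotY: "vec_tensor b y ?Y = vec_tensor (q' * b) ?Y y" by (rule vec_power_commute[OF y(1)])
  obtain X' where X': "?X = vec_tensor b y X'"
    using proportional_factor[OF y(1), of ?X j x ?Y] X j x(2) base
    by (metis proportional_sym rotX)
  obtain Y' where Y': "?Y = vec_tensor a x Y'"
    using proportional_factor[OF x(1), of ?Y i y ?X] Y i y(2) base
    by (metis rotY)
  have "proportional (vec_tensor (a + b) (vec_tensor a x y) X') (vec_tensor (b + a) (vec_tensor b y x) Y')"
    using base by (simp add: X' Y' vec_tensor_assoc)
  then have eq: "proportional (vec_tensor (a + b) (vec_tensor a x y) X') (vec_tensor (a + b) (vec_tensor b y x) Y')"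
    by (simp only: add.commute[of b a])
  have nz: "X' \<noteq> (\<lambda>_. 0)" using X(2) X' by (auto simp: vec_tensor_def)
  have yx: "vec_tensor b y x \<in> vecs n (a + b)"
    using vec_tensor_vecs[OF y(1) x(1)] by (simp only: add.commute)
  have "proportional (vec_tensor a x y) (vec_tensor b y x)"
    by (rule proportional_prefix[OF vec_tensor_vecs[OF x(1) y(1)] yx vec_tensor_nonzero[OF x y(2)] nz eq])
  then show ?thesis using commuting_common_root[OF x(1) y(1) pos(1,2) x(2) y(2)] by blast
qed

lemma complex_root:
  assumes "s \<ge> 1"
  obtains d :: complex where "d ^ s = c"
proof
  have "rcis (root s (cmod c)) (Arg c / s) ^ s = rcis (root s (cmod c) ^ s) (real s * (Arg c / s))"
    by (rule DeMoivre2)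
  also have "\<dots> = c" using assms by (simp add: rcis_cmod_Arg real_root_pow_pos2)
  finally show "rcis (root s (cmod c)) (Arg c / s) ^ s = c" .
qed

text \<open>Over the complex numbers the scalar has an \<open>s\<close>-th root, which is absorbed
  into \<open>w\<close>; the proportionality then becomes an exact power.\<close>

lemma nonperiodic_proportional:
  assumes z: "nonperiodic n z" and w: "k \<ge> 1" "w \<in> vecs n k" "s \<ge> 1"
    and pr: "proportional z (vec_power k w s)"
  shows "s = 1"
proof -
  obtain c where c: "z = (\<lambda>J. c * vec_power k w s J)" using pr by (auto simp: proportional_def)
  obtain d where "d ^ s = c" using complex_root[OF w(3)] by blast
  then have "z = vec_power k (\<lambda>J. d * w J) s" by (simp add: c vec_power_smult)
  then show ?thesis using z w vecs_smult[OF w(2)] unfolding nonperiodic_def by blast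
qed

section \<open>The product of homogeneous tensors\<close>

lemma index_box_length [simp]: "length (index_box n' J K) = min (length J) (length K)"
  by (simp add: index_box_def)

text \<open>The indices start at 1, so the pairing \<open>n' * (j - 1) + k\<close> is inverted by
  dividing \<open>l - 1\<close> by \<open>n'\<close>; quotient and remainder are shifted back by
  1.\<close>

definition unbox_left :: "nat \<Rightarrow> nat \<Rightarrow> nat" where "unbox_left n' l = (l - 1) div n' + 1"
definition unbox_right :: "nat \<Rightarrow> nat \<Rightarrow> nat" where "unbox_right n' l = (l - 1) mod n' + 1"

lemma unbox_box:
  assumes "j \<in> {1..n}" "k \<in> {1..n'}"
  shows "unbox_left n' (n' * (j - 1) + k) = j" "unbox_right n' (n' * (j - 1) + k) = k"
    "n' * (j - 1) + k \<in> {1..n * n'}"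
proof -
  obtain j' k' where jk: "j = Suc j'" "k = Suc k'" using assms by (metis atLeastAtMost_iff One_nat_def Suc_le_D)
  have "n' * j' + n' \<le> n' * n" using assms jk by (metis Suc_le_eq atLeastAtMost_iff mult_Suc_right mult_le_mono2 add.commute)
  then show "unbox_left n' (n' * (j - 1) + k) = j" "unbox_right n' (n' * (j - 1) + k) = k"
    "n' * (j - 1) + k \<in> {1..n * n'}"
    using assms jk by (auto simp: unbox_left_def unbox_right_def mult.commute)
qed

lemma box_unbox:
  assumes "l \<in> {1..n * n'}"
  shows "n' * (unbox_left n' l - 1) + unbox_right n' l = l" "unbox_left n' l \<in> {1..n}" "unbox_right n' l \<in> {1..n'}"
proof -
  have n': "n' > 0" using assms by (cases "n' = 0") auto
  show "n' * (unbox_left n' l - 1) + unbox_right n' l = l"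
    using assms by (simp add: unbox_left_def unbox_right_def)
  have "l - 1 < n * n'" using assms by auto
  then have "(l - 1) div n' < n" by (simp add: less_mult_imp_div_less)
  then show "unbox_left n' l \<in> {1..n}" by (simp add: unbox_left_def)
  have "(l - 1) mod n' < n'" using n' by simp
  then show "unbox_right n' l \<in> {1..n'}" by (simp add: unbox_right_def)
qed

lemma unbox_index_box:
  assumes "J \<in> multi_indices n m" "K \<in> multi_indices n' m"
  shows "map (unbox_left n') (index_box n' J K) = J" "map (unbox_right n') (index_box n' J K) = K"
    "index_box n' J K \<in> multi_indices (n * n') m"
proof -
  have J: "\<And>t. t < m \<Longrightarrow> J ! t \<in> {1..n}" "length J = m" and K: "\<And>t. t < m \<Longrightarrow> K ! t \<in> {1..n'}" "length K = m"
    using assms by (auto simp: multi_indices_def) (metis atLeastAtMost_iff nth_mem subset_iff)+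
  have nth: "index_box n' J K ! t = n' * (J ! t - 1) + K ! t" if "t < m" for t
    using that J(2) K(2) by (simp add: index_box_def)
  show "map (unbox_left n') (index_box n' J K) = J"
    by (rule nth_equalityI) (use J K nth unbox_box(1)[OF J(1) K(1)] in auto)
  show "map (unbox_right n') (index_box n' J K) = K"
    by (rule nth_equalityI) (use J K nth unbox_box(2)[OF J(1) K(1)] in auto)
  have "\<forall>t<m. index_box n' J K ! t \<in> {1..n * n'}"
    using nth unbox_box(3)[OF J(1) K(1)] by simp
  then show "index_box n' J K \<in> multi_indices (n * n') m"
    using J(2) K(2) unfolding multi_indices_def by (auto simp: in_set_conv_nth)
qed

lemma index_box_unbox:
  assumes "L \<in> multi_indices (n * n') m"
  shows "index_box n' (map (unbox_left n') L) (map (unbox_right n') L) = L"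
    "map (unbox_left n') L \<in> multi_indices n m" "map (unbox_right n') L \<in> multi_indices n' m"
proof -
  have L: "\<And>l. l \<in> set L \<Longrightarrow> l \<in> {1..n * n'}" "length L = m" using assms by (auto simp: multi_indices_def)
  have "index_box n' (map (unbox_left n') L) (map (unbox_right n') L) =
      map (\<lambda>l. n' * (unbox_left n' l - 1) + unbox_right n' l) L"
    by (simp add: index_box_def map2_map_map)
  also have "\<dots> = L" using box_unbox(1)[OF L(1)] by (intro map_idI) simp
  finally show "index_box n' (map (unbox_left n') L) (map (unbox_right n') L) = L" .
  show "map (unbox_left n') L \<in> multi_indices n m" "map (unbox_right n') L \<in> multi_indices n' m"
    using L box_unbox(2,3)[OF L(1)] by (auto simp: multi_indices_def simp del: atLeastAtMost_iff)
qed

lemma vec_box_eq: "vec_box n n' m x y L =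
  (if L \<in> multi_indices (n * n') m then x (map (unbox_left n') L) * y (map (unbox_right n') L) else 0)"
proof -
  let ?S = "{(J, K). J \<in> multi_indices n m \<and> K \<in> multi_indices n' m \<and> index_box n' J K = L}"
  have "?S = (if L \<in> multi_indices (n * n') m then {(map (unbox_left n') L, map (unbox_right n') L)} else {})"
    using unbox_index_box[of _ n m _ n'] index_box_unbox[of L n n' m] by (auto split: if_splits)
  then show ?thesis unfolding vec_box_def by simp
qed

lemma vec_box_vecs: "vec_box n n' m x y \<in> vecs (n * n') m"
  by (simp add: vecs_def vec_box_eq)

lemma vec_box_index_box:
  "J \<in> multi_indices n m \<Longrightarrow> K \<in> multi_indices n' m \<Longrightarrow> vec_box n n' m x y (index_box n' J K) = x J * y K"
  by (simp add: vec_box_eq unbox_index_box)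

lemma vec_box_tensor:
  "vec_tensor k (vec_box n n' k x y) (vec_box n n' j x' y')
    = vec_box n n' (k + j) (vec_tensor k x x') (vec_tensor k y y')"
  by (rule ext) (simp add: vec_tensor_def vec_box_eq multi_indices_split take_map drop_map)

lemma vec_box_power:
  assumes "n * n' > 0"
  shows "vec_power k (vec_box n n' k x y) p = vec_box n n' (p * k) (vec_power k x p) (vec_power k y p)"
proof (induction p)
  case 0
  then show ?case by (auto simp: vec_box_eq fun_eq_iff)
next
  case (Suc p)
  then show ?case by (simp add: vec_box_tensor)
qed

lemma sum_vec_box:
  fixes f :: "nat list \<Rightarrow> nat list \<Rightarrow> 'a :: comm_monoid_add"
  shows "(\<Sum>L\<in>multi_indices (n * n') m. f (map (unbox_left n') L) (map (unbox_right n') L))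
    = (\<Sum>J\<in>multi_indices n m. \<Sum>K\<in>multi_indices n' m. f J K)"
proof -
  have "(\<Sum>L\<in>multi_indices (n * n') m. f (map (unbox_left n') L) (map (unbox_right n') L))
    = (\<Sum>(J, K)\<in>multi_indices n m \<times> multi_indices n' m. f J K)"
    by (rule sum.reindex_bij_witness[where i = "\<lambda>(J, K). index_box n' J K"
          and j = "\<lambda>L. (map (unbox_left n') L, map (unbox_right n') L)"])
      (auto simp: unbox_index_box index_box_unbox)
  then show ?thesis by (simp add: sum.cartesian_product)
qed

lemma vec_box_unit:
  assumes "x \<in> unit_vecs n m" "y \<in> unit_vecs n' m"
  shows "vec_box n n' m x y \<in> unit_vecs (n * n') m"
proof -
  have "(\<Sum>L\<in>multi_indices (n * n') m. (cmod (vec_box n n' m x y L))\<^sup>2)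
    = (\<Sum>J\<in>multi_indices n m. \<Sum>K\<in>multi_indices n' m. (cmod (x J))\<^sup>2 * (cmod (y K))\<^sup>2)"
    by (subst sum_vec_box[symmetric]) (simp add: vec_box_eq norm_mult power_mult_distrib)
  also have "\<dots> = 1" using unit_vecs_sum[OF assms(1)] unit_vecs_sum[OF assms(2)]
    by (simp flip: sum_distrib_left)
  finally show ?thesis by (simp add: unit_vecs_def vec_box_vecs)
qed

text \<open>Fixing one index at which a factor does not vanish recovers the other factor up to the
  ratio of the two fixed values.\<close>

lemma vec_box_proportional:
  assumes x: "x \<in> vecs n m" "x' \<in> vecs n m" and y: "y \<in> vecs n' m" "y' \<in> vecs n' m"
    and nz: "x \<noteq> (\<lambda>_. 0)" "y \<noteq> (\<lambda>_. 0)"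
    and eq: "vec_box n n' m x y = vec_box n n' m x' y'"
  shows "proportional x x'" "proportional y y'"
proof -
  have pt: "x J * y K = x' J * y' K" if "J \<in> multi_indices n m" "K \<in> multi_indices n' m" for J K
    using fun_cong[OF eq, of "index_box n' J K"] that by (simp add: vec_box_index_box)
  obtain J where J: "J \<in> multi_indices n m" "x J \<noteq> 0" using vecs_nonzero[OF x(1) nz(1)] .
  obtain K where K: "K \<in> multi_indices n' m" "y K \<noteq> 0" using vecs_nonzero[OF y(1) nz(2)] .
  have nz': "x' J \<noteq> 0" "y' K \<noteq> 0" using pt[OF J(1) K(1)] J K by auto
  have "x = (\<lambda>I. (y' K / y K) * x' I)"
    by (rule vecs_eqI[OF x(1) vecs_smult[OF x(2)]]) (use pt[OF _ K(1)] K in \<open>simp add: field_simps\<close>)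
  then show "proportional x x'" unfolding proportional_def using nz' K by (intro exI[of _ "y' K / y K"]) simp
  have "y = (\<lambda>I. (x' J / x J) * y' I)"
    by (rule vecs_eqI[OF y(1) vecs_smult[OF y(2)]]) (use pt[OF J(1)] J in \<open>simp add: field_simps\<close>)
  then show "proportional y y'" unfolding proportional_def using nz' J by (intro exI[of _ "x' J / x J"]) simp
qed

text \<open>Up to the scalar \<open>v L\<close>, \<open>w\<close> is a slice of the product along
  the fixed suffix \<open>L\<close>, and such a slice is again a product, because unboxing acts
  letter by letter. The scalar is put into \<open>a\<close>.\<close>

lemma vec_box_factor:
  assumes w: "w \<in> vecs (n * n') k" and v: "v \<in> vecs (n * n') j" "v \<noteq> (\<lambda>_. 0)"
    and eq: "vec_tensor k w v = vec_box n n' (k + j) x y"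
  obtains a b where "a \<in> vecs n k" "b \<in> vecs n' k" "w = vec_box n n' k a b"
proof -
  obtain L where L: "L \<in> multi_indices (n * n') j" "v L \<noteq> 0" using vecs_nonzero[OF v] .
  let ?l = "map (unbox_left n')" and ?r = "map (unbox_right n')"
  define a where "a = (\<lambda>J. if J \<in> multi_indices n k then x (J @ ?l L) / v L else 0)"
  define b where "b = (\<lambda>K. if K \<in> multi_indices n' k then y (K @ ?r L) else 0)"
  have "w = vec_box n n' k a b"
  proof (rule vecs_eqI[OF w vec_box_vecs])
    fix I assume I: "I \<in> multi_indices (n * n') k"
    then have "w I * v L = x (?l I @ ?l L) * y (?r I @ ?r L)"
      using fun_cong[OF eq, of "I @ L"] L(1) by (simp add: vec_box_eq multi_indices_length multi_indices_append)
    then show "w I = vec_box n n' k a b I"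
      using I L(2) index_box_unbox(2,3)[OF I] by (simp add: vec_box_eq a_def b_def field_simps)
  qed
  moreover have "a \<in> vecs n k" "b \<in> vecs n' k" by (simp_all add: vecs_def a_def b_def)
  ultimately show thesis using that by blast
qed

lemma vec_box_nonzero:
  assumes "x \<in> vecs n m" "y \<in> vecs n' m" "x \<noteq> (\<lambda>_. 0)" "y \<noteq> (\<lambda>_. 0)"
  shows "vec_box n n' m x y \<noteq> (\<lambda>_. 0)"
proof -
  obtain J where J: "J \<in> multi_indices n m" "x J \<noteq> 0" using vecs_nonzero[OF assms(1,3)] .
  obtain K where K: "K \<in> multi_indices n' m" "y K \<noteq> 0" using vecs_nonzero[OF assms(2,4)] .
  have "vec_box n n' m x y (index_box n' J K) \<noteq> 0" using J K by (simp add: vec_box_index_box)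
  then show ?thesis by metis
qed

text \<open>\<open>a\<close> and \<open>z\<close> have a common root; by nonperiodicity
  \<open>z\<close> is proportional to the root itself, whose order divides that of
  \<open>a\<close>.\<close>

lemma nonperiodic_root_dvd:
  assumes z: "z \<in> vecs n m" "z \<noteq> (\<lambda>_. 0)" "nonperiodic n z" "m \<ge> 1"
    and a: "a \<in> vecs n k" "a \<noteq> (\<lambda>_. 0)" "k \<ge> 1" and pq: "p \<ge> 1" "q \<ge> 1" "p * k = q * m"
    and pr: "proportional (vec_power k a p) (vec_power m z q)"
  shows "m dvd k"
proof -
  obtain r w s t where r: "r \<ge> 1" "w \<in> vecs n r" "k = s * r" "m = t * r"
      "proportional z (vec_power r w t)"
    using powers_common_root[OF a(1,2) z(1,2) a(3) z(4) pq pr] by blast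
  have "t \<ge> 1" using r z(4) by (cases t) auto
  then have "t = 1" using nonperiodic_proportional[OF z(3) r(1,2) _ r(5)] by simp
  then show ?thesis using r by simp
qed

lemma nonperiodic_vec_star:
  assumes n: "n \<ge> 1" "n' \<ge> 1" and ml: "m \<ge> 1" "l \<ge> 1"
    and z: "z \<in> vecs n m" "z \<noteq> (\<lambda>_. 0)" "nonperiodic n z"
    and y: "y \<in> vecs n' l" "y \<noteq> (\<lambda>_. 0)" "nonperiodic n' y"
  shows "nonperiodic (n * n') (vec_star n n' m l z y)"
  unfolding nonperiodic_def
proof (intro allI impI ballI)
  fix p k :: nat and w assume p: "1 \<le> p" and k: "1 \<le> k" and w: "w \<in> vecs (n * n') k"
    and eq: "vec_star n n' m l z y = vec_power k w p"
  define d where "d = lcm m l"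
  have d: "d \<ge> 1" "d div m * m = d" "d div l * l = d" using ml by (auto simp: d_def Suc_le_eq lcm_pos_nat)
  have dm: "d div m \<ge> 1" "d div l \<ge> 1" using d by (metis Suc_leI One_nat_def mult_is_0 neq0_conv not_one_le_zero)+
  let ?Z = "vec_power m z (d div m)" and ?Y = "vec_power l y (d div l)"
  have Z: "?Z \<in> vecs n d" "?Z \<noteq> (\<lambda>_. 0)" and Y: "?Y \<in> vecs n' d" "?Y \<noteq> (\<lambda>_. 0)"
    using vec_power_vecs[OF z(1), of "d div m"] vec_power_vecs[OF y(1), of "d div l"] z y d
    by (simp_all add: vec_power_nonzero)
  have eq': "vec_power k w p = vec_box n n' d ?Z ?Y"
    using eq by (simp add: vec_star_def Let_def d_def)
  have nz: "vec_power k w p \<noteq> (\<lambda>_. 0)" unfolding eq' by (rule vec_box_nonzero[OF Z(1) Y(1) Z(2) Y(2)])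
  \<comment> \<open>Vectors do not carry their order. It is read off from the length of an index at
    which the nonzero vector does not vanish.\<close>
  have pk: "p * k = d"
  proof -
    obtain L where "L \<in> multi_indices (n * n') (p * k)" "vec_power k w p L \<noteq> 0"
      using vecs_nonzero[OF vec_power_vecs[OF w] nz] .
    then have "length L = p * k" "L \<in> multi_indices (n * n') d"
      using eq' vec_box_vecs[of n n' d] vecs_outside multi_indices_length by metis+
    then show ?thesis using multi_indices_length by metis
  qed
  obtain p' where p': "p = Suc p'" using p by (cases p) auto
  have wnz: "w \<noteq> (\<lambda>_. 0)" using nz unfolding p' by (auto simp: vec_tensor_def)
  have "vec_tensor k w (vec_power k w p') = vec_box n n' (k + p' * k) ?Z ?Y"
    using eq' pk by (simp add: p')
  then obtain a b where ab: "a \<in> vecs n k" "b \<in> vecs n' k" "w = vec_box n n' k a b"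
    using vec_box_factor[OF w vec_power_vecs[OF w] vec_power_nonzero[OF w wnz]] by blast
  have abnz: "a \<noteq> (\<lambda>_. 0)" "b \<noteq> (\<lambda>_. 0)" using wnz ab(3) by (auto simp: vec_box_eq)
  have pv: "vec_power k a p \<in> vecs n d" "vec_power k b p \<in> vecs n' d"
    using vec_power_vecs[OF ab(1), of p] vec_power_vecs[OF ab(2), of p] pk by simp_all
  have "vec_box n n' d (vec_power k a p) (vec_power k b p) = vec_box n n' d ?Z ?Y"
    using eq' vec_box_power[of n n' k a b p] n ab(3) pk by simp
  note pr = vec_box_proportional[OF pv(1) Z(1) pv(2) Y(1)
      vec_power_nonzero[OF ab(1) abnz(1)] vec_power_nonzero[OF ab(2) abnz(2)] this]
  have "m dvd k"
    using nonperiodic_root_dvd[OF z ml(1) ab(1) abnz(1) k p dm(1) _ pr(1)] pk d by simp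
  moreover have "l dvd k"
    using nonperiodic_root_dvd[OF y ml(2) ab(2) abnz(2) k p dm(2) _ pr(2)] pk d by simp
  \<comment> \<open>Now \<open>p * k = d\<close> divides \<open>k\<close>, which leaves only
    \<open>p = 1\<close>.\<close>
  ultimately have "d dvd k" by (simp add: d_def)
  then have "p * k \<le> 1 * k" using pk k by (simp add: dvd_imp_le)
  then show "p = 1" using p k by simp
qed

lemma vec_star_unit:
  assumes "m \<ge> 1" "l \<ge> 1" "z \<in> unit_vecs n m" "y \<in> unit_vecs n' l"
  shows "vec_star n n' m l z y \<in> unit_vecs (n * n') (lcm m l)"
proof -
  have "lcm m l div m * m = lcm m l" "lcm m l div l * l = lcm m l" by auto
  then show ?thesis
    using unit_vecs_power[OF assms(3), of "lcm m l div m"] unit_vecs_power[OF assms(4), of "lcm m l div l"]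
    by (simp add: vec_star_def Let_def vec_box_unit)
qed

lemma vec_star_same_order:
  "m \<ge> 1 \<Longrightarrow> z \<in> vecs n m \<Longrightarrow> y \<in> vecs n' m \<Longrightarrow> vec_star n n' m m z y = vec_box n n' m z y"
  by (simp add: vec_star_def del: vec_power.simps)

section \<open>Existence of sub-Cuntz states\<close>

text \<open>The generators act on functions of finite words. The vectors of interest are the functions that
  eventually grow by tensoring with \<open>z\<close> on the right; in these the inner product is computed on any
  \<open>m\<close> consecutive word lengths far out, and there the defect of \<open>\<Sum> s\<^sub>i s\<^sub>i\<^sup>* = 1\<close> at the empty word is
  invisible. The powers of \<open>z\<close> form the vector \<open>\<Omega>\<close> with \<open>s\<^sub>z \<Omega> = \<Omega>\<close>.\<close>

fun act :: "letter \<Rightarrow> (nat list \<Rightarrow> complex) \<Rightarrow> nat list \<Rightarrow> complex" where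
  "act (Gen i) g = (\<lambda>W. case W of [] \<Rightarrow> 0 | j # W' \<Rightarrow> if j = i then g W' else 0)"
| "act (GenAdj i) g = (\<lambda>W. g (i # W))"

definition act_word :: "letter list \<Rightarrow> (nat list \<Rightarrow> complex) \<Rightarrow> nat list \<Rightarrow> complex" where
  "act_word w g = foldr act w g"

lemma act_word_simps [simp]:
  "act_word [] g = g" "act_word (l # w) g = act l (act_word w g)" "act_word (u @ v) g = act_word u (act_word v g)"
  by (simp_all add: act_word_def)

lemma act_orth: "act (GenAdj i) (act (Gen j) g) = (if i = j then g else (\<lambda>W. 0))"
  by auto

lemma act_word_zero: "act_word w (\<lambda>W. 0) = (\<lambda>W. 0)"
proof (induction w)
  case (Cons l w)
  then show ?case by (cases l) (auto split: list.split)
qed simp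

lemma act_word_rev_adj: "act_word (rev (map GenAdj J)) g = (\<lambda>W. g (J @ W))"
proof (induction J arbitrary: g)
  case (Cons a J)
  then show ?case by simp
qed simp

lemma multi_indices_words: "J \<in> multi_indices n m \<Longrightarrow> map Gen J \<in> lists (letters n)"
  by (auto simp: multi_indices_def subset_iff)

locale subcuntz_data =
  fixes n m :: nat and z :: "nat list \<Rightarrow> complex"
  assumes m: "1 \<le> m" and z: "z \<in> unit_vecs n m"
begin

definition tail_from :: "nat \<Rightarrow> (nat list \<Rightarrow> complex) \<Rightarrow> bool" where
  "tail_from N g \<longleftrightarrow> (\<forall>W W'. N \<le> length W \<longrightarrow> W' \<in> multi_indices n m \<longrightarrow> g (W @ W') = g W * z W')"

definition tail :: "(nat list \<Rightarrow> complex) \<Rightarrow> bool" where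
  "tail g \<longleftrightarrow> (\<exists>N. tail_from N g)"

definition layer :: "nat \<Rightarrow> (nat list \<Rightarrow> complex) \<Rightarrow> (nat list \<Rightarrow> complex) \<Rightarrow> complex" where
  "layer k g h = (\<Sum>W\<in>multi_indices n k. cnj (g W) * h W)"

text \<open>Summed over all lengths, the squared length of \<open>\<Omega>\<close> would diverge,
  since each multiple of \<open>m\<close> contributes 1. A window of \<open>m\<close> consecutive
  lengths meets every residue modulo \<open>m\<close> exactly once.\<close>

definition form_at :: "nat \<Rightarrow> (nat list \<Rightarrow> complex) \<Rightarrow> (nat list \<Rightarrow> complex) \<Rightarrow> complex" where
  "form_at N g h = (\<Sum>k\<in>{N..<N + m}. layer k g h)"

text \<open>On the functions of interest \<open>form_at N\<close> is constant for large
  \<open>N\<close>; the limit spares the choice of an \<open>N\<close> for each pair of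
  arguments.\<close>

definition form :: "(nat list \<Rightarrow> complex) \<Rightarrow> (nat list \<Rightarrow> complex) \<Rightarrow> complex" where
  "form g h = lim (\<lambda>N. form_at N g h)"

lemma z_norm: "(\<Sum>K\<in>multi_indices n m. cnj (z K) * z K) = 1"
proof -
  have "(\<Sum>K\<in>multi_indices n m. cnj (z K) * z K) = of_real (\<Sum>K\<in>multi_indices n m. (cmod (z K))\<^sup>2)"
    unfolding of_real_sum by (intro sum.cong refl) (metis complex_norm_square mult.commute)
  then show ?thesis using unit_vecs_sum[OF z] by simp
qed

lemma tail_from_mono: "tail_from N g \<Longrightarrow> N \<le> N' \<Longrightarrow> tail_from N' g"
  unfolding tail_from_def by auto

text \<open>Far out, appending a word of length \<open>m\<close> multiplies by a coordinate of the
  unit vector \<open>z\<close>, so layers at distance \<open>m\<close> agree. A window moved by one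
  therefore gains what it loses, and \<open>form_at\<close> stabilizes.\<close>

lemma layer_tail:
  assumes "tail_from N g" "tail_from N h" "N \<le> k"
  shows "layer (k + m) g h = layer k g h"
proof -
  have "layer (k + m) g h = (\<Sum>J\<in>multi_indices n k. \<Sum>K\<in>multi_indices n m. (cnj (g J) * h J) * (cnj (z K) * z K))"
    unfolding layer_def sum_multi_indices_add
    by (intro sum.cong refl) (use assms in \<open>simp add: tail_from_def multi_indices_length\<close>)
  also have "\<dots> = layer k g h" using z_norm by (simp add: layer_def flip: sum_distrib_left)
  finally show ?thesis .
qed

lemma form_at_Suc:
  assumes "tail_from N g" "tail_from N h" "N \<le> k"
  shows "form_at (Suc k) g h = form_at k g h"
proof -
  have "form_at (Suc k) g h = (\<Sum>i\<in>{Suc k..<k + m}. layer i g h) + layer (k + m) g h"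
    unfolding form_at_def using m by simp
  also have "\<dots> = layer k g h + (\<Sum>i\<in>{Suc k..<k + m}. layer i g h)" using layer_tail[OF assms] by simp
  also have "\<dots> = form_at k g h" unfolding form_at_def using m by (simp add: sum.atLeast_Suc_lessThan)
  finally show ?thesis .
qed

lemma form_at_const:
  assumes "tail_from N g" "tail_from N h" "N \<le> k"
  shows "form_at k g h = form_at N g h"
  using assms(3)
proof (induction k rule: dec_induct)
  case (step k)
  then show ?case using form_at_Suc[OF assms(1,2), of k] by simp
qed simp

lemma form_eqI: "eventually (\<lambda>N. form_at N g h = c) sequentially \<Longrightarrow> form g h = c"
  unfolding form_def by (rule limI) (rule tendsto_eventually)

lemma form_eventually:
  assumes "tail g" "tail h"
  shows "eventually (\<lambda>N. form_at N g h = form g h) sequentially"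
proof -
  obtain M N where "tail_from M g" "tail_from N h" using assms by (auto simp: tail_def)
  then have t: "tail_from (max M N) g" "tail_from (max M N) h" by (auto intro: tail_from_mono)
  then have ev: "eventually (\<lambda>k. form_at k g h = form_at (max M N) g h) sequentially"
    using form_at_const[OF t] unfolding eventually_sequentially by blast
  then show ?thesis using form_eqI[OF ev] by simp
qed

lemma tail_act:
  assumes "tail g"
  shows "tail (act l g)"
proof -
  obtain N where N: "tail_from N g" using assms by (auto simp: tail_def)
  show ?thesis
  proof (cases l)
    case (Gen i)
    have "tail_from (Suc N) (act l g)"
      using N unfolding tail_from_def Gen by (auto simp: neq_Nil_conv split: list.split)
    then show ?thesis by (auto simp: tail_def)
  next
    case (GenAdj i)
    have "tail_from N (act l g)"
      unfolding tail_from_def GenAdj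
    proof (intro allI impI)
      fix W W' :: "nat list" assume "N \<le> length W" "W' \<in> multi_indices n m"
      then show "act (GenAdj i) g (W @ W') = act (GenAdj i) g W * z W'"
        using N[unfolded tail_from_def, rule_format, of "i # W" W'] by simp
    qed
    then show ?thesis by (auto simp: tail_def)
  qed
qed

lemma tail_act_word: "tail g \<Longrightarrow> tail (act_word w g)"
  by (induction w) (auto intro: tail_act)

lemma layer_Suc: "layer (Suc k) g h = (\<Sum>j\<in>{1..n}. \<Sum>K\<in>multi_indices n k. cnj (g (j # K)) * h (j # K))"
  unfolding layer_def using sum_multi_indices_add[of "\<lambda>W. cnj (g W) * h W" n 1 k]
  by (simp add: sum_multi_indices_1[simplified])

lemma form_at_shift: "form_at (Suc N) g h = (\<Sum>k\<in>{N..<N + m}. layer (Suc k) g h)"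
  unfolding form_at_def using sum.shift_bounds_Suc_ivl[of "\<lambda>k. layer k g h" N "N + m"] by simp

text \<open>A generator lengthens words by one letter, so the windows on the two sides are shifted
  against each other by one. The direction of the shift depends on whether the letter is a generator
  or an adjoint, hence the disjunction; in the limit the shift disappears.\<close>

lemma form_at_adj:
  assumes "l \<in> letters n"
  shows "form_at (Suc N) (act l g) h = form_at N g (act (letter_adj l) h) \<or>
    form_at N (act l g) h = form_at (Suc N) g (act (letter_adj l) h)"
proof (cases l)
  case (Gen i)
  have "layer (Suc k) (act l g) h = layer k g (act (letter_adj l) h)" for k
  proof -
    have "layer (Suc k) (act l g) h = (\<Sum>j\<in>{1..n}. if j = i then \<Sum>K\<in>multi_indices n k. cnj (g K) * h (i # K) else 0)"
      unfolding layer_Suc Gen by (intro sum.cong refl) auto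
    also have "\<dots> = layer k g (act (letter_adj l) h)" using assms Gen by (simp add: layer_def)
    finally show ?thesis .
  qed
  then show ?thesis by (simp add: form_at_shift) (simp add: form_at_def)
next
  case (GenAdj i)
  have "layer (Suc k) g (act (letter_adj l) h) = layer k (act l g) h" for k
  proof -
    have "layer (Suc k) g (act (letter_adj l) h)
        = (\<Sum>j\<in>{1..n}. if j = i then \<Sum>K\<in>multi_indices n k. cnj (g (i # K)) * h K else 0)"
      unfolding layer_Suc GenAdj by (intro sum.cong refl) auto
    also have "\<dots> = layer k (act l g) h" using assms GenAdj by (simp add: layer_def)
    finally show ?thesis .
  qed
  then show ?thesis by (simp add: form_at_shift) (simp add: form_at_def)
qed

lemma form_adj:
  assumes "l \<in> letters n" "tail g" "tail h"
  shows "form (act l g) h = form g (act (letter_adj l) h)"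
proof -
  have e1: "eventually (\<lambda>N. form_at N (act l g) h = form (act l g) h) sequentially"
    and e2: "eventually (\<lambda>N. form_at N g (act (letter_adj l) h) = form g (act (letter_adj l) h)) sequentially"
    using assms by (auto intro!: form_eventually tail_act)
  have "eventually (\<lambda>N. form (act l g) h = form g (act (letter_adj l) h)) sequentially"
    using e1 e2 e1[THEN eventually_sequentially_Suc[THEN iffD2]] e2[THEN eventually_sequentially_Suc[THEN iffD2]]
  proof eventually_elim
    case (elim N)
    then show ?case using form_at_adj[OF assms(1), of N g h] by auto
  qed
  then show ?thesis by simp
qed

lemma form_adj_word:
  assumes "w \<in> lists (letters n)" "tail g" "tail h"
  shows "form (act_word (rev (map letter_adj w)) g) h = form g (act_word w h)"
  using assms(1,2)
proof (induction w arbitrary: g)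
  case (Cons l w)
  have "form (act_word (rev (map letter_adj (l # w))) g) h
      = form (act_word (rev (map letter_adj w)) (act (letter_adj l) g)) h" by simp
  also have "\<dots> = form (act (letter_adj l) g) (act_word w h)"
    using Cons by (intro Cons.IH) (auto intro: tail_act)
  also have "\<dots> = form g (act l (act_word w h))"
    using Cons assms(3) by (subst form_adj) (auto intro: tail_act_word)
  finally show ?case by simp
qed simp

definition \<Omega> :: "nat list \<Rightarrow> complex" where
  "\<Omega> W = (if m dvd length W then vec_power m z (length W div m) W else 0)"

lemma Omega_append_right: "W' \<in> multi_indices n m \<Longrightarrow> \<Omega> (W @ W') = \<Omega> W * z W'"
proof -
  assume W': "W' \<in> multi_indices n m"
  then have len: "length W' = m" by (rule multi_indices_length)
  have "vec_power m z (Suc q) (W @ W') = vec_power m z q W * z W'" if "length W = q * m" for q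
    using vec_power_add[of m z q 1] that unit_vecs_vecs[OF z] by (simp del: vec_power.simps(2))
  then show ?thesis using m len by (auto simp: \<Omega>_def simp del: vec_power.simps)
qed

text \<open>The preceding lemma, on the right end, puts \<open>\<Omega>\<close> among the functions
  with a tail. This one, on the left end, is the eigenvalue equation
  \<open>s_J^* \<Omega> = z_J \<Omega>\<close>.\<close>

lemma Omega_append_left: "J \<in> multi_indices n m \<Longrightarrow> \<Omega> (J @ W) = z J * \<Omega> W"
  using m multi_indices_length[of J n m] by (auto simp: \<Omega>_def)

lemma tail_Omega: "tail_from 0 \<Omega>"
  by (simp add: tail_from_def Omega_append_right)

lemma tail_Omega' [simp]: "tail \<Omega>"
  using tail_Omega by (auto simp: tail_def)

text \<open>\<open>\<Omega>\<close> has its tail from length 0 on, so the window of lengths below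
  \<open>m\<close> may be used; its only multiple of \<open>m\<close> is the length 0 of the empty
  word.\<close>

lemma form_Omega: "form \<Omega> \<Omega> = 1"
proof (rule form_eqI, rule eventuallyI)
  fix N
  have "form_at N \<Omega> \<Omega> = form_at 0 \<Omega> \<Omega>" by (rule form_at_const[OF tail_Omega tail_Omega]) simp
  also have "\<dots> = layer 0 \<Omega> \<Omega> + (\<Sum>k\<in>{1..<m}. layer k \<Omega> \<Omega>)"
    unfolding form_at_def using m by (simp add: sum.atLeast_Suc_lessThan)
  also have "layer 0 \<Omega> \<Omega> = 1" by (simp add: layer_def \<Omega>_def)
  also have "(\<Sum>k\<in>{1..<m}. layer k \<Omega> \<Omega>) = 0"
  proof (rule sum.neutral, rule ballI)
    fix k assume "k \<in> {1..<m}"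
    then have "\<not> m dvd k" by (auto dest: dvd_imp_le)
    then show "layer k \<Omega> \<Omega> = 0" unfolding layer_def
      by (intro sum.neutral) (auto simp: \<Omega>_def multi_indices_length)
  qed
  finally show "form_at N \<Omega> \<Omega> = 1" by simp
qed

definition word_coeff :: "letter list \<Rightarrow> complex" where
  "word_coeff w = form \<Omega> (act_word w \<Omega>)"

lemma word_coeff_split:
  assumes "u \<in> lists (letters n)"
  shows "word_coeff (u @ v) = form (act_word (rev (map letter_adj u)) \<Omega>) (act_word v \<Omega>)"
  unfolding word_coeff_def act_word_simps
  by (rule form_adj_word[symmetric]) (use assms in \<open>auto intro: tail_act_word\<close>)

lemma word_coeff_adj_split:
  assumes "u \<in> lists (letters n)"
  shows "word_coeff (rev (map letter_adj u) @ v) = form (act_word u \<Omega>) (act_word v \<Omega>)"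
proof -
  have "rev (map letter_adj u) \<in> lists (letters n)" using words.madj_closed[of u n] assms by simp
  moreover have "rev (map letter_adj (rev (map letter_adj u))) = u" by (simp add: rev_map comp_def)
  ultimately show ?thesis using word_coeff_split[of "rev (map letter_adj u)" v] by simp
qed

lemma word_coeff_pos:
  assumes f: "f \<in> carrier (free_alg n)"
  shows "lin word_coeff (adj (free_alg n) f \<otimes>\<^bsub>free_alg n\<^esub> f) \<in> \<real>\<^sub>\<ge>\<^sub>0"
proof -
  define S where "S = {w. f w \<noteq> 0}"
  have fin: "finite S" and sub: "S \<subseteq> lists (letters n)"
    using f by (auto simp: S_def free_alg_def words.MA_carrier)
  have "lin word_coeff (adj (free_alg n) f \<otimes>\<^bsub>free_alg n\<^esub> f)
      = (\<Sum>u\<in>S. \<Sum>v\<in>S. cnj (f u) * f v * word_coeff (rev (map letter_adj u) @ v))"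
    using f by (simp add: free_alg_lin) (simp add: lin_def S_def sum_distrib_left mult.assoc)
  also have "\<dots> = (\<Sum>u\<in>S. \<Sum>v\<in>S. cnj (f u) * f v * form (act_word u \<Omega>) (act_word v \<Omega>))"
    by (intro sum.cong refl arg_cong2[where f = "(*)"] word_coeff_adj_split) (use sub in blast)
  finally have eq: "lin word_coeff (adj (free_alg n) f \<otimes>\<^bsub>free_alg n\<^esub> f) = \<dots>" .
  \<comment> \<open>The support is finite, so one window computes the form for all pairs of words
    simultaneously. In that window the double sum is the squared length of the single vector
    \<open>g\<close>.\<close>
  have "eventually (\<lambda>N. \<forall>uv\<in>S \<times> S. form_at N (act_word (fst uv) \<Omega>) (act_word (snd uv) \<Omega>)
      = form (act_word (fst uv) \<Omega>) (act_word (snd uv) \<Omega>)) sequentially"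
    by (rule eventually_ball_finite) (auto simp: fin intro!: form_eventually tail_act_word)
  then obtain N where N: "\<And>u v. u \<in> S \<Longrightarrow> v \<in> S \<Longrightarrow>
      form_at N (act_word u \<Omega>) (act_word v \<Omega>) = form (act_word u \<Omega>) (act_word v \<Omega>)"
    by (auto simp: eventually_sequentially)
  define g where "g W = (\<Sum>u\<in>S. f u * act_word u \<Omega> W)" for W
  have "(\<Sum>u\<in>S. \<Sum>v\<in>S. cnj (f u) * f v * form (act_word u \<Omega>) (act_word v \<Omega>))
      = (\<Sum>u\<in>S. \<Sum>v\<in>S. \<Sum>k\<in>{N..<N + m}. \<Sum>W\<in>multi_indices n k.
          cnj (f u * act_word u \<Omega> W) * (f v * act_word v \<Omega> W))"
    by (intro sum.cong refl) (simp add: N[symmetric] form_at_def layer_def sum_distrib_left mult_ac)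
  also have "\<dots> = (\<Sum>k\<in>{N..<N + m}. \<Sum>W\<in>multi_indices n k. \<Sum>u\<in>S. \<Sum>v\<in>S.
          cnj (f u * act_word u \<Omega> W) * (f v * act_word v \<Omega> W))"
  proof -
    have "(\<Sum>u\<in>S. \<Sum>v\<in>S. \<Sum>k\<in>K. \<Sum>W\<in>M k. F u v W) = (\<Sum>k\<in>K. \<Sum>W\<in>M k. \<Sum>u\<in>S. \<Sum>v\<in>S. F u v W)"
      for K :: "nat set" and M :: "nat \<Rightarrow> nat list set" and F :: "letter list \<Rightarrow> letter list \<Rightarrow> nat list \<Rightarrow> complex"
    proof -
      have "(\<Sum>u\<in>S. \<Sum>v\<in>S. \<Sum>k\<in>K. \<Sum>W\<in>M k. F u v W) = (\<Sum>u\<in>S. \<Sum>k\<in>K. \<Sum>W\<in>M k. \<Sum>v\<in>S. F u v W)"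
        by (rule sum.cong[OF refl], subst sum.swap, rule sum.cong[OF refl], rule sum.swap)
      also have "\<dots> = (\<Sum>k\<in>K. \<Sum>W\<in>M k. \<Sum>u\<in>S. \<Sum>v\<in>S. F u v W)"
        by (subst sum.swap, rule sum.cong[OF refl], rule sum.swap)
      finally show ?thesis .
    qed
    then show ?thesis .
  qed
  also have "\<dots> = (\<Sum>k\<in>{N..<N + m}. \<Sum>W\<in>multi_indices n k. cnj (g W) * g W)"
    by (simp add: g_def sum_product)
  also have "\<dots> = of_real (\<Sum>k\<in>{N..<N + m}. \<Sum>W\<in>multi_indices n k. (cmod (g W))\<^sup>2)"
    unfolding of_real_sum by (intro sum.cong refl) (metis complex_norm_square mult.commute)
  also have "\<dots> \<in> \<real>\<^sub>\<ge>\<^sub>0" unfolding nonneg_Reals_of_real_iff by (intro sum_nonneg) simp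
  finally show ?thesis unfolding eq .
qed

lemma form_sum:
  assumes "tail g" "tail h"
  shows "(\<Sum>i\<in>{1..n}. form h (act (Gen i) (act (GenAdj i) g))) = form h g"
proof -
  have "layer (Suc k) h (act (Gen i) (act (GenAdj i) g)) = (\<Sum>K\<in>multi_indices n k. cnj (h (i # K)) * g (i # K))"
    if "i \<in> {1..n}" for i k
  proof -
    have "layer (Suc k) h (act (Gen i) (act (GenAdj i) g))
        = (\<Sum>j\<in>{1..n}. if j = i then \<Sum>K\<in>multi_indices n k. cnj (h (i # K)) * g (i # K) else 0)"
      unfolding layer_Suc by (intro sum.cong refl) auto
    then show ?thesis using that by simp
  qed
  then have layer: "(\<Sum>i\<in>{1..n}. layer (Suc k) h (act (Gen i) (act (GenAdj i) g))) = layer (Suc k) h g" for k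
    unfolding layer_Suc[of k h g] by simp
  \<comment> \<open>\<open>s_i s_i^*\<close> projects onto the words beginning with
    \<open>i\<close>, so the sum misses the empty word only. A window starting at
    \<open>Suc N\<close> does not contain the length 0.\<close>
  have form: "(\<Sum>i\<in>{1..n}. form_at (Suc N) h (act (Gen i) (act (GenAdj i) g))) = form_at (Suc N) h g" for N
    unfolding form_at_shift by (subst sum.swap) (simp only: layer)
  have "eventually (\<lambda>N. \<forall>i\<in>{1..n}. form_at N h (act (Gen i) (act (GenAdj i) g))
      = form h (act (Gen i) (act (GenAdj i) g))) sequentially"
    by (rule eventually_ball_finite) (auto simp: assms simp del: act.simps intro!: form_eventually tail_act)
  moreover have "eventually (\<lambda>N. form_at N h g = form h g) sequentially"
    using assms by (intro form_eventually)
  ultimately have "eventually (\<lambda>N. (\<forall>i\<in>{1..n}. form_at N h (act (Gen i) (act (GenAdj i) g))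
      = form h (act (Gen i) (act (GenAdj i) g))) \<and> form_at N h g = form h g) sequentially"
    by (rule eventually_conj)
  then obtain N0 where N0: "\<And>N. N \<ge> N0 \<Longrightarrow> (\<forall>i\<in>{1..n}. form_at N h (act (Gen i) (act (GenAdj i) g))
      = form h (act (Gen i) (act (GenAdj i) g))) \<and> form_at N h g = form h g"
    unfolding eventually_sequentially by blast
  show ?thesis using N0[of "Suc N0"] form[of N0] by (simp del: act.simps)
qed

sublocale cuntz_word_functional n word_coeff
proof
  show "word_coeff [] = 1" by (simp add: word_coeff_def form_Omega)
  fix u v assume u: "u \<in> lists (letters n)" and v: "v \<in> lists (letters n)"
  show "word_coeff (u @ [GenAdj i, Gen j] @ v) = (if i = j then word_coeff (u @ v) else 0)" for i j
  proof -
    have "form g (\<lambda>W. 0) = 0" for g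
      by (rule form_eqI) (simp add: form_at_def layer_def)
    then show ?thesis
      by (simp only: word_coeff_def act_word_simps act_orth) (simp add: act_word_zero)
  qed
  show "(\<Sum>i\<in>{1..n}. word_coeff (u @ [Gen i, GenAdj i] @ v)) = word_coeff (u @ v)"
    unfolding word_coeff_split[OF u] unfolding act_word_simps
    by (rule form_sum) (simp_all add: tail_act_word)
qed (rule word_coeff_pos)

lemma word_coeff_gens:
  assumes J: "J \<in> multi_indices n m"
  shows "word_coeff (map Gen J) = cnj (z J)"
proof -
  have w: "map Gen J \<in> lists (letters n)" using J by (rule multi_indices_words)
  have "word_coeff (map Gen J) = form (act_word (rev (map GenAdj J)) \<Omega>) \<Omega>"
    using word_coeff_split[OF w, of "[]"] by (simp add: comp_def)
  also have "\<dots> = form (\<lambda>W. z J * \<Omega> W) \<Omega>" by (simp add: act_word_rev_adj Omega_append_left[OF J])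
  also have "\<dots> = cnj (z J)"
  proof (rule form_eqI)
    have "form_at N (\<lambda>W. z J * \<Omega> W) \<Omega> = cnj (z J) * form_at N \<Omega> \<Omega>" for N
      by (simp add: form_at_def layer_def sum_distrib_left mult.assoc)
    then show "eventually (\<lambda>N. form_at N (\<lambda>W. z J * \<Omega> W) \<Omega> = cnj (z J)) sequentially"
      using form_eventually[OF tail_Omega' tail_Omega'] by (simp add: form_Omega eventually_mono)
  qed
  finally show ?thesis .
qed

lemma sub_cuntz_state_exists: "\<exists>\<omega>. sub_cuntz_state n m z \<omega>"
proof -
  obtain \<omega> where om: "\<omega> \<in> states (cuntz n)"
    "\<And>w. w \<in> lists (letters n) \<Longrightarrow> \<omega> (word_eval (cuntz n) (cuntz_gen n) w) = word_coeff w"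
    using cuntz_word_state by blast
  have "\<omega> (cuntz_gens n J) = cnj (z J)" if J: "J \<in> multi_indices n m" for J
  proof -
    have "map Gen J \<in> lists (letters n)" using J by (rule multi_indices_words)
    then show ?thesis using om(2) word_coeff_gens[OF J] by (simp add: cuntz_gens_word_eval)
  qed
  with om(1) show ?thesis unfolding sub_cuntz_state_def by blast
qed

end

section \<open>Uniqueness of sub-Cuntz states\<close>

lemma (in positive_functional) om_finsum:
  assumes "finite I" "\<And>i. i \<in> I \<Longrightarrow> f i \<in> carrier A" "a \<in> carrier A" "b \<in> carrier A"
  shows "\<omega> (a \<otimes> (finsum A f I \<otimes> b)) = (\<Sum>i\<in>I. \<omega> (a \<otimes> (f i \<otimes> b)))"
  using assms(1,2)
proof (induction I)
  case (insert i I)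
  then have "f \<in> I \<rightarrow> carrier A" by auto
  then show ?case using insert assms(3,4) by (simp add: finsum_insert l_distr r_distr om_add finsum_closed)
qed (use assms in simp)

section \<open>Words in a Cuntz family and their normal form\<close>

context cuntz_family
begin

definition gens :: "nat list \<Rightarrow> 'a" where
  "gens J = word_eval A s (map Gen J)"

lemma gens_simps [simp]: "gens [] = \<one>" "gens (j # J) = s j \<otimes> gens J"
  by (simp_all add: gens_def)

lemma gens_closed [simp]:
  assumes "J \<in> multi_indices n k"
  shows "gens J \<in> carrier A"
  using word_eval_closed[of n s "map Gen J"] multi_indices_words[OF assms] by (simp add: gens_def)

lemma gens_append:
  assumes "J \<in> multi_indices n k" "K \<in> multi_indices n j"
  shows "gens (J @ K) = gens J \<otimes> gens K"
  using word_eval_append[of n s "map Gen J" "map Gen K"] multi_indices_words[OF assms(1)] multi_indices_words[OF assms(2)]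
  by (simp add: gens_def)

lemma gens_split:
  assumes "L \<in> multi_indices n (k + j)"
  shows "gens L = gens (take k L) \<otimes> gens (drop k L)"
  using gens_append[of "take k L" k "drop k L" j] assms by (simp add: multi_indices_split)

text \<open>Letters are added on the left. A generator extends \<open>J\<close>. The adjoint of a
  generator cancels the first letter of \<open>J\<close> or makes the word vanish; if
  \<open>J\<close> is empty it moves over to \<open>K\<close>, because the adjoint of
  \<open>s_K s_i\<close> is \<open>s_i^* s_K^*\<close>.\<close>

lemma word_normal_form:
  assumes "w \<in> lists (letters n)"
  shows "word_eval A s w = \<zero> \<or> (\<exists>j k. \<exists>J\<in>multi_indices n j. \<exists>K\<in>multi_indices n k.
    word_eval A s w = gens J \<otimes> adj A (gens K))"
  using assms
proof (induction w)
  case Nil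
  have "word_eval A s [] = gens [] \<otimes> adj A (gens [])" by simp
  then show ?case by (metis multi_indices_0 singletonI)
next
  case (Cons l w)
  consider "word_eval A s w = \<zero>" | j k J K where "J \<in> multi_indices n j" "K \<in> multi_indices n k"
    "word_eval A s w = gens J \<otimes> adj A (gens K)"
    using Cons.IH by blast
  then show ?case
  proof cases
    case 1
    then show ?thesis using Cons.hyps by (cases l) simp_all
  next
    case (2 j k J K)
    note JK = gens_closed[OF 2(1)] gens_closed[OF 2(2)]
    show ?thesis
    proof (cases l)
      case (Gen i)
      then have i: "i \<in> {1..n}" using Cons.hyps by simp
      have "i # J \<in> multi_indices n (Suc j)" using i 2(1) by (simp add: multi_indices_def)
      moreover have "word_eval A s (l # w) = gens (i # J) \<otimes> adj A (gens K)"
        using Gen i 2(3) JK by (simp add: m_assoc)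
      ultimately show ?thesis using 2(2) by blast
    next
      case (GenAdj i)
      then have i: "i \<in> {1..n}" using Cons.hyps by simp
      show ?thesis
      proof (cases J)
        case Nil
        have si: "[i] \<in> multi_indices n 1" using i by (simp add: multi_indices_def)
        have "word_eval A s (l # w) = gens [] \<otimes> adj A (gens (K @ [i]))"
          using GenAdj Nil 2(3) i JK gens_append[OF 2(2) si] by (simp add: adj_mult)
        moreover have "K @ [i] \<in> multi_indices n (k + 1)" using si 2(2) by (simp add: multi_indices_def)
        ultimately show ?thesis by (metis multi_indices_0 singletonI)
      next
        case (Cons h J')
        then have h: "h \<in> {1..n}" and J': "J' \<in> multi_indices n (length J')" using 2(1) by (auto simp: multi_indices_def)
        have "word_eval A s (l # w) = (adj A (s i) \<otimes> s h) \<otimes> (gens J' \<otimes> adj A (gens K))"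
          using GenAdj Cons 2(3) i h JK gens_closed[OF J'] by (simp add: m_assoc)
        also have "\<dots> = (if i = h then gens J' \<otimes> adj A (gens K) else \<zero>)"
          using s_orth[OF i h] JK gens_closed[OF J'] by simp
        finally show ?thesis using J' 2(2) by (auto split: if_splits)
      qed
    qed
  qed
qed

end

section \<open>Functionals with prescribed values on the words of length m\<close>

locale sub_cuntz_functional = cuntz_family A n s + positive_functional A \<omega>
  for A :: "('a, 'm) star_algebra_scheme" (structure) and n s \<omega> +
  fixes m :: nat and z :: "nat list \<Rightarrow> complex"
  assumes om_one: "\<omega> \<one> = 1" and m: "1 \<le> m" and z: "z \<in> unit_vecs n m"
    and om_gens: "J \<in> multi_indices n m \<Longrightarrow> \<omega> (gens J) = cnj (z J)"
begin

text \<open>The sum relation iterated: the range projections of all words of one length add up to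
  the identity, so words of any length can be inserted between two factors.\<close>

lemma resolution:
  assumes "a \<in> carrier A" "b \<in> carrier A"
  shows "(\<Sum>K\<in>multi_indices n k. \<omega> ((a \<otimes> gens K) \<otimes> (adj A (gens K) \<otimes> b))) = \<omega> (a \<otimes> b)"
  using assms
proof (induction k arbitrary: a b)
  case 0
  then show ?case by simp
next
  case (Suc k)
  have one: "[j] \<in> multi_indices n 1" if "j \<in> {1..n}" for j using that by (simp add: multi_indices_def)
  have "(\<Sum>K\<in>multi_indices n (1 + k). \<omega> ((a \<otimes> gens K) \<otimes> (adj A (gens K) \<otimes> b)))
     = (\<Sum>j\<in>{1..n}. \<Sum>K\<in>multi_indices n k. \<omega> (((a \<otimes> s j) \<otimes> gens K) \<otimes> (adj A (gens K) \<otimes> (adj A (s j) \<otimes> b))))"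
    unfolding sum_multi_indices_add sum_multi_indices_1
    by (intro sum.cong refl) (use Suc.prems in \<open>simp add: adj_mult m_assoc\<close>)
  also have "\<dots> = (\<Sum>j\<in>{1..n}. \<omega> (a \<otimes> ((s j \<otimes> adj A (s j)) \<otimes> b)))"
    by (intro sum.cong refl, subst Suc.IH) (use Suc.prems in \<open>simp_all add: m_assoc\<close>)
  also have "\<dots> = \<omega> (a \<otimes> (finsum A (\<lambda>j. s j \<otimes> adj A (s j)) {1..n} \<otimes> b))"
    by (rule om_finsum[symmetric]) (use Suc.prems in simp_all)
  also have "\<dots> = \<omega> (a \<otimes> b)" using s_sum Suc.prems by simp
  finally show ?case by simp
qed

text \<open>\<open>s\<^sub>J\<^sup>* \<Omega> = z\<^sub>J \<Omega>\<close>: the squared norms of the vectors \<open>s\<^sub>J\<^sup>* \<Omega> - z\<^sub>J \<Omega>\<close> add up to zero.\<close>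

lemma om_mult_adj_gens:
  assumes a: "a \<in> carrier A" and J: "J \<in> multi_indices n m"
  shows "\<omega> (a \<otimes> adj A (gens J)) = z J * \<omega> a"
proof -
  define b where "b J = adj A (gens J) \<oplus> (- z J) \<odot> \<one>" for J
  have bc: "b J \<in> carrier A" if "J \<in> multi_indices n m" for J using that by (simp add: b_def)
  have "\<omega> (adj A (b J) \<otimes> b J) = \<omega> (gens J \<otimes> adj A (gens J)) - cnj (z J) * z J" if J: "J \<in> multi_indices n m" for J
    unfolding b_def using expand_sq[of "adj A (gens J)" \<one> "- z J"] J om_adj[of "gens J"] om_gens[OF J]
    by (simp add: om_one algebra_simps)
  then have "(\<Sum>J\<in>multi_indices n m. \<omega> (adj A (b J) \<otimes> b J))
      = (\<Sum>J\<in>multi_indices n m. \<omega> (gens J \<otimes> adj A (gens J))) - (\<Sum>J\<in>multi_indices n m. cnj (z J) * z J)"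
    by (simp add: sum_subtractf)
  also have "(\<Sum>J\<in>multi_indices n m. \<omega> (gens J \<otimes> adj A (gens J))) = 1"
  proof -
    have "(\<Sum>J\<in>multi_indices n m. \<omega> (gens J \<otimes> adj A (gens J)))
      = (\<Sum>J\<in>multi_indices n m. \<omega> ((\<one> \<otimes> gens J) \<otimes> (adj A (gens J) \<otimes> \<one>)))"
      by (intro sum.cong refl) simp
    then show ?thesis using resolution[of \<one> \<one> m] om_one by simp
  qed
  also have "(\<Sum>J\<in>multi_indices n m. cnj (z J) * z J) = 1"
    using subcuntz_data.z_norm[of n m z] m z by (simp add: subcuntz_data_def)
  finally have sum0: "(\<Sum>J\<in>multi_indices n m. Re (\<omega> (adj A (b J) \<otimes> b J))) = 0"
    by (simp flip: Re_sum)
  have "Re (\<omega> (adj A (b J) \<otimes> b J)) = 0"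
    using sum_nonneg_0[OF finite_multi_indices _ sum0 J] om_pos'(1)[OF bc] by simp
  \<comment> \<open>A vector of length 0 is orthogonal to every vector.\<close>
  then have "(cmod (\<omega> (a \<otimes> b J)))\<^sup>2 \<le> 0"
    using cauchy_schwarz[of "adj A a" "b J"] a bc[OF J] by simp
  then have "\<omega> (a \<otimes> b J) = 0" by simp
  moreover have "\<omega> (a \<otimes> b J) = \<omega> (a \<otimes> adj A (gens J)) - z J * \<omega> a"
    unfolding b_def using a J by (simp add: r_distr smult_mult_r om_add om_smult)
  ultimately show ?thesis by simp
qed

lemma om_mult_adj_gens_power:
  assumes "a \<in> carrier A" "K \<in> multi_indices n (q * m)"
  shows "\<omega> (a \<otimes> adj A (gens K)) = vec_power m z q K * \<omega> a"
  using assms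
proof (induction q arbitrary: K a)
  case 0
  then show ?case by simp
next
  case (Suc q)
  then have K: "take m K \<in> multi_indices n m" "drop m K \<in> multi_indices n (q * m)" and KK: "K \<in> multi_indices n (m + q * m)"
    by (simp_all add: multi_indices_split)
  have "\<omega> (a \<otimes> adj A (gens K)) = \<omega> ((a \<otimes> adj A (gens (drop m K))) \<otimes> adj A (gens (take m K)))"
    unfolding gens_split[OF KK] using K Suc.prems by (simp add: adj_mult m_assoc)
  also have "\<dots> = z (take m K) * (vec_power m z q (drop m K) * \<omega> a)"
    using K Suc.prems by (simp add: om_mult_adj_gens Suc.IH)
  finally show ?case by (simp add: vec_tensor_def)
qed

lemma om_gens_mult_power:
  assumes a: "a \<in> carrier A" and K: "K \<in> multi_indices n (q * m)"
  shows "\<omega> (gens K \<otimes> a) = cnj (vec_power m z q K) * \<omega> a"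
proof -
  have "\<omega> (gens K \<otimes> a) = cnj (\<omega> (adj A a \<otimes> adj A (gens K)))"
    using a K om_adj[of "gens K \<otimes> a"] by (simp add: adj_mult)
  then show ?thesis using a K om_mult_adj_gens_power[of "adj A a" K q] by (simp add: om_adj)
qed

lemma om_gens_short:
  assumes np: "nonperiodic n z" and r: "0 < r" "r < m" and J: "J \<in> multi_indices n r"
  shows "\<omega> (gens J) = 0"
proof -
  define x where "x J = (if J \<in> multi_indices n r then \<omega> (adj A (gens J)) else 0)" for J
  have x: "x \<in> vecs n r" by (simp add: vecs_def x_def)
  have zv: "z \<in> vecs n m" "z \<noteq> (\<lambda>_. 0)" using unit_vecs_vecs[OF z] unit_vecs_nonzero[OF z] by auto
  define u v where "u = vec_tensor m z x" and "v = vec_tensor r x z"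
  have uv: "u \<in> vecs n (r + m)" "v \<in> vecs n (r + m)"
    using vec_tensor_vecs[OF zv(1) x] vec_tensor_vecs[OF x zv(1)] by (simp_all add: u_def v_def add.commute)
  \<comment> \<open>This is the contraction of \<open>u = z \<otimes> x\<close> with
    \<open>z\<close> in the last \<open>m\<close> places. The projections \<open>s_K s_K^*\<close>
    are inserted on the left, and the outer \<open>s_K\<close> then contributes the scalar
    \<open>cnj (z K)\<close>.\<close>
  have xu: "x J = (\<Sum>K\<in>multi_indices n m. cnj (z K) * u (J @ K))" if J: "J \<in> multi_indices n r" for J
  proof -
    have "x J = (\<Sum>K\<in>multi_indices n m. \<omega> ((\<one> \<otimes> gens K) \<otimes> (adj A (gens K) \<otimes> adj A (gens J))))"
      using J by (subst resolution) (simp_all add: x_def)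
    also have "\<dots> = (\<Sum>K\<in>multi_indices n m. cnj (z K) * u (J @ K))"
    proof (intro sum.cong refl)
      fix K assume K: "K \<in> multi_indices n m"
      let ?L = "J @ K"
      have L: "?L \<in> multi_indices n (m + r)"
        using multi_indices_append[of J r K n m] J K by (simp add: multi_indices_length add.commute)
      then have td: "take m ?L \<in> multi_indices n m" "drop m ?L \<in> multi_indices n r"
        by (simp_all only: multi_indices_split)
      have 1: "\<omega> ((\<one> \<otimes> gens K) \<otimes> (adj A (gens K) \<otimes> adj A (gens J))) = cnj (z K) * \<omega> (adj A (gens K) \<otimes> adj A (gens J))"
        using om_gens_mult_power[of "adj A (gens K) \<otimes> adj A (gens J)" K 1] J K zv(1)
        by (simp del: vec_power.simps)
      \<comment> \<open>The word \<open>J @ K\<close> is cut again, now after \<open>m\<close>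
        letters instead of \<open>r\<close>. The adjoint of the first \<open>m\<close> letters
        stands on the right and becomes a coordinate of \<open>z\<close>; the remaining
        \<open>r\<close> letters give a coordinate of \<open>x\<close>.\<close>
      have "adj A (gens K) \<otimes> adj A (gens J) = adj A (gens ?L)"
        using J K by (simp add: gens_append adj_mult)
      also have "\<dots> = adj A (gens (drop m ?L)) \<otimes> adj A (gens (take m ?L))"
        unfolding gens_split[OF L] by (rule adj_mult[OF gens_closed[OF td(1)] gens_closed[OF td(2)]])
      finally have 2: "adj A (gens K) \<otimes> adj A (gens J) = adj A (gens (drop m ?L)) \<otimes> adj A (gens (take m ?L))" .
      have "\<omega> (adj A (gens (drop m ?L)) \<otimes> adj A (gens (take m ?L))) = z (take m ?L) * x (drop m ?L)"
        using om_mult_adj_gens[OF adj_closed[OF gens_closed[OF td(2)]] td(1)] td(2) by (simp only: x_def if_True)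
      also have "\<dots> = u ?L" by (simp only: u_def vec_tensor_def)
      finally show "\<omega> ((\<one> \<otimes> gens K) \<otimes> (adj A (gens K) \<otimes> adj A (gens J))) = cnj (z K) * u ?L"
        unfolding 1 unfolding 2 by simp
    qed
    finally show ?thesis .
  qed
  define X where "X = (\<Sum>J\<in>multi_indices n r. (cmod (x J))\<^sup>2)"
  have nv: "(\<Sum>L\<in>multi_indices n (r + m). (cmod (v L))\<^sup>2) = X"
  proof -
    have "(\<Sum>L\<in>multi_indices n (r + m). (cmod (v L))\<^sup>2)
        = (\<Sum>J\<in>multi_indices n r. \<Sum>K\<in>multi_indices n m. (cmod (x J))\<^sup>2 * (cmod (z K))\<^sup>2)"
      unfolding sum_multi_indices_add
      by (intro sum.cong refl) (simp add: v_def multi_indices_length norm_mult power_mult_distrib)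
    then show ?thesis using unit_vecs_sum[OF z] by (simp add: X_def flip: sum_distrib_left)
  qed
  have nu: "(\<Sum>L\<in>multi_indices n (r + m). (cmod (u L))\<^sup>2) = X"
  proof -
    have "(\<Sum>L\<in>multi_indices n (m + r). (cmod (u L))\<^sup>2)
        = (\<Sum>J\<in>multi_indices n m. \<Sum>K\<in>multi_indices n r. (cmod (z J))\<^sup>2 * (cmod (x K))\<^sup>2)"
      unfolding sum_multi_indices_add
      by (intro sum.cong refl) (simp add: u_def multi_indices_length norm_mult power_mult_distrib)
    then show ?thesis using unit_vecs_sum[OF z]
      by (simp add: X_def add.commute flip: sum_distrib_left sum_distrib_right)
  qed
  have "(\<Sum>L\<in>multi_indices n (r + m). cnj (v L) * u L)
      = (\<Sum>J\<in>multi_indices n r. cnj (x J) * (\<Sum>K\<in>multi_indices n m. cnj (z K) * u (J @ K)))"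
    unfolding sum_multi_indices_add sum_distrib_left
    by (intro sum.cong refl) (simp add: v_def multi_indices_length mult.assoc)
  also have "\<dots> = (\<Sum>J\<in>multi_indices n r. cnj (x J) * x J)"
    by (intro sum.cong refl) (simp only: xu)
  also have "\<dots> = of_real X"
    unfolding X_def of_real_sum by (intro sum.cong refl) (metis complex_norm_square mult.commute)
  finally have "(\<Sum>L\<in>multi_indices n (r + m). Re (cnj (v L) * u L)) = X"
    by (simp only: Re_complex_of_real flip: Re_sum)
  \<comment> \<open>\<open>u\<close> and \<open>v\<close> have the same squared length
    \<open>X\<close>, and their inner product is \<open>X\<close> too, so their squared distance is
    \<open>X + X - 2 * X\<close>.\<close>
  moreover have "(cmod (u L - v L))\<^sup>2 = (cmod (u L))\<^sup>2 + (cmod (v L))\<^sup>2 - 2 * Re (cnj (v L) * u L)" for L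
    unfolding cmod_power2 by (simp add: power2_eq_square algebra_simps)
  ultimately have "(\<Sum>L\<in>multi_indices n (r + m). (cmod (u L - v L))\<^sup>2) = 0"
    using nu nv by (simp add: sum_subtractf sum.distrib flip: sum_distrib_left)
  then have "u L = v L" if "L \<in> multi_indices n (r + m)" for L
    using that sum_nonneg_0[of "multi_indices n (r + m)" "\<lambda>L. (cmod (u L - v L))\<^sup>2" L] by simp
  then have eq: "u = v" using vecs_eqI[OF uv] by blast
  have "x = (\<lambda>_. 0)"
  proof (rule ccontr)
    assume nz: "x \<noteq> (\<lambda>_. 0)"
    have "proportional (vec_tensor r x z) (vec_tensor m z x)" using eq by (simp add: u_def v_def)
    then obtain k w s t where w: "k \<ge> 1" "w \<in> vecs n k" "r = s * k" "m = t * k"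
      "proportional z (vec_power k w t)"
      using commuting_common_root[OF x zv(1) _ m nz zv(2)] r by auto
    have "t \<ge> 1" using w m by (cases t) auto
    then have "t = 1" using nonperiodic_proportional[OF np w(1,2) _ w(5)] by simp
    \<comment> \<open>Here \<open>k = m\<close>, so the order \<open>r\<close> of \<open>x\<close>
      would be a multiple of \<open>m\<close> although \<open>0 < r < m\<close>.\<close>
    then show False using w r by (cases s) auto
  qed
  then have "x J = 0" by simp
  then show ?thesis using J om_adj[of "gens J"] by (simp add: x_def)
qed

text \<open>Blocks of \<open>m\<close> letters are stripped from the left, each giving a scalar. The
  rest is shorter than \<open>m\<close>, where the functional vanishes unless the rest is empty. The
  right-hand side no longer mentions the functional.\<close>

lemma om_gens_eq:
  assumes np: "nonperiodic n z" and J: "J \<in> multi_indices n k"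
  shows "\<omega> (gens J) = (if m dvd k then cnj (vec_power m z (k div m) J) else 0)"
proof -
  define q r where "q = k div m" and "r = k mod m"
  have k: "k = q * m + r" by (simp add: q_def r_def)
  have J': "take (q * m) J \<in> multi_indices n (q * m)" "drop (q * m) J \<in> multi_indices n r"
    using J unfolding k by (simp_all only: multi_indices_split)
  have "\<omega> (gens J) = cnj (vec_power m z q (take (q * m) J)) * \<omega> (gens (drop (q * m) J))"
    using om_gens_mult_power[OF gens_closed[OF J'(2)] J'(1)] gens_split[of J "q * m" r] J by (simp only: k)
  moreover have "\<omega> (gens (drop (q * m) J)) = 0" if "r \<noteq> 0"
    using om_gens_short[OF np _ _ J'(2)] that m by (simp add: r_def)
  moreover have "take (q * m) J = J" "drop (q * m) J = []" if "r = 0"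
    using multi_indices_length[OF J] that by (simp_all add: k)
  ultimately show ?thesis using om_one by (cases "r = 0") (auto simp: r_def q_def dvd_eq_mod_eq_0)
qed

text \<open>Inserting \<open>\<Sum> s\<^sub>L s\<^sub>L\<^sup>* = 1\<close> between \<open>s\<^sub>J\<close> and \<open>s\<^sub>K\<^sup>*\<close> makes the length of \<open>KL\<close> a multiple of \<open>m\<close>.\<close>

lemma om_normal_form:
  assumes J: "J \<in> multi_indices n j" and K: "K \<in> multi_indices n k"
  shows "\<omega> (gens J \<otimes> adj A (gens K)) =
    (\<Sum>L\<in>multi_indices n (k * (m - 1)). vec_power m z k (K @ L) * \<omega> (gens (J @ L)))"
proof -
  let ?t = "k * (m - 1)"
  have kt: "k + ?t = k * m" using m by (cases m) auto
  have "\<omega> (gens J \<otimes> adj A (gens K))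
      = (\<Sum>L\<in>multi_indices n ?t. \<omega> ((gens J \<otimes> gens L) \<otimes> (adj A (gens L) \<otimes> adj A (gens K))))"
    using J K by (intro resolution[symmetric]) simp_all
  also have "\<dots> = (\<Sum>L\<in>multi_indices n ?t. vec_power m z k (K @ L) * \<omega> (gens (J @ L)))"
  proof (intro sum.cong refl)
    fix L assume L: "L \<in> multi_indices n ?t"
    have KL: "K @ L \<in> multi_indices n (k * m)"
      using multi_indices_append[of K k L n ?t] K L
      unfolding kt by (simp add: multi_indices_length)
    have "(gens J \<otimes> gens L) \<otimes> (adj A (gens L) \<otimes> adj A (gens K)) = gens (J @ L) \<otimes> adj A (gens (K @ L))"
      using J K L by (simp add: gens_append[OF J L] gens_append[OF K L] adj_mult)
    moreover have "gens (J @ L) \<in> carrier A" using J L by (simp add: gens_append)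
    ultimately show "\<omega> ((gens J \<otimes> gens L) \<otimes> (adj A (gens L) \<otimes> adj A (gens K)))
        = vec_power m z k (K @ L) * \<omega> (gens (J @ L))"
      using om_mult_adj_gens_power[OF _ KL] by simp
  qed
  finally show ?thesis .
qed

end

section \<open>Uniqueness on words and on the Cuntz algebra\<close>

lemma sub_cuntz_functional_unique:
  assumes 1: "sub_cuntz_functional A n s \<omega> m z" and 2: "sub_cuntz_functional A n s \<omega>' m z"
    and np: "nonperiodic n z" and w: "w \<in> lists (letters n)"
  shows "\<omega> (word_eval A s w) = \<omega>' (word_eval A s w)"
proof -
  interpret o1: sub_cuntz_functional A n s \<omega> m z by fact
  interpret o2: sub_cuntz_functional A n s \<omega>' m z by fact
  show ?thesis
  proof (cases "word_eval A s w = \<zero>\<^bsub>A\<^esub>")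
    case False
    then obtain j k J K where J: "J \<in> multi_indices n j" and K: "K \<in> multi_indices n k"
      and eq: "word_eval A s w = o1.gens J \<otimes>\<^bsub>A\<^esub> adj A (o1.gens K)"
      using o1.word_normal_form[OF w] by blast
    have "\<omega> (o1.gens (J @ L)) = \<omega>' (o1.gens (J @ L))" if "L \<in> multi_indices n t" for L t
    proof -
      have "J @ L \<in> multi_indices n (j + t)"
        using multi_indices_append[of J j L n t] J that by (simp add: multi_indices_length)
      then show ?thesis by (simp add: o1.om_gens_eq[OF np] o2.om_gens_eq[OF np])
    qed
    then show ?thesis unfolding eq o1.om_normal_form[OF J K] o2.om_normal_form[OF J K]
      by (intro sum.cong refl) simp
  qed simp
qed

lemma sub_cuntz_state_functional:
  assumes "sub_cuntz_state n m z \<omega>" "1 \<le> m" "z \<in> unit_vecs n m"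
  shows "sub_cuntz_functional (cuntz n) n (cuntz_gen n) \<omega> m z"
proof -
  interpret cuntz_family "cuntz n" n "cuntz_gen n" by (rule cuntz_gen_family)
  have om: "\<omega> \<in> states (cuntz n)" using assms(1) by (simp add: sub_cuntz_state_def)
  have "positive_functional (cuntz n) \<omega>"
    using cuntz_norm.states_positive[of \<omega> n] om by (simp add: cuntz_def)
  then interpret positive_functional "cuntz n" \<omega> .
  show ?thesis
  proof (unfold_locales)
    show "\<omega> \<one>\<^bsub>cuntz n\<^esub> = 1" using om by (simp add: states_def)
    show "\<omega> (gens J) = cnj (z J)" if "J \<in> multi_indices n m" for J
      using assms(1) that by (simp add: sub_cuntz_state_def gens_def cuntz_gens_word_eval)
  qed (use assms in simp_all)
qed

lemma cuntz_states_eqI: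
  assumes "\<omega> \<in> states (cuntz n)" "\<omega>' \<in> states (cuntz n)"
    and eq: "\<And>w. w \<in> lists (letters n) \<Longrightarrow>
      \<omega> (word_eval (cuntz n) (cuntz_gen n) w) = \<omega>' (word_eval (cuntz n) (cuntz_gen n) w)"
  shows "\<omega> = \<omega>'"
proof (rule cuntz_norm.states_eqI[of _ n])
  show om: "\<omega> \<in> states (completion (free_alg n) (cuntz_norm n))"
    "\<omega>' \<in> states (completion (free_alg n) (cuntz_norm n))"
    using assms by (simp_all add: cuntz_def)
  interpret o1: positive_functional "cuntz n" \<omega>
    unfolding cuntz_def by (rule cuntz_norm.states_positive[OF om(1)])
  interpret o2: positive_functional "cuntz n" \<omega>'
    unfolding cuntz_def by (rule cuntz_norm.states_positive[OF om(2)])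
  fix x assume "x \<in> carrier (free_alg n)"
  then show "\<omega> (cuntz_emb n x) = \<omega>' (cuntz_emb n x)"
  proof (induction rule: free_alg_induct)
    case zero
    then show ?case by (simp add: cuntz_emb.hom_zero)
  next
    case (add g c w)
    then have w: "w \<in> lists (letters n)" by simp
    then have "\<omega> (cuntz_emb n (single w)) = \<omega>' (cuntz_emb n (single w))"
      using eq by (simp add: cuntz_emb_single)
    then show ?case using add w
      by (simp add: cuntz_emb.hom_add cuntz_emb.hom_smult o1.om_add o1.om_smult o2.om_add o2.om_smult)
  qed
qed

lemma sub_cuntz_state_unique:
  assumes "1 \<le> m" "z \<in> unit_vecs n m" "nonperiodic n z"
    and "sub_cuntz_state n m z \<omega>" "sub_cuntz_state n m z \<omega>'"
  shows "\<omega> = \<omega>'"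
proof (rule cuntz_states_eqI[of _ n])
  show "\<omega> \<in> states (cuntz n)" "\<omega>' \<in> states (cuntz n)" using assms by (simp_all add: sub_cuntz_state_def)
  show "\<omega> (word_eval (cuntz n) (cuntz_gen n) w) = \<omega>' (word_eval (cuntz n) (cuntz_gen n) w)"
    if "w \<in> lists (letters n)" for w
    using sub_cuntz_functional_unique[OF sub_cuntz_state_functional[OF assms(4,1,2)]
        sub_cuntz_state_functional[OF assms(5,1,2)] assms(3) that] .
qed

lemma omega_tilde_eqI:
  assumes "1 \<le> m" "z \<in> unit_vecs n m" "nonperiodic n z" "sub_cuntz_state n m z \<omega>"
  shows "omega_tilde n m z = \<omega>"
  unfolding omega_tilde_def using assms sub_cuntz_state_unique by (intro the_equality) blast+

lemma omega_tilde_sub_cuntz: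
  assumes "1 \<le> m" "z \<in> unit_vecs n m" "nonperiodic n z"
  shows "sub_cuntz_state n m z (omega_tilde n m z)"
proof -
  obtain \<omega> where "sub_cuntz_state n m z \<omega>"
    using subcuntz_data.sub_cuntz_state_exists[of n m z] assms by (auto simp: subcuntz_data_def)
  then show ?thesis using omega_tilde_eqI[OF assms] by simp
qed

section \<open>Product states\<close>

definition psd :: "'i set \<Rightarrow> ('i \<Rightarrow> 'i \<Rightarrow> complex) \<Rightarrow> bool" where
  "psd I G \<longleftrightarrow> (\<forall>i\<in>I. \<forall>j\<in>I. G j i = cnj (G i j)) \<and>
     (\<forall>x. 0 \<le> Re (\<Sum>i\<in>I. \<Sum>j\<in>I. cnj (x i) * x j * G i j))"

lemma psd_herm: "psd I G \<Longrightarrow> i \<in> I \<Longrightarrow> j \<in> I \<Longrightarrow> G j i = cnj (G i j)"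
  unfolding psd_def by blast

lemma psd_nonneg: "psd I G \<Longrightarrow> 0 \<le> Re (\<Sum>i\<in>I. \<Sum>j\<in>I. cnj (x i) * x j * G i j)"
  unfolding psd_def by blast

lemma sum_insert2:
  fixes F :: "'i \<Rightarrow> 'i \<Rightarrow> complex"
  assumes "finite I" "k \<notin> I"
  shows "(\<Sum>i\<in>insert k I. \<Sum>j\<in>insert k I. F i j)
    = F k k + (\<Sum>j\<in>I. F k j) + (\<Sum>i\<in>I. F i k) + (\<Sum>i\<in>I. \<Sum>j\<in>I. F i j)"
  using assms by (simp add: sum.distrib)

lemma psd_insert_subset:
  assumes "psd (insert k I) G" "finite I" "k \<notin> I"
  shows "psd I G"
  unfolding psd_def
proof (intro conjI allI ballI)
  show "G j i = cnj (G i j)" if "i \<in> I" "j \<in> I" for i j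
    by (rule psd_herm[OF assms(1)]) (use that in simp_all)
  fix x :: "'a \<Rightarrow> complex"
  define y where "y = x(k := 0)"
  have "(\<Sum>i\<in>I. \<Sum>j\<in>I. cnj (y i) * y j * G i j) = (\<Sum>i\<in>I. \<Sum>j\<in>I. cnj (x i) * x j * G i j)"
    by (intro sum.cong refl) (use assms(3) in \<open>auto simp: y_def\<close>)
  then have "(\<Sum>i\<in>insert k I. \<Sum>j\<in>insert k I. cnj (y i) * y j * G i j)
      = (\<Sum>i\<in>I. \<Sum>j\<in>I. cnj (x i) * x j * G i j)"
    unfolding sum_insert2[OF assms(2,3)] by (simp add: y_def)
  then show "0 \<le> Re (\<Sum>i\<in>I. \<Sum>j\<in>I. cnj (x i) * x j * G i j)"
    using psd_nonneg[OF assms(1), of y] by simp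
qed

lemma psd_diag:
  assumes "psd (insert k I) G" "finite I" "k \<notin> I"
  shows "G k k = of_real (Re (G k k))" "0 \<le> Re (G k k)"
proof -
  show "G k k = of_real (Re (G k k))" using psd_herm[OF assms(1), of k k] by (simp add: complex_eq_iff)
  define e where "e i = (if i = k then 1 else (0 :: complex))" for i
  have e: "e k = 1" "i \<in> I \<Longrightarrow> e i = 0" for i using assms(3) by (auto simp: e_def)
  have "(\<Sum>i\<in>insert k I. \<Sum>j\<in>insert k I. cnj (e i) * e j * G i j) = G k k"
    unfolding sum_insert2[OF assms(2,3)] by (simp add: e cong: sum.cong)
  then show "0 \<le> Re (G k k)" using psd_nonneg[OF assms(1), of e] by simp
qed

text \<open>On the vectors with entry \<open>- r * c\<close> at \<open>k\<close> and 1 at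
  \<open>j\<close> the form equals \<open>G j j - 2 * r * (cmod c)\<^sup>2\<close>. It has no
  quadratic term in \<open>r\<close> because \<open>G k k = 0\<close>, so it is bounded below only
  if \<open>c = 0\<close>.\<close>

lemma psd_zero_row:
  assumes G: "psd (insert k I) G" "finite I" "k \<notin> I" and z: "G k k = 0" and j: "j \<in> I"
  shows "G k j = 0"
proof (rule ccontr)
  assume nz: "G k j \<noteq> 0"
  define c where "c = G k j"
  have c: "G k j = c" "G j k = cnj c" using psd_herm[OF G(1), of k j] j by (simp_all add: c_def)
  have jk: "j \<noteq> k" using G(3) j by blast
  have I: "I = insert j (I - {j})" "finite (I - {j})" "j \<notin> I - {j}" using j G(2) by auto
  have key: "0 \<le> Re (G j j) - 2 * r * (cmod c)\<^sup>2" for r :: real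
  proof -
    define x where "x = (\<lambda>i. if i = k then - of_real r * c else if i = j then 1 else (0::complex))"
    have x0: "x i = 0" if "i \<in> I - {j}" for i using that G(3) by (auto simp: x_def)
    have x: "x k = - of_real r * c" "x j = 1" using jk by (simp_all add: x_def)
    have s1: "(\<Sum>i\<in>I. x i * f i) = f j" "(\<Sum>i\<in>I. cnj (x i) * f i) = f j" for f
      by (subst I(1), subst sum.insert[OF I(2,3)], simp add: x0 x)+
    have "(\<Sum>i\<in>I. \<Sum>l\<in>I. cnj (x i) * x l * G i l) = (\<Sum>i\<in>I. cnj (x i) * (\<Sum>l\<in>I. x l * G i l))"
      by (simp add: sum_distrib_left mult.assoc)
    also have "\<dots> = G j j" by (simp add: s1)
    finally have "(\<Sum>i\<in>insert k I. \<Sum>l\<in>insert k I. cnj (x i) * x l * G i l)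
        = cnj (x k) * (\<Sum>l\<in>I. x l * G k l) + x k * (\<Sum>i\<in>I. cnj (x i) * G i k) + G j j"
      unfolding sum_insert2[OF G(2,3)] by (simp add: z sum_distrib_left mult_ac)
    also have "\<dots> = - of_real (2 * r * (cmod c)\<^sup>2) + G j j"
      unfolding of_real_mult complex_norm_square by (simp add: s1 x c algebra_simps)
    finally show ?thesis using psd_nonneg[OF G(1), of x] by simp
  qed
  have c2: "(cmod c)\<^sup>2 > 0" using nz by (simp add: c_def)
  have "2 * ((Re (G j j) + 1) / (2 * (cmod c)\<^sup>2)) * (cmod c)\<^sup>2 = Re (G j j) + 1"
    using c2 by (simp add: field_simps)
  then show False using key[of "(Re (G j j) + 1) / (2 * (cmod c)\<^sup>2)"] by simp
qed

text \<open>Completing the square in the coordinate \<open>k\<close>: the entry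
  \<open>- t / G k k\<close> minimizes the form there, and the minimum is the form of the Schur
  complement at the remaining coordinates.\<close>

lemma psd_schur_complement:
  assumes G: "psd (insert k I) G" "finite I" "k \<notin> I" and pos: "G k k \<noteq> 0"
  shows "psd I (\<lambda>i j. G i j - cnj (G k i) * G k j / G k k)" (is "psd I ?G'")
  unfolding psd_def
proof (intro conjI allI ballI)
  define g where "g = Re (G k k)"
  have g: "G k k = of_real g" "g > 0" using psd_diag[OF G] pos by (auto simp: g_def order_less_le)
  show "?G' j i = cnj (?G' i j)" if "i \<in> I" "j \<in> I" for i j
    using psd_herm[OF G(1), of i j] that by (simp add: g)
  fix x :: "'a \<Rightarrow> complex"
  define t where "t = (\<Sum>j\<in>I. x j * G k j)"
  define y where "y = x(k := - t / of_real g)"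
  have y: "y k = - t / of_real g" "i \<in> I \<Longrightarrow> y i = x i" for i using G(3) by (auto simp: y_def)
  have t': "(\<Sum>i\<in>I. cnj (x i) * G i k) = cnj t"
    unfolding t_def cnj_sum by (intro sum.cong refl) (use psd_herm[OF G(1), of k] in simp)
  have "(\<Sum>i\<in>insert k I. \<Sum>j\<in>insert k I. cnj (y i) * y j * G i j)
     = cnj (y k) * y k * of_real g + cnj (y k) * t + y k * cnj t + (\<Sum>i\<in>I. \<Sum>j\<in>I. cnj (x i) * x j * G i j)"
  proof -
    have "(\<Sum>j\<in>I. cnj (y k) * y j * G k j) = cnj (y k) * t"
      unfolding t_def sum_distrib_left by (intro sum.cong refl) (simp add: y(2))
    moreover have "(\<Sum>i\<in>I. cnj (y i) * y k * G i k) = y k * cnj t"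
      unfolding t'[symmetric] sum_distrib_left by (intro sum.cong refl) (simp add: y(2))
    moreover have "(\<Sum>i\<in>I. \<Sum>j\<in>I. cnj (y i) * y j * G i j) = (\<Sum>i\<in>I. \<Sum>j\<in>I. cnj (x i) * x j * G i j)"
      by (intro sum.cong refl) (simp add: y(2))
    ultimately show ?thesis unfolding sum_insert2[OF G(2,3)] by (simp add: g)
  qed
  also have "\<dots> = (\<Sum>i\<in>I. \<Sum>j\<in>I. cnj (x i) * x j * G i j) - cnj t * t / of_real g"
    using g(2) by (simp add: y(1) field_simps)
  also have "cnj t * t / of_real g = (\<Sum>i\<in>I. \<Sum>j\<in>I. cnj (x i) * x j * (cnj (G k i) * G k j / G k k))"
    unfolding t_def cnj_sum sum_product sum_divide_distrib
    by (intro sum.cong refl) (simp add: g mult_ac)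
  also have "(\<Sum>i\<in>I. \<Sum>j\<in>I. cnj (x i) * x j * G i j) - \<dots> = (\<Sum>i\<in>I. \<Sum>j\<in>I. cnj (x i) * x j * ?G' i j)"
    by (simp add: sum_subtractf algebra_simps)
  finally show "0 \<le> Re (\<Sum>i\<in>I. \<Sum>j\<in>I. cnj (x i) * x j * ?G' i j)"
    using psd_nonneg[OF G(1), of y] by simp
qed

text \<open>Each index is removed by splitting off from \<open>G\<close> the rank one kernel of its row.\<close>

lemma schur_product:
  assumes "finite I" "psd I G" "psd I H"
  shows "0 \<le> Re (\<Sum>i\<in>I. \<Sum>j\<in>I. cnj (x i) * x j * (G i j * H i j))"
  using assms
proof (induction I arbitrary: G)
  case empty
  then show ?case by simp
next
  case (insert k I)
  note G = insert.prems(1) insert.hyps(1,2)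
  \<comment> \<open>If \<open>G k k = 0\<close> then \<open>G' = G\<close>, since \<open>x / 0 = 0\<close>.\<close>
  define G' where "G' i j = G i j - cnj (G k i) * G k j / G k k" for i j
  have G': "psd I G'" using psd_schur_complement[OF G] psd_insert_subset[OF G]
    by (cases "G k k = 0") (simp_all add: G'_def[abs_def])
  have row: "G' k j = 0 \<and> G' j k = 0" if "j \<in> insert k I" for j
  proof (cases "G k k = 0")
    case True
    then have "G k j = 0" using psd_zero_row[OF G True] that by auto
    then show ?thesis using psd_herm[OF G(1), of k j] that by (simp add: G'_def)
  next
    case False
    then show ?thesis using psd_herm[OF G(1), of k j] psd_diag(1)[OF G] that
      by (simp add: G'_def) (metis complex_cnj_complex_of_real nonzero_mult_div_cancel_left nonzero_mult_div_cancel_right diff_self)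
  qed
  \<comment> \<open>The rank one part of \<open>G\<close> turns into a value of the form of
    \<open>H\<close>, at the vector with entries \<open>x i * G k i\<close>, divided by
    \<open>G k k\<close>. In the other part the row and column of \<open>k\<close> vanish, so the
    induction hypothesis applies.\<close>
  have "(\<Sum>i\<in>insert k I. \<Sum>j\<in>insert k I. cnj (x i) * x j * (G i j * H i j))
     = (\<Sum>i\<in>insert k I. \<Sum>j\<in>insert k I. cnj (x i) * x j * (G' i j * H i j))
     + (\<Sum>i\<in>insert k I. \<Sum>j\<in>insert k I. cnj (x i * G k i) * (x j * G k j) * H i j) / G k k"
    unfolding sum_divide_distrib sum.distrib[symmetric]
    by (intro sum.cong refl) (simp add: G'_def algebra_simps)
  also have "(\<Sum>i\<in>insert k I. \<Sum>j\<in>insert k I. cnj (x i) * x j * (G' i j * H i j))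
     = (\<Sum>i\<in>I. \<Sum>j\<in>I. cnj (x i) * x j * (G' i j * H i j))"
    unfolding sum_insert2[OF G(2,3)] using row by simp
  finally have eq: "(\<Sum>i\<in>insert k I. \<Sum>j\<in>insert k I. cnj (x i) * x j * (G i j * H i j))
     = (\<Sum>i\<in>I. \<Sum>j\<in>I. cnj (x i) * x j * (G' i j * H i j))
     + (\<Sum>i\<in>insert k I. \<Sum>j\<in>insert k I. cnj (x i * G k i) * (x j * G k j) * H i j) / of_real (Re (G k k))"
    using psd_diag(1)[OF G] by simp
  have "0 \<le> Re (\<Sum>i\<in>I. \<Sum>j\<in>I. cnj (x i) * x j * (G' i j * H i j))"
    using insert.IH[OF G' psd_insert_subset[OF insert.prems(2) G(2,3)]] .
  moreover have "0 \<le> Re (\<Sum>i\<in>insert k I. \<Sum>j\<in>insert k I. cnj (x i * G k i) * (x j * G k j) * H i j)"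
    by (rule psd_nonneg[OF insert.prems(2)])
  ultimately show ?case unfolding eq plus_complex.sel Re_divide_of_real
    using psd_diag(2)[OF G] by (intro add_nonneg_nonneg divide_nonneg_nonneg)
qed

text \<open>In a C*-algebra this follows from the positivity of
  \<open>(p a)\<^sup>2 \<odot> \<one> \<ominus> adj A a \<otimes> a\<close>, whose square root need
  not exist here. Repeated squaring replaces it: a violation is raised to the power
  \<open>2 ^ k\<close> in the \<open>k\<close>-th step, whereas the crude estimate by
  \<open>p\<close> costs only the constant factor \<open>M / K\<close>, the same for all
  \<open>k\<close>.\<close>

lemma (in cstar_seminormed) bounded_functional_le:
  assumes "positive_functional A \<omega>" and bd: "\<And>a. a \<in> carrier A \<Longrightarrow> cmod (\<omega> a) \<le> p a"
    and a: "a \<in> carrier A" and c: "c \<in> carrier A"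
  shows "Re (\<omega> (adj A (a \<otimes> c) \<otimes> (a \<otimes> c))) \<le> (p a)\<^sup>2 * Re (\<omega> (adj A c \<otimes> c))"
proof -
  interpret positive_functional A \<omega> by fact
  \<comment> \<open>\<open>b k = (a\<^sup>* a)\<^bsup>2^k\<^esup>\<close>; Cauchy--Schwarz bounds \<open>\<omega> (c\<^sup>* b c)\<^sup>2\<close> by \<open>\<omega> (c\<^sup>* c) \<omega> (c\<^sup>* b\<^sup>2 c)\<close>.\<close>
  define b where "b k = ((\<lambda>x. x \<otimes> x) ^^ k) (adj A a \<otimes> a)" for k
  have b0: "b 0 = adj A a \<otimes> a" and bS: "b (Suc k) = b k \<otimes> b k" for k by (simp_all add: b_def)
  have b: "b k \<in> carrier A \<and> adj A (b k) = b k" for k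
    by (induction k) (simp_all add: b0 bS a adj_mult)
  have pb: "p (b k) \<le> ((p a)\<^sup>2) ^ (2 ^ k)" for k
  proof (induction k)
    case 0
    then show ?case using p_cstar[OF a] by (simp add: b0)
  next
    case (Suc k)
    have "p (b (Suc k)) \<le> p (b k) * p (b k)" unfolding bS using b by (intro p_mult) simp_all
    also have "\<dots> \<le> ((p a)\<^sup>2) ^ (2 ^ k) * ((p a)\<^sup>2) ^ (2 ^ k)"
      using Suc b by (intro mult_mono) simp_all
    also have "\<dots> = ((p a)\<^sup>2) ^ (2 ^ Suc k)" by (simp add: power_add[symmetric] mult_2)
    finally show ?case .
  qed
  define t where "t k = Re (\<omega> (adj A c \<otimes> (b k \<otimes> c)))" for k
  define K where "K = Re (\<omega> (adj A c \<otimes> c))"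
  define M where "M = (p c)\<^sup>2"
  have K: "K \<ge> 0" using om_pos'(1)[OF c] by (simp add: K_def)
  have t0: "t 0 = Re (\<omega> (adj A (a \<otimes> c) \<otimes> (a \<otimes> c)))" using a c by (simp add: t_def b0 adj_mult m_assoc)
  have t0_nn: "t 0 \<ge> 0" unfolding t0 using a c by (intro om_pos') simp
  have step: "(t k)\<^sup>2 \<le> K * t (Suc k)" for k
  proof -
    have "(t k)\<^sup>2 \<le> (cmod (\<omega> (adj A c \<otimes> (b k \<otimes> c))))\<^sup>2"
      unfolding t_def by (rule abs_le_square_iff[THEN iffD1]) (simp add: abs_Re_le_cmod)
    also have "\<dots> \<le> K * Re (\<omega> (adj A (b k \<otimes> c) \<otimes> (b k \<otimes> c)))"
      unfolding K_def using b c by (intro cauchy_schwarz) simp_all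
    also have "Re (\<omega> (adj A (b k \<otimes> c) \<otimes> (b k \<otimes> c))) = t (Suc k)"
      using b c by (simp add: t_def bS adj_mult m_assoc)
    finally show ?thesis .
  qed
  have upper: "t k \<le> M * ((p a)\<^sup>2) ^ (2 ^ k)" for k
  proof -
    have "t k \<le> cmod (\<omega> (adj A c \<otimes> (b k \<otimes> c)))" unfolding t_def by (rule complex_Re_le_cmod)
    also have "\<dots> \<le> p (adj A c \<otimes> (b k \<otimes> c))" using b c by (intro bd) simp
    also have "\<dots> \<le> p (adj A c) * p (b k \<otimes> c)" using b c by (intro p_mult) simp_all
    also have "\<dots> \<le> p (adj A c) * (p (b k) * p c)" using b c by (intro mult_left_mono p_mult) simp_all
    also have "\<dots> = M * p (b k)" using c by (simp add: M_def power2_eq_square mult_ac)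
    also have "\<dots> \<le> M * ((p a)\<^sup>2) ^ (2 ^ k)" using pb by (intro mult_left_mono) (simp_all add: M_def)
    finally show ?thesis .
  qed
  have "t 0 \<le> (p a)\<^sup>2 * K"
  proof (rule ccontr)
    assume "\<not> t 0 \<le> (p a)\<^sup>2 * K"
    then have gt: "t 0 > (p a)\<^sup>2 * K" by simp
    then have tpos: "t 0 > 0" using K by (meson mult_nonneg_nonneg order_le_less_trans zero_le_power2)
    have Kpos: "K > 0" using step[of 0] tpos K by (cases "K = 0") auto
    define \<tau> where "\<tau> = t 0 / K"
    have tau: "\<tau> > (p a)\<^sup>2" "\<tau> > 0" using gt tpos Kpos by (simp_all add: \<tau>_def field_simps)
    have pw: "\<tau> ^ (2 ^ k) \<le> t k / K" for k
    proof (induction k)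
      case 0
      then show ?case by (simp add: \<tau>_def)
    next
      case (Suc k)
      have "\<tau> ^ (2 ^ Suc k) = (\<tau> ^ (2 ^ k))\<^sup>2" by (simp add: power_mult[symmetric] mult.commute)
      also have "\<dots> \<le> (t k / K)\<^sup>2" using Suc tau by (intro power_mono) simp_all
      also have "\<dots> \<le> (K * t (Suc k)) / K\<^sup>2" using step[of k] Kpos by (simp add: power_divide divide_right_mono)
      also have "\<dots> = t (Suc k) / K" using Kpos by (simp add: power2_eq_square)
      finally show ?case .
    qed
    have bound: "\<tau> ^ (2 ^ k) \<le> (M / K) * ((p a)\<^sup>2) ^ (2 ^ k)" for k
      using order.trans[OF pw[of k] divide_right_mono[OF upper[of k], of K]] Kpos by simp
    show False
    proof (cases "p a = 0")
      case True
      then show ?thesis using bound[of 0] tau by simp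
    next
      case False
      then have pa: "(p a)\<^sup>2 > 0" by simp
      \<comment> \<open>\<open>\<rho>\<close> is the factor by which the claim would fail; all its
        powers with exponent \<open>2 ^ k\<close> would stay below \<open>M / K\<close>.\<close>
      define \<rho> where "\<rho> = \<tau> / (p a)\<^sup>2"
      have rho: "\<rho> > 1" using tau pa by (simp add: \<rho>_def)
      have le: "\<rho> ^ (2 ^ k) \<le> M / K" for k
        using bound[of k] pa by (simp add: \<rho>_def power_divide divide_le_eq)
      obtain N where N: "M / K < \<rho> ^ N" using real_arch_pow[OF rho] by blast
      have "\<rho> ^ N \<le> \<rho> ^ (2 ^ N)" using rho by (intro power_increasing) (simp_all add: less_imp_le)
      then show False using N le[of N] by simp
    qed
  qed
  then show ?thesis by (simp add: t0 K_def)
qed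

text \<open>The quadratic form of a Gram kernel is the squared length of a single vector. The left
  multiplier \<open>e\<close> is carried along so that the same expansion serves the kernel before
  and after \<open>e\<close> has acted.\<close>

lemma (in positive_functional) gram_vector:
  assumes "finite I" "\<And>i. i \<in> I \<Longrightarrow> a i \<in> carrier A"
  defines "c \<equiv> \<lambda>x. finsum A (\<lambda>i. x i \<odot> a i) I"
  shows "c x \<in> carrier A" "e \<in> carrier A \<Longrightarrow> \<omega> (adj A (e \<otimes> c x) \<otimes> (e \<otimes> c x)) =
    (\<Sum>i\<in>I. \<Sum>j\<in>I. cnj (x i) * x j * \<omega> (adj A (e \<otimes> a i) \<otimes> (e \<otimes> a j)))"
proof -
  define c' where "c' = c x"
  have c: "c' \<in> carrier A" unfolding c'_def c_def by (rule finsum_closed) (use assms in auto)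
  have lin: "\<omega> (adj A y \<otimes> (e \<otimes> c')) = (\<Sum>j\<in>I. x j * \<omega> (adj A y \<otimes> (e \<otimes> a j)))"
    if y: "y \<in> carrier A" and e: "e \<in> carrier A" for y e
    unfolding c'_def c_def using assms(1,2)
  proof (induction I)
    case (insert i I)
    then have "(\<lambda>i. x i \<odot> a i) \<in> I \<rightarrow> carrier A" by auto
    then show ?case using insert y e
      by (simp add: finsum_insert finsum_closed r_distr om_add smult_mult_r om_smult)
  qed (use y e in simp)
  show "c x \<in> carrier A" using c by (simp add: c'_def)
  show "\<omega> (adj A (e \<otimes> c x) \<otimes> (e \<otimes> c x)) = (\<Sum>i\<in>I. \<Sum>j\<in>I. cnj (x i) * x j * \<omega> (adj A (e \<otimes> a i) \<otimes> (e \<otimes> a j)))"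
    if e: "e \<in> carrier A" for e
  proof -
    have "\<omega> (adj A (e \<otimes> c') \<otimes> (e \<otimes> a j)) = (\<Sum>i\<in>I. cnj (x i) * \<omega> (adj A (e \<otimes> a i) \<otimes> (e \<otimes> a j)))"
      if j: "j \<in> I" for j
    proof -
      have "\<omega> (adj A (e \<otimes> c') \<otimes> (e \<otimes> a j)) = cnj (\<omega> (adj A (e \<otimes> a j) \<otimes> (e \<otimes> c')))"
        using c e j assms by (intro om_herm) simp_all
      also have "\<dots> = (\<Sum>i\<in>I. cnj (x i) * cnj (\<omega> (adj A (e \<otimes> a j) \<otimes> (e \<otimes> a i))))"
        using e j assms by (subst lin) simp_all
      also have "\<dots> = (\<Sum>i\<in>I. cnj (x i) * \<omega> (adj A (e \<otimes> a i) \<otimes> (e \<otimes> a j)))"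
        using e j assms by (intro sum.cong refl arg_cong2[where f = "(*)"] om_herm[symmetric]) simp_all
      finally show ?thesis .
    qed
    then have "\<omega> (adj A (e \<otimes> c') \<otimes> (e \<otimes> c')) = (\<Sum>j\<in>I. \<Sum>i\<in>I. cnj (x i) * x j * \<omega> (adj A (e \<otimes> a i) \<otimes> (e \<otimes> a j)))"
      using c e by (subst lin) (simp_all add: sum_distrib_left mult_ac)
    also have "\<dots> = (\<Sum>i\<in>I. \<Sum>j\<in>I. cnj (x i) * x j * \<omega> (adj A (e \<otimes> a i) \<otimes> (e \<otimes> a j)))"
      by (rule sum.swap)
    finally show ?thesis by (simp add: c'_def)
  qed
qed

lemma (in positive_functional) psd_gram:
  assumes "finite I" "\<And>i. i \<in> I \<Longrightarrow> a i \<in> carrier A"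
  shows "psd I (\<lambda>i j. \<omega> (adj A (a i) \<otimes> a j))"
  unfolding psd_def
proof (intro conjI allI ballI)
  show "\<omega> (adj A (a j) \<otimes> a i) = cnj (\<omega> (adj A (a i) \<otimes> a j))" if "i \<in> I" "j \<in> I" for i j
    using assms that by (intro om_herm) simp_all
  fix x
  define c where "c = finsum A (\<lambda>i. x i \<odot> a i) I"
  have cc: "c \<in> carrier A" unfolding c_def by (rule gram_vector(1)) (use assms in simp_all)
  have ce: "\<omega> (adj A (e \<otimes> c) \<otimes> (e \<otimes> c)) =
      (\<Sum>i\<in>I. \<Sum>j\<in>I. cnj (x i) * x j * \<omega> (adj A (e \<otimes> a i) \<otimes> (e \<otimes> a j)))" if "e \<in> carrier A" for e
    unfolding c_def by (rule gram_vector(2)) (use assms that in simp_all)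
  have "(\<Sum>i\<in>I. \<Sum>j\<in>I. cnj (x i) * x j * \<omega> (adj A (a i) \<otimes> a j)) = \<omega> (adj A c \<otimes> c)"
    using ce[OF one_closed] cc assms by simp
  then show "0 \<le> Re (\<Sum>i\<in>I. \<Sum>j\<in>I. cnj (x i) * x j * \<omega> (adj A (a i) \<otimes> a j))"
    using om_pos'(1)[OF cc] by simp
qed

text \<open>The inequality \<open>bounded_functional_le\<close> for all linear combinations of the
  \<open>a i\<close> at once. As a statement on kernels it can be multiplied entrywise by a kernel
  of the other tensor factor.\<close>

lemma (in cstar_seminormed) psd_bounded:
  assumes "positive_functional A \<omega>" and bd: "\<And>a. a \<in> carrier A \<Longrightarrow> cmod (\<omega> a) \<le> p a"
    and I: "finite I" "\<And>i. i \<in> I \<Longrightarrow> a i \<in> carrier A" and e: "e \<in> carrier A"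
  shows "psd I (\<lambda>i j. of_real ((p e)\<^sup>2) * \<omega> (adj A (a i) \<otimes> a j) - \<omega> (adj A (e \<otimes> a i) \<otimes> (e \<otimes> a j)))"
  unfolding psd_def
proof (intro conjI allI ballI)
  interpret positive_functional A \<omega> by fact
  show "of_real ((p e)\<^sup>2) * \<omega> (adj A (a j) \<otimes> a i) - \<omega> (adj A (e \<otimes> a j) \<otimes> (e \<otimes> a i)) =
    cnj (of_real ((p e)\<^sup>2) * \<omega> (adj A (a i) \<otimes> a j) - \<omega> (adj A (e \<otimes> a i) \<otimes> (e \<otimes> a j)))"
    if "i \<in> I" "j \<in> I" for i j
    using I that e om_herm[of "a i" "a j"] om_herm[of "e \<otimes> a i" "e \<otimes> a j"] by simp
  fix x
  define c where "c = finsum A (\<lambda>i. x i \<odot> a i) I"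
  have cc: "c \<in> carrier A" unfolding c_def by (rule gram_vector(1)) (use I in simp_all)
  have ce: "\<omega> (adj A (e \<otimes> c) \<otimes> (e \<otimes> c)) =
      (\<Sum>i\<in>I. \<Sum>j\<in>I. cnj (x i) * x j * \<omega> (adj A (e \<otimes> a i) \<otimes> (e \<otimes> a j)))" if "e \<in> carrier A" for e
    unfolding c_def by (rule gram_vector(2)) (use I that in simp_all)
  have c1: "\<omega> (adj A c \<otimes> c) = (\<Sum>i\<in>I. \<Sum>j\<in>I. cnj (x i) * x j * \<omega> (adj A (a i) \<otimes> a j))"
    using ce[OF one_closed] cc I by simp
  have "(\<Sum>i\<in>I. \<Sum>j\<in>I. cnj (x i) * x j *
      (of_real ((p e)\<^sup>2) * \<omega> (adj A (a i) \<otimes> a j) - \<omega> (adj A (e \<otimes> a i) \<otimes> (e \<otimes> a j))))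
    = of_real ((p e)\<^sup>2) * \<omega> (adj A c \<otimes> c) - \<omega> (adj A (e \<otimes> c) \<otimes> (e \<otimes> c))"
    unfolding c1 ce[OF e] sum_distrib_left sum_subtractf[symmetric]
    by (intro sum.cong refl) (simp add: algebra_simps)
  then show "0 \<le> Re (\<Sum>i\<in>I. \<Sum>j\<in>I. cnj (x i) * x j *
      (of_real ((p e)\<^sup>2) * \<omega> (adj A (a i) \<otimes> a j) - \<omega> (adj A (e \<otimes> a i) \<otimes> (e \<otimes> a j))))"
    using bounded_functional_le[OF assms(1) bd e cc] by simp
qed

section \<open>Product functionals and the spatial seminorm\<close>

definition tensor_monoid :: "('a, 'm) star_algebra_scheme \<Rightarrow> ('b, 'n) star_algebra_scheme \<Rightarrow> ('a \<times> 'b) star_monoid" where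
  "tensor_monoid A B =
    \<lparr>carrier = carrier A \<times> carrier B,
     mult = (\<lambda>(a, b) (a', b'). (a \<otimes>\<^bsub>A\<^esub> a', b \<otimes>\<^bsub>B\<^esub> b')),
     one = (\<one>\<^bsub>A\<^esub>, \<one>\<^bsub>B\<^esub>),
     madj = (\<lambda>(a, b). (adj A a, adj B b))\<rparr>"

lemma tensor_alg_eq: "tensor_alg A B = monoid_algebra (tensor_monoid A B)"
  by (simp add: tensor_alg_def tensor_monoid_def)

lemma tensor_monoid_simps [simp]:
  "carrier (tensor_monoid A B) = carrier A \<times> carrier B"
  "u \<otimes>\<^bsub>tensor_monoid A B\<^esub> v = (fst u \<otimes>\<^bsub>A\<^esub> fst v, snd u \<otimes>\<^bsub>B\<^esub> snd v)"
  "\<one>\<^bsub>tensor_monoid A B\<^esub> = (\<one>\<^bsub>A\<^esub>, \<one>\<^bsub>B\<^esub>)"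
  "madj (tensor_monoid A B) u = (adj A (fst u), adj B (snd u))"
  by (simp_all add: tensor_monoid_def case_prod_beta)

definition prod_fun :: "('a \<Rightarrow> complex) \<Rightarrow> ('b \<Rightarrow> complex) \<Rightarrow> 'a \<times> 'b \<Rightarrow> complex" where
  "prod_fun \<omega>1 \<omega>2 u = \<omega>1 (fst u) * \<omega>2 (snd u)"

lemma prod_functional_eq: "prod_functional \<omega>1 \<omega>2 = lin (prod_fun \<omega>1 \<omega>2)"
  unfolding prod_functional_def lin_def prod_fun_def by (intro ext sum.cong) auto

text \<open>The existence of states keeps the supremum in \<open>spatial_norm\<close> from being
  over the empty set.\<close>

locale tensor_pair = A: cstar_seminormed A "nrm A" + B: cstar_seminormed B "nrm B"
  for A :: "('a, 'm) normed_star_algebra_scheme" (structure)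
    and B :: "('b, 'k) normed_star_algebra_scheme" (structure) +
  assumes states_ne: "states A \<noteq> {}" "states B \<noteq> {}"
begin

abbreviation "T \<equiv> tensor_alg A B"

sublocale M: involutive_monoid "tensor_monoid A B"
proof (intro involutive_monoid.intro involutive_monoid_axioms.intro)
  show "monoid (tensor_monoid A B)" by (rule monoidI) (auto simp: A.m_assoc B.m_assoc)
qed (auto simp: A.adj_mult B.adj_mult)

sublocale T: star_alg T unfolding tensor_alg_eq by (rule M.star_alg_MA)

lemmas T_lin = M.lin_MA[folded tensor_alg_eq]
lemmas T_lin_cong = M.MA_lin_cong[folded tensor_alg_eq]
lemmas T_induct [consumes 1, case_names zero add] = M.MA_induct[folded tensor_alg_eq]
lemmas T_single_closed [simp] = M.single_closed[folded tensor_alg_eq]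

lemma T_supp: "f \<in> carrier T \<Longrightarrow> f w \<noteq> 0 \<Longrightarrow> fst w \<in> carrier A \<and> snd w \<in> carrier B"
  using M.MA_supp[of f w] by (auto simp: tensor_alg_eq)

lemma T_finite: "f \<in> carrier T \<Longrightarrow> finite {w. f w \<noteq> 0}"
  by (simp add: tensor_alg_eq)

lemma states_pos: "\<omega> \<in> states A \<Longrightarrow> positive_functional A \<omega>" "\<omega>' \<in> states B \<Longrightarrow> positive_functional B \<omega>'"
  by (intro positive_functional.intro A.star_alg_axioms B.star_alg_axioms positive_functional_axioms.intro;
      simp add: states_def)+

lemma states_le: "\<omega> \<in> states A \<Longrightarrow> a \<in> carrier A \<Longrightarrow> cmod (\<omega> a) \<le> nrm A a"
  "\<omega>' \<in> states B \<Longrightarrow> b \<in> carrier B \<Longrightarrow> cmod (\<omega>' b) \<le> nrm B b"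
  by (simp_all add: states_def)

lemma lin_square:
  assumes f: "f \<in> carrier T" and ab: "a \<in> carrier A" "b \<in> carrier B"
  shows "lin (prod_fun \<omega>1 \<omega>2) (adj T (single (a, b) \<otimes>\<^bsub>T\<^esub> f) \<otimes>\<^bsub>T\<^esub> (single (a, b) \<otimes>\<^bsub>T\<^esub> f))
    = (\<Sum>u | f u \<noteq> 0. \<Sum>v | f v \<noteq> 0. cnj (f u) * f v *
        (\<omega>1 (adj A (a \<otimes>\<^bsub>A\<^esub> fst u) \<otimes>\<^bsub>A\<^esub> (a \<otimes>\<^bsub>A\<^esub> fst v)) * \<omega>2 (adj B (b \<otimes>\<^bsub>B\<^esub> snd u) \<otimes>\<^bsub>B\<^esub> (b \<otimes>\<^bsub>B\<^esub> snd v))))"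
  using f ab by (simp add: T_lin) (simp add: lin_def prod_fun_def sum_distrib_left mult.assoc)

text \<open>On a square, the product functional is the quadratic form of the entrywise product of
  two Gram kernels, one for each factor, evaluated at the coefficients of \<open>f\<close>. Schur's
  theorem gives the sign of the real part, and hermitian symmetry makes the value real.\<close>

lemma prod_positive:
  assumes om: "\<omega>1 \<in> states A" "\<omega>2 \<in> states B"
  shows "positive_functional T (lin (prod_fun \<omega>1 \<omega>2))"
proof (intro positive_functional.intro T.star_alg_axioms positive_functional_axioms.intro)
  interpret o1: positive_functional A \<omega>1 using states_pos om by blast
  interpret o2: positive_functional B \<omega>2 using states_pos om by blast
  fix f assume f: "f \<in> carrier T"
  let ?S = "{u. f u \<noteq> 0}"
  let ?G = "\<lambda>u v. \<omega>1 (adj A (fst u) \<otimes>\<^bsub>A\<^esub> fst v)" and ?H = "\<lambda>u v. \<omega>2 (adj B (snd u) \<otimes>\<^bsub>B\<^esub> snd v)"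
  have S: "finite ?S" using T_finite[OF f] .
  have ac: "\<And>u. u \<in> ?S \<Longrightarrow> fst u \<in> carrier A" "\<And>u. u \<in> ?S \<Longrightarrow> snd u \<in> carrier B"
    using T_supp[OF f] by auto
  have psd: "psd ?S ?G" "psd ?S ?H"
    by (rule o1.psd_gram[OF S ac(1)], assumption) (rule o2.psd_gram[OF S ac(2)])
  have eq: "lin (prod_fun \<omega>1 \<omega>2) (adj T f \<otimes>\<^bsub>T\<^esub> f) = (\<Sum>u\<in>?S. \<Sum>v\<in>?S. cnj (f u) * f v * (?G u v * ?H u v))"
    using f by (simp add: T_lin) (simp add: lin_def prod_fun_def sum_distrib_left mult.assoc)
  have real: "cnj w = w \<Longrightarrow> Im w = 0" for w by (simp add: complex_eq_iff)
  have "cnj (cnj (f u) * f v * (?G u v * ?H u v)) = cnj (f v) * f u * (?G v u * ?H v u)"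
    if "u \<in> ?S" "v \<in> ?S" for u v
    unfolding psd_herm[OF psd(1) that] psd_herm[OF psd(2) that] by simp
  then have "cnj (\<Sum>u\<in>?S. \<Sum>v\<in>?S. cnj (f u) * f v * (?G u v * ?H u v))
      = (\<Sum>u\<in>?S. \<Sum>v\<in>?S. cnj (f v) * f u * (?G v u * ?H v u))"
    unfolding cnj_sum by (intro sum.cong refl)
  also have "\<dots> = (\<Sum>u\<in>?S. \<Sum>v\<in>?S. cnj (f u) * f v * (?G u v * ?H u v))" by (rule sum.swap)
  finally have "Im (\<Sum>u\<in>?S. \<Sum>v\<in>?S. cnj (f u) * f v * (?G u v * ?H u v)) = 0"
    by (rule real)
  then show "lin (prod_fun \<omega>1 \<omega>2) (adj T f \<otimes>\<^bsub>T\<^esub> f) \<in> \<real>\<^sub>\<ge>\<^sub>0"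
    unfolding eq complex_nonneg_Reals_iff using schur_product[OF S psd] by simp
qed (simp_all add: T_lin)

abbreviation F :: "(('a \<times> 'b \<Rightarrow> complex) \<Rightarrow> complex) set" where
  "F \<equiv> {lin (prod_fun \<omega>1 \<omega>2) | \<omega>1 \<omega>2. \<omega>1 \<in> states A \<and> \<omega>2 \<in> states B}"

sublocale ff: functional_family T F
  by (intro functional_family.intro T.star_alg_axioms functional_family_axioms.intro)
    (use prod_positive in blast)

text \<open>One factor is replaced at a time: first \<open>Ga\<close> by a multiple of
  \<open>G\<close> against the positive kernel \<open>Hb\<close>, then \<open>Hb\<close> by a
  multiple of \<open>H\<close> against the positive kernel \<open>G\<close>. The constant depends on
  the norms of \<open>a\<close> and \<open>b\<close> only, not on the two states.\<close>

lemma gns_bounded_single: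
  assumes ab: "a \<in> carrier A" "b \<in> carrier B"
  shows "gns_bounded T F (single (a, b))"
  unfolding gns_bounded_def
proof (intro exI[of _ "nrm A a * nrm B b"] conjI ballI)
  show "0 \<le> nrm A a * nrm B b" using ab by simp
  fix \<omega> f assume "\<omega> \<in> F" and f: "f \<in> carrier T"
  then obtain \<omega>1 \<omega>2 where om: "\<omega>1 \<in> states A" "\<omega>2 \<in> states B" and \<omega>: "\<omega> = lin (prod_fun \<omega>1 \<omega>2)" by blast
  interpret o1: positive_functional A \<omega>1 using states_pos om by blast
  interpret o2: positive_functional B \<omega>2 using states_pos om by blast
  let ?S = "{u. f u \<noteq> 0}"
  define G H Ga Hb :: "'a \<times> 'b \<Rightarrow> 'a \<times> 'b \<Rightarrow> complex" where "G = (\<lambda>u v. \<omega>1 (adj A (fst u) \<otimes>\<^bsub>A\<^esub> fst v))" and "H = (\<lambda>u v. \<omega>2 (adj B (snd u) \<otimes>\<^bsub>B\<^esub> snd v))"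
    and "Ga = (\<lambda>u v. \<omega>1 (adj A (a \<otimes>\<^bsub>A\<^esub> fst u) \<otimes>\<^bsub>A\<^esub> (a \<otimes>\<^bsub>A\<^esub> fst v)))"
    and "Hb = (\<lambda>u v. \<omega>2 (adj B (b \<otimes>\<^bsub>B\<^esub> snd u) \<otimes>\<^bsub>B\<^esub> (b \<otimes>\<^bsub>B\<^esub> snd v)))"
  have S: "finite ?S" using T_finite[OF f] .
  have ac: "\<And>u. u \<in> ?S \<Longrightarrow> fst u \<in> carrier A" "\<And>u. u \<in> ?S \<Longrightarrow> snd u \<in> carrier B"
    using T_supp[OF f] by auto
  have psdG: "psd ?S G" unfolding G_def by (rule o1.psd_gram[OF S ac(1)])
  have psdHb: "psd ?S Hb" unfolding Hb_def
    by (rule o2.psd_gram[OF S]) (rule B.m_closed[OF ab(2) ac(2)])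
  have psd1: "psd ?S (\<lambda>u v. of_real ((nrm A a)\<^sup>2) * G u v - Ga u v)"
    unfolding G_def Ga_def by (rule A.psd_bounded[OF states_pos(1)[OF om(1)] states_le(1)[OF om(1)] S ac(1) ab(1)])
  have psd2: "psd ?S (\<lambda>u v. of_real ((nrm B b)\<^sup>2) * H u v - Hb u v)"
    unfolding H_def Hb_def by (rule B.psd_bounded[OF states_pos(2)[OF om(2)] states_le(2)[OF om(2)] S ac(2) ab(2)])
  define R where "R G H = (\<Sum>u\<in>?S. \<Sum>v\<in>?S. cnj (f u) * f v * (G u v * H u v))" for G H :: "'a \<times> 'b \<Rightarrow> 'a \<times> 'b \<Rightarrow> complex"
  have "R (\<lambda>u v. of_real ((nrm A a)\<^sup>2) * G u v - Ga u v) Hb = of_real ((nrm A a)\<^sup>2) * R G Hb - R Ga Hb"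
    unfolding R_def sum_distrib_left sum_subtractf[symmetric]
    by (intro sum.cong refl) (simp add: algebra_simps)
  then have 1: "Re (R Ga Hb) \<le> (nrm A a)\<^sup>2 * Re (R G Hb)"
    using schur_product[OF S psd1 psdHb, of f] by (simp add: R_def[symmetric])
  have "R G (\<lambda>u v. of_real ((nrm B b)\<^sup>2) * H u v - Hb u v) = of_real ((nrm B b)\<^sup>2) * R G H - R G Hb"
    unfolding R_def sum_distrib_left sum_subtractf[symmetric]
    by (intro sum.cong refl) (simp add: algebra_simps)
  then have 2: "Re (R G Hb) \<le> (nrm B b)\<^sup>2 * Re (R G H)"
    using schur_product[OF S psdG psd2, of f] by (simp add: R_def[symmetric])
  have "Re (R Ga Hb) \<le> (nrm A a)\<^sup>2 * ((nrm B b)\<^sup>2 * Re (R G H))"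
    using 1 mult_left_mono[OF 2, of "(nrm A a)\<^sup>2"] by simp
  moreover have "\<omega> (adj T (single (a, b) \<otimes>\<^bsub>T\<^esub> f) \<otimes>\<^bsub>T\<^esub> (single (a, b) \<otimes>\<^bsub>T\<^esub> f)) = R Ga Hb"
    unfolding \<omega> lin_square[OF f ab] R_def Ga_def Hb_def by simp
  moreover have "\<omega> (adj T f \<otimes>\<^bsub>T\<^esub> f) = R G H"
    unfolding \<omega> R_def G_def H_def
    using f by (simp add: T_lin) (simp add: lin_def prod_fun_def sum_distrib_left mult.assoc)
  ultimately show "Re (\<omega> (adj T (single (a, b) \<otimes>\<^bsub>T\<^esub> f) \<otimes>\<^bsub>T\<^esub> (single (a, b) \<otimes>\<^bsub>T\<^esub> f)))
      \<le> (nrm A a * nrm B b)\<^sup>2 * Re (\<omega> (adj T f \<otimes>\<^bsub>T\<^esub> f))"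
    by (simp add: power_mult_distrib mult.assoc)
qed

sublocale gf: gns_family T F
proof (intro gns_family.intro ff.functional_family_axioms gns_family_axioms.intro)
  show "F \<noteq> {}" using states_ne by blast
  show "\<omega> \<one>\<^bsub>T\<^esub> = 1" if "\<omega> \<in> F" for \<omega>
    using that by (auto simp: T_lin prod_fun_def states_def)
  show "gns_bounded T F f" if "f \<in> carrier T" for f
    using that
  proof (induction rule: T_induct)
    case zero
    then show ?case by (rule ff.gns_bounded_zero)
  next
    case (add g c w)
    then show ?case using gns_bounded_single[of "fst w" "snd w"]
      by (intro ff.gns_bounded_add ff.gns_bounded_smult) auto
  qed
qed

lemma spatial_norm_eq: "spatial_norm A B = gns_norm T F"
proof
  fix x
  show "spatial_norm A B x = gns_norm T F x"
    unfolding spatial_norm_def gns_norm_def Let_def prod_functional_eq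
    by (rule arg_cong[of _ _ Sup]) blast
qed

sublocale S: cstar_seminormed T "spatial_norm A B"
  unfolding spatial_norm_eq
  by (intro cstar_seminormed.intro T.star_alg_axioms cstar_seminormed_axioms.intro gf.gns_cstar_seminorm)

lemma tensor_eq: "tensor A B = S.Q"
  by (simp add: tensor_def)

text \<open>In \<open>T\<close> bilinearity holds only up to elements of seminorm 0, so the images
  of the Cuntz relations are not zero there. This criterion tests such an element between elementary
  tensors, where product functionals see it as bilinear.\<close>

lemma spatial_norm_null:
  assumes r: "r \<in> carrier T"
    and eq: "\<And>\<omega>1 \<omega>2 u v. \<omega>1 \<in> states A \<Longrightarrow> \<omega>2 \<in> states B \<Longrightarrow>
      u \<in> carrier A \<times> carrier B \<Longrightarrow> v \<in> carrier A \<times> carrier B \<Longrightarrow>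
      lin (\<lambda>w. \<omega>1 (fst u \<otimes>\<^bsub>A\<^esub> (fst w \<otimes>\<^bsub>A\<^esub> fst v)) * \<omega>2 (snd u \<otimes>\<^bsub>B\<^esub> (snd w \<otimes>\<^bsub>B\<^esub> snd v))) r = 0"
  shows "spatial_norm A B r = 0"
proof -
  have zero: "lin (prod_fun \<omega>1 \<omega>2) (t \<otimes>\<^bsub>T\<^esub> (r \<otimes>\<^bsub>T\<^esub> y)) = 0"
    if om: "\<omega>1 \<in> states A" "\<omega>2 \<in> states B" and t: "t \<in> carrier T" and y: "y \<in> carrier T" for \<omega>1 \<omega>2 t y
  proof -
    define \<psi> where "\<psi> u w v = \<omega>1 (fst u \<otimes>\<^bsub>A\<^esub> (fst w \<otimes>\<^bsub>A\<^esub> fst v)) * \<omega>2 (snd u \<otimes>\<^bsub>B\<^esub> (snd w \<otimes>\<^bsub>B\<^esub> snd v))" for u w v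
    have "lin (prod_fun \<omega>1 \<omega>2) (t \<otimes>\<^bsub>T\<^esub> (r \<otimes>\<^bsub>T\<^esub> y)) = lin (\<lambda>u. lin (\<lambda>w. lin (\<lambda>v. \<psi> u w v) y) r) t"
      using t y r by (simp add: T_lin prod_fun_def \<psi>_def)
    \<comment> \<open>The evaluation on \<open>r\<close> is moved to the innermost place, where the
      hypothesis makes it vanish for fixed \<open>u\<close> and \<open>v\<close>.\<close>
    also have "\<dots> = lin (\<lambda>u. lin (\<lambda>v. lin (\<lambda>w. \<psi> u w v) r) y) t"
      unfolding lin_def[of _ r] lin_def[of _ y] by (simp add: sum_distrib_left mult_ac sum.swap[of _ "{w. r w \<noteq> 0}"])
    also have "\<dots> = lin (\<lambda>u. lin (\<lambda>v. 0) y) t"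
      using t y eq[OF om] by (intro T_lin_cong) (simp_all add: \<psi>_def)
    also have "\<dots> = 0" by (simp add: lin_def)
    finally show ?thesis .
  qed
  have "gns_norm T F r \<le> 0"
  proof (rule gf.gns_norm_least[OF r])
    fix \<omega> y assume om: "\<omega> \<in> F" and y: "y \<in> carrier T"
    then obtain \<omega>1 \<omega>2 where "\<omega>1 \<in> states A" "\<omega>2 \<in> states B" "\<omega> = lin (prod_fun \<omega>1 \<omega>2)" by blast
    then have "\<omega> (adj T (r \<otimes>\<^bsub>T\<^esub> y) \<otimes>\<^bsub>T\<^esub> (r \<otimes>\<^bsub>T\<^esub> y)) = 0" using zero r y by simp
    then show "positive_functional.om_norm T \<omega> (r \<otimes>\<^bsub>T\<^esub> y) \<le> 0"
      using positive_functional.om_norm_def[OF ff.fam_pos[OF om]] by simp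
  qed
  then show ?thesis using gf.gns_norm_nonneg[OF r] by (simp add: spatial_norm_eq)
qed

lemma tensor_states_eqI:
  assumes om: "\<omega> \<in> states (tensor A B)" "\<omega>' \<in> states (tensor A B)"
    and eq: "\<And>a b. a \<in> carrier A \<Longrightarrow> b \<in> carrier B \<Longrightarrow> \<omega> (elem_tensor A B a b) = \<omega>' (elem_tensor A B a b)"
  shows "\<omega> = \<omega>'"
proof (rule S.states_eqI)
  show om': "\<omega> \<in> states S.Q" "\<omega>' \<in> states S.Q" using om by (simp_all add: tensor_eq)
  interpret o1: positive_functional S.Q \<omega> by (rule S.states_positive[OF om'(1)])
  interpret o2: positive_functional S.Q \<omega>' by (rule S.states_positive[OF om'(2)])
  fix x assume "x \<in> carrier T"
  then show "\<omega> (S.emb x) = \<omega>' (S.emb x)"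
  proof (induction rule: T_induct)
    case zero
    then show ?case by (simp add: S.emb_zero)
  next
    case (add g c w)
    then have w: "single w \<in> carrier T" by simp
    have "\<omega> (S.emb (single w)) = \<omega>' (S.emb (single w))"
      using eq[of "fst w" "snd w"] add by (auto simp: elem_tensor_def)
    then show ?case using add w
      by (simp add: S.emb_add S.emb_smult o1.om_add o1.om_smult o2.om_add o2.om_smult)
  qed
qed

lemma prod_state:
  assumes om: "\<omega>1 \<in> states A" "\<omega>2 \<in> states B"
  shows "prod_state A B \<omega>1 \<omega>2 \<in> states (tensor A B)"
    and "\<And>a b. a \<in> carrier A \<Longrightarrow> b \<in> carrier B \<Longrightarrow>
      prod_state A B \<omega>1 \<omega>2 (elem_tensor A B a b) = \<omega>1 a * \<omega>2 b"
proof -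
  have le: "cmod (lin (prod_fun \<omega>1 \<omega>2) x) \<le> spatial_norm A B x" if "x \<in> carrier T" for x
    unfolding spatial_norm_eq using om by (intro gf.gns_norm_state[OF that]) blast
  have one: "lin (prod_fun \<omega>1 \<omega>2) \<one>\<^bsub>T\<^esub> = 1" using om by (simp add: T_lin prod_fun_def states_def)
  note ext = S.ext_functional[OF prod_positive[OF om] le one]
  define \<omega> where "\<omega> = S.ext_functional (lin (prod_fun \<omega>1 \<omega>2))"
  have ex: "\<omega> \<in> states (tensor A B) \<and>
      (\<forall>a \<in> carrier A. \<forall>b \<in> carrier B. \<omega> (elem_tensor A B a b) = \<omega>1 a * \<omega>2 b)"
  proof (intro conjI ballI)
    show "\<omega> \<in> states (tensor A B)" using ext(1) by (simp add: \<omega>_def tensor_eq)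
    fix a b assume "a \<in> carrier A" "b \<in> carrier B"
    then show "\<omega> (elem_tensor A B a b) = \<omega>1 a * \<omega>2 b"
      using ext(2)[of "single (a, b)"] by (simp add: \<omega>_def elem_tensor_def) (simp add: prod_fun_def)
  qed
  have "prod_state A B \<omega>1 \<omega>2 = \<omega>"
    unfolding prod_state_def
  proof (rule the_equality, rule ex)
    fix \<omega>' assume "\<omega>' \<in> states (tensor A B) \<and>
      (\<forall>a \<in> carrier A. \<forall>b \<in> carrier B. \<omega>' (elem_tensor A B a b) = \<omega>1 a * \<omega>2 b)"
    then show "\<omega>' = \<omega>" using ex by (intro tensor_states_eqI) simp_all
  qed
  then show "prod_state A B \<omega>1 \<omega>2 \<in> states (tensor A B)"
    "\<And>a b. a \<in> carrier A \<Longrightarrow> b \<in> carrier B \<Longrightarrow>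
      prod_state A B \<omega>1 \<omega>2 (elem_tensor A B a b) = \<omega>1 a * \<omega>2 b"
    using ex by simp_all
qed

end

section \<open>The embedding into the tensor product\<close>

lemma sum_unbox:
  fixes f :: "nat \<Rightarrow> nat \<Rightarrow> 'a :: comm_monoid_add"
  shows "(\<Sum>l\<in>{1..n * n'}. f (unbox_left n' l) (unbox_right n' l)) = (\<Sum>i\<in>{1..n}. \<Sum>j\<in>{1..n'}. f i j)"
proof -
  have "(\<Sum>l\<in>{1..n * n'}. f (unbox_left n' l) (unbox_right n' l)) = (\<Sum>(i, j)\<in>{1..n} \<times> {1..n'}. f i j)"
    by (rule sum.reindex_bij_witness[where i = "\<lambda>(i, j). n' * (i - 1) + j" and j = "\<lambda>l. (unbox_left n' l, unbox_right n' l)"])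
      (auto simp: box_unbox unbox_box simp del: atLeastAtMost_iff One_nat_def)
  then show ?thesis by (simp add: sum.cartesian_product)
qed

locale cuntz_tensor = tensor_pair A B + A: cuntz_family A n s + B: cuntz_family B n' t
  for A :: "('a, 'm) normed_star_algebra_scheme" (structure)
    and B :: "('b, 'k) normed_star_algebra_scheme" (structure) and n n' s t
begin

text \<open>The embedding before linear extension and completion. A product of elementary tensors is
  again one, so a word in the \<open>n * n'\<close> generators can be sent to a pair of elements,
  each letter being unboxed.\<close>

definition pair_word :: "letter list \<Rightarrow> 'a \<times> 'b" where
  "pair_word w = (word_eval A (\<lambda>l. s (unbox_left n' l)) w, word_eval B (\<lambda>l. t (unbox_right n' l)) w)"

lemma unbox_closed:
  "l \<in> {1..n * n'} \<Longrightarrow> s (unbox_left n' l) \<in> carrier A" "l \<in> {1..n * n'} \<Longrightarrow> t (unbox_right n' l) \<in> carrier B"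
  using box_unbox(2,3) by (auto simp del: atLeastAtMost_iff)

lemma pair_word_closed:
  assumes "w \<in> lists (letters (n * n'))"
  shows "fst (pair_word w) \<in> carrier A" "snd (pair_word w) \<in> carrier B"
  unfolding pair_word_def fst_conv snd_conv
  by (rule A.word_eval_closed[OF unbox_closed(1) assms], assumption)
    (rule B.word_eval_closed[OF unbox_closed(2) assms])

sublocale H: involutive_monoid_hom "words (n * n')" "tensor_monoid A B" pair_word
proof (intro involutive_monoid_hom.intro words.involutive_monoid_axioms M.involutive_monoid_axioms
    involutive_monoid_hom_axioms.intro)
  fix u assume "u \<in> carrier (words (n * n'))"
  then have u: "u \<in> lists (letters (n * n'))" by simp
  show "pair_word u \<in> carrier (tensor_monoid A B)"
    using pair_word_closed[OF u] by (simp add: mem_Times_iff)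
  show "pair_word (madj (words (n * n')) u) = madj (tensor_monoid A B) (pair_word u)"
    using A.word_eval_adj[OF unbox_closed(1) u] B.word_eval_adj[OF unbox_closed(2) u]
    by (simp add: pair_word_def)
  fix v assume "v \<in> carrier (words (n * n'))"
  then have v: "v \<in> lists (letters (n * n'))" by simp
  show "pair_word (u \<otimes>\<^bsub>words (n * n')\<^esub> v) = pair_word u \<otimes>\<^bsub>tensor_monoid A B\<^esub> pair_word v"
    using A.word_eval_append[OF unbox_closed(1) u v] B.word_eval_append[OF unbox_closed(2) u v]
    by (simp add: pair_word_def)
qed (simp add: pair_word_def)

abbreviation "\<Phi> \<equiv> push pair_word"

sublocale P: star_alg_hom "free_alg (n * n')" T \<Phi>
  unfolding free_alg_def tensor_alg_eq by (rule H.push_star_alg_hom)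

text \<open>Under a product functional each relation splits into the relations of the two factors:
  the two Kronecker deltas multiply to the delta of the paired indices, and the sum over
  \<open>n * n'\<close> indices becomes a product of two sums.\<close>

lemma spatial_norm_relation:
  assumes "r \<in> cuntz_relations (n * n')"
  shows "spatial_norm A B (\<Phi> r) = 0"
proof (rule spatial_norm_null)
  have r: "r \<in> carrier (free_alg (n * n'))" using assms unfolding cuntz_relations_eq by auto
  then show "\<Phi> r \<in> carrier T" by simp
  fix \<omega>1 \<omega>2 u v
  assume om: "\<omega>1 \<in> states A" "\<omega>2 \<in> states B" and u: "u \<in> carrier A \<times> carrier B" and v: "v \<in> carrier A \<times> carrier B"
  interpret o1: positive_functional A \<omega>1 using states_pos om by blast
  interpret o2: positive_functional B \<omega>2 using states_pos om by blast
  have uv: "fst u \<in> carrier A" "snd u \<in> carrier B" "fst v \<in> carrier A" "snd v \<in> carrier B" using u v by auto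
  define \<alpha> where "\<alpha> a = \<omega>1 (fst u \<otimes>\<^bsub>A\<^esub> (a \<otimes>\<^bsub>A\<^esub> fst v))" for a
  define \<beta> where "\<beta> b = \<omega>2 (snd u \<otimes>\<^bsub>B\<^esub> (b \<otimes>\<^bsub>B\<^esub> snd v))" for b
  define \<psi> where "\<psi> w = \<alpha> (fst (pair_word w)) * \<beta> (snd (pair_word w))" for w
  have zero: "\<alpha> \<zero>\<^bsub>A\<^esub> = 0" "\<beta> \<zero>\<^bsub>B\<^esub> = 0" using uv by (simp_all add: \<alpha>_def \<beta>_def)
  have nil: "\<psi> [] = \<alpha> \<one>\<^bsub>A\<^esub> * \<beta> \<one>\<^bsub>B\<^esub>" by (simp add: \<psi>_def pair_word_def)
  have "lin \<psi> r = 0"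
  proof -
    have "lin \<psi> (orth_rel (n * n') i j) = 0" if ij: "i \<in> {1..n * n'}" "j \<in> {1..n * n'}" for i j
    proof -
      have fs: "fst (pair_word [GenAdj i, Gen j]) = adj A (s (unbox_left n' i)) \<otimes>\<^bsub>A\<^esub> s (unbox_left n' j)"
        "snd (pair_word [GenAdj i, Gen j]) = adj B (t (unbox_right n' i)) \<otimes>\<^bsub>B\<^esub> t (unbox_right n' j)"
        using unbox_closed[OF ij(1)] unbox_closed[OF ij(2)] by (simp_all add: pair_word_def)
      \<comment> \<open>An index is recovered from its two unboxed parts, so distinct indices differ
        in at least one of them, and there the orthogonality of the factor applies.\<close>
      have "i = j \<longleftrightarrow> unbox_left n' i = unbox_left n' j \<and> unbox_right n' i = unbox_right n' j"
        using box_unbox(1)[OF ij(1)] box_unbox(1)[OF ij(2)] by metis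
      then have "\<psi> [GenAdj i, Gen j] = (if i = j then \<psi> [] else 0)"
        unfolding nil unfolding \<psi>_def fs A.s_orth[OF box_unbox(2)[OF ij(1)] box_unbox(2)[OF ij(2)]]
          B.s_orth[OF box_unbox(3)[OF ij(1)] box_unbox(3)[OF ij(2)]]
        by (auto simp: zero)
      then show ?thesis using lin_orth_rel[OF ij] by simp
    qed
    moreover have "lin \<psi> (sum_rel (n * n')) = 0"
    proof -
      have fs: "\<psi> [Gen l, GenAdj l] = \<alpha> (s (unbox_left n' l) \<otimes>\<^bsub>A\<^esub> adj A (s (unbox_left n' l)))
          * \<beta> (t (unbox_right n' l) \<otimes>\<^bsub>B\<^esub> adj B (t (unbox_right n' l)))" if "l \<in> {1..n * n'}" for l
        using unbox_closed[OF that] by (simp add: \<psi>_def pair_word_def)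
      have "(\<Sum>l\<in>{1..n * n'}. \<psi> [Gen l, GenAdj l])
        = (\<Sum>i\<in>{1..n}. \<Sum>j\<in>{1..n'}. \<alpha> (s i \<otimes>\<^bsub>A\<^esub> adj A (s i)) * \<beta> (t j \<otimes>\<^bsub>B\<^esub> adj B (t j)))"
        by (subst sum_unbox[symmetric]) (intro sum.cong refl fs)
      also have "\<dots> = (\<Sum>i\<in>{1..n}. \<alpha> (s i \<otimes>\<^bsub>A\<^esub> adj A (s i))) * (\<Sum>j\<in>{1..n'}. \<beta> (t j \<otimes>\<^bsub>B\<^esub> adj B (t j)))"
        by (rule sum_product[symmetric])
      also have "(\<Sum>i\<in>{1..n}. \<alpha> (s i \<otimes>\<^bsub>A\<^esub> adj A (s i))) = \<alpha> \<one>\<^bsub>A\<^esub>"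
        unfolding \<alpha>_def A.s_sum[symmetric] by (rule o1.om_finsum[symmetric]) (use uv in simp_all)
      also have "(\<Sum>j\<in>{1..n'}. \<beta> (t j \<otimes>\<^bsub>B\<^esub> adj B (t j))) = \<beta> \<one>\<^bsub>B\<^esub>"
        unfolding \<beta>_def B.s_sum[symmetric] by (rule o2.om_finsum[symmetric]) (use uv in simp_all)
      finally show ?thesis by (simp only: lin_sum_rel nil) simp
    qed
    ultimately show ?thesis using assms unfolding cuntz_relations_eq by auto
  qed
  then show "lin (\<lambda>w. \<omega>1 (fst u \<otimes>\<^bsub>A\<^esub> (fst w \<otimes>\<^bsub>A\<^esub> fst v)) * \<omega>2 (snd u \<otimes>\<^bsub>B\<^esub> (snd w \<otimes>\<^bsub>B\<^esub> snd v))) (\<Phi> r) = 0"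
    using H.lin_push[of r] r by (simp add: free_alg_def \<psi>_def[abs_def] \<alpha>_def \<beta>_def)
qed

text \<open>The universal property at work: the spatial seminorm pulled back along
  \<open>\<Phi>\<close> kills the relations, so it is one of the seminorms over which
  \<open>cuntz_norm\<close> is the supremum.\<close>

sublocale C: contractive_hom "free_alg (n * n')" T \<Phi> "cuntz_norm (n * n')" "spatial_norm A B"
proof (intro contractive_hom.intro contractive_hom_axioms.intro P.star_alg_hom_axioms
    cuntz_norm.cstar_seminormed_axioms S.cstar_seminormed_axioms)
  have "(\<lambda>f. spatial_norm A B (\<Phi> f)) \<in> cuntz_seminorms (n * n')"
    unfolding cuntz_seminorms_def mem_Collect_eq
    by (intro conjI ballI P.pullback_cstar_seminorm S.cstar spatial_norm_relation)
  then show "spatial_norm A B (\<Phi> a) \<le> cuntz_norm (n * n') a" if "a \<in> carrier (free_alg (n * n'))" for a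
    using cuntz_norm_upper that by blast
qed

lemma ext_hom_word:
  assumes "w \<in> lists (letters (n * n'))"
  shows "C.ext_hom (word_eval (cuntz (n * n')) (cuntz_gen (n * n')) w)
    = elem_tensor A B (fst (pair_word w)) (snd (pair_word w))"
proof -
  have "C.ext_hom (cuntz_emb (n * n') (single w)) = S.emb (\<Phi> (single w))"
    using assms by (intro C.ext_hom_emb) simp
  then show ?thesis using assms H.push_single[of w] by (simp add: cuntz_emb_single elem_tensor_def)
qed

lemma ext_hom_gen:
  assumes "i \<in> {1..n}" "j \<in> {1..n'}"
  shows "C.ext_hom (cuntz_gen (n * n') (n' * (i - 1) + j)) = elem_tensor A B (s i) (t j)"
proof -
  let ?l = "n' * (i - 1) + j"
  note b = unbox_box[OF assms]
  interpret F: cuntz_family "cuntz (n * n')" "n * n'" "cuntz_gen (n * n')" by (rule cuntz_gen_family)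
  have "[Gen ?l] \<in> lists (letters (n * n'))" using b(3) by simp
  from ext_hom_word[OF this] show ?thesis
    using assms b(1,2) F.s_closed[OF b(3)] by (simp add: pair_word_def)
qed

text \<open>Supplies the uniqueness behind the definite description \<open>cuntz_phi\<close>. The
  generators determine the values on words, linearity those on the free algebra, and boundedness
  together with density the rest.\<close>

lemma ext_hom_unique:
  assumes f: "f \<in> star_hom (cuntz (n * n')) (tensor A B)"
    and gen: "\<And>i j. i \<in> {1..n} \<Longrightarrow> j \<in> {1..n'} \<Longrightarrow>
      f (cuntz_gen (n * n') (n' * (i - 1) + j)) = elem_tensor A B (s i) (t j)"
  shows "f = C.ext_hom"
proof -
  let ?N = "n * n'"
  have g: "C.ext_hom \<in> star_hom (cuntz ?N) (tensor A B)"
    using C.ext_hom_star_hom by (simp add: cuntz_def tensor_eq)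
  have SQ: "star_alg (tensor A B)" unfolding tensor_eq by (rule S.star_alg_completion)
  interpret f: star_alg_hom "cuntz ?N" "tensor A B" f by (rule star_hom_imp_star_alg_hom[OF f cuntz.star_alg_axioms SQ])
  interpret g: star_alg_hom "cuntz ?N" "tensor A B" C.ext_hom by (rule star_hom_imp_star_alg_hom[OF g cuntz.star_alg_axioms SQ])
  have eq: "f (cuntz_gen ?N l) = C.ext_hom (cuntz_gen ?N l)" if "l \<in> {1..?N}" for l
    using gen[OF box_unbox(2,3)[OF that]] ext_hom_gen[OF box_unbox(2,3)[OF that]] box_unbox(1)[OF that] by simp
  interpret F: cuntz_family "cuntz ?N" ?N "cuntz_gen ?N" by (rule cuntz_gen_family)
  have word: "f (word_eval (cuntz ?N) (cuntz_gen ?N) w) = C.ext_hom (word_eval (cuntz ?N) (cuntz_gen ?N) w)"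
    if "w \<in> lists (letters ?N)" for w
    using that
  proof (induction w)
    case Nil
    then show ?case by (simp add: f.hom_one g.hom_one)
  next
    case (Cons l w)
    have wc: "word_eval (cuntz ?N) (cuntz_gen ?N) w \<in> carrier (cuntz ?N)"
      by (rule cuntz.word_eval_closed[OF F.s_closed Cons.hyps(2)])
    show ?case
    proof (cases l)
      case (Gen i)
      then have i: "i \<in> {1..?N}" using Cons.hyps(1) by simp
      show ?thesis unfolding Gen word_eval.simps
        using wc F.s_closed[OF i] eq[OF i] Cons.IH by (simp only: f.hom_mult g.hom_mult)
    next
      case (GenAdj i)
      then have i: "i \<in> {1..?N}" using Cons.hyps(1) by simp
      show ?thesis unfolding GenAdj word_eval.simps
        using wc F.s_closed[OF i] cuntz.adj_closed[OF F.s_closed[OF i]] eq[OF i] Cons.IH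
        by (simp only: f.hom_mult g.hom_mult f.hom_adj g.hom_adj)
    qed
  qed
  show ?thesis
  proof (rule star_hom_eqI[OF cuntz_norm.cstar_seminormed_axioms S.cstar_seminormed_axioms])
    show "f \<in> star_hom (completion (free_alg ?N) (cuntz_norm ?N)) S.Q"
      using f by (simp only: cuntz_def tensor_eq)
    show "C.ext_hom \<in> star_hom (completion (free_alg ?N) (cuntz_norm ?N)) S.Q"
      by (rule C.ext_hom_star_hom)
    fix x assume "x \<in> carrier (free_alg ?N)"
    then show "f (cuntz_emb ?N x) = C.ext_hom (cuntz_emb ?N x)"
    proof (induction rule: free_alg_induct)
      case zero
      then show ?case by (simp only: cuntz_emb.hom_zero f.hom_zero g.hom_zero)
    next
      case (add x c w)
      have w: "w \<in> lists (letters ?N)" using add.hyps by simp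
      then have sw: "single w \<in> carrier (free_alg ?N)" by simp
      have csw: "c \<odot>\<^bsub>free_alg ?N\<^esub> single w \<in> carrier (free_alg ?N)"
        by (rule free_alg.smult_closed[OF sw])
      have "f (cuntz_emb ?N (single w)) = C.ext_hom (cuntz_emb ?N (single w))"
        using word[OF w] by (simp only: cuntz_emb_single[OF w])
      then show ?case
        using add.IH cuntz_emb.hom_closed[OF add.hyps(1)] cuntz_emb.hom_closed[OF sw]
          cuntz.smult_closed[OF cuntz_emb.hom_closed[OF sw]]
        by (simp only: cuntz_emb.hom_add[OF add.hyps(1) csw] cuntz_emb.hom_smult[OF sw]
            f.hom_add g.hom_add f.hom_smult g.hom_smult)
    qed
  qed
qed

end

section \<open>The product state on the words in the paired generators\<close>

lemma word_eval_map_Gen: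
  "word_eval A (\<lambda>l. s (g l)) (map Gen L) = word_eval A s (map Gen (map g L))"
  by (induction L) simp_all

text \<open>On \<open>s_L\<close> the product state is the product of the values of the two states
  at the unboxed words. The length \<open>lcm m l\<close> of these is a whole number of blocks for
  either state, so both values are coordinates of tensor powers of \<open>z\<close> and
  \<open>y\<close>.\<close>

lemma state_tensor_phi_sub_cuntz:
  assumes m: "1 \<le> m" "1 \<le> l" and z: "z \<in> unit_vecs n m" and y: "y \<in> unit_vecs n' l"
    and om: "sub_cuntz_state n m z \<omega>1" "sub_cuntz_state n' l y \<omega>2"
  shows "sub_cuntz_state (n * n') (lcm m l) (vec_star n n' m l z y) (state_tensor_phi n n' \<omega>1 \<omega>2)"
proof -
  have st: "\<omega>1 \<in> states (cuntz n)" "\<omega>2 \<in> states (cuntz n')" using om by (simp_all add: sub_cuntz_state_def)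
  interpret cuntz_tensor "cuntz n" "cuntz n'" n n' "cuntz_gen n" "cuntz_gen n'"
    by (intro cuntz_tensor.intro tensor_pair.intro tensor_pair_axioms.intro cuntz_gen_family
        cuntz.cstar_seminormed_axioms) (use st in auto)
  interpret o1: sub_cuntz_functional "cuntz n" n "cuntz_gen n" \<omega>1 m z
    by (rule sub_cuntz_state_functional[OF om(1) m(1) z])
  interpret o2: sub_cuntz_functional "cuntz n'" n' "cuntz_gen n'" \<omega>2 l y
    by (rule sub_cuntz_state_functional[OF om(2) m(2) y])
  let ?N = "n * n'" and ?d = "lcm m l"
  have hom: "C.ext_hom \<in> star_hom (cuntz ?N) (tensor (cuntz n) (cuntz n'))"
    using C.ext_hom_star_hom by (simp only: cuntz_def[of ?N] tensor_eq)
  have phi: "cuntz_phi n n' = C.ext_hom"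
    unfolding cuntz_phi_def
  proof (rule the_equality)
    show "C.ext_hom \<in> star_hom (cuntz ?N) (tensor (cuntz n) (cuntz n')) \<and>
      (\<forall>i\<in>{1..n}. \<forall>j\<in>{1..n'}. C.ext_hom (cuntz_gen ?N (n' * (i - 1) + j)) =
        elem_tensor (cuntz n) (cuntz n') (cuntz_gen n i) (cuntz_gen n' j))"
      by (intro conjI ballI hom ext_hom_gen)
    show "f = C.ext_hom" if "f \<in> star_hom (cuntz ?N) (tensor (cuntz n) (cuntz n')) \<and>
      (\<forall>i\<in>{1..n}. \<forall>j\<in>{1..n'}. f (cuntz_gen ?N (n' * (i - 1) + j)) =
        elem_tensor (cuntz n) (cuntz n') (cuntz_gen n i) (cuntz_gen n' j))" for f
      using that by (intro ext_hom_unique) blast+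
  qed
  note ps = prod_state[OF st]
  have SQ: "star_alg (tensor (cuntz n) (cuntz n'))" unfolding tensor_eq by (rule S.star_alg_completion)
  have "state_tensor_phi n n' \<omega>1 \<omega>2 \<in> states (cuntz ?N)"
    unfolding state_tensor_phi_def phi
  proof (rule states_compose_star_hom[OF cuntz.star_alg_axioms SQ ps(1) hom])
    show "nrm (tensor (cuntz n) (cuntz n')) (C.ext_hom a) \<le> nrm (cuntz ?N) a" if "a \<in> carrier (cuntz ?N)" for a
      using C.ext_hom_contr that by (simp only: cuntz_def[of ?N] tensor_eq)
  qed
  moreover have "state_tensor_phi n n' \<omega>1 \<omega>2 (cuntz_gens ?N L) = cnj (vec_star n n' m l z y L)"
    if L: "L \<in> multi_indices ?N ?d" for L
  proof -
    let ?J = "map (unbox_left n') L" and ?K = "map (unbox_right n') L"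
    have J: "?J \<in> multi_indices n (?d div m * m)" and K: "?K \<in> multi_indices n' (?d div l * l)"
      using index_box_unbox[OF L] by simp_all
    have w: "map Gen L \<in> lists (letters ?N)" by (rule multi_indices_words[OF L])
    have "word_eval (cuntz ?N) (cuntz_gen ?N) (map Gen L) \<in> carrier (cuntz ?N)"
      using cuntz_family.gens_closed[OF cuntz_gen_family L] by (simp add: cuntz_family.gens_def[OF cuntz_gen_family])
    then have "state_tensor_phi n n' \<omega>1 \<omega>2 (cuntz_gens ?N L)
        = prod_state (cuntz n) (cuntz n') \<omega>1 \<omega>2 (C.ext_hom (word_eval (cuntz ?N) (cuntz_gen ?N) (map Gen L)))"
      unfolding state_tensor_phi_def phi cuntz_gens_word_eval by (simp add: compose_def)
    also have "\<dots> = \<omega>1 (A.gens ?J) * \<omega>2 (B.gens ?K)"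
      unfolding ext_hom_word[OF w] using ps(2)[OF pair_word_closed[OF w]]
      by (simp add: pair_word_def word_eval_map_Gen A.gens_def B.gens_def)
    also have "\<omega>1 (A.gens ?J) = cnj (vec_power m z (?d div m) ?J)"
      using o1.om_gens_mult_power[OF cuntz.one_closed J] A.gens_closed[OF J] o1.om_one by simp
    also have "\<omega>2 (B.gens ?K) = cnj (vec_power l y (?d div l) ?K)"
      using o2.om_gens_mult_power[OF cuntz.one_closed K] B.gens_closed[OF K] o2.om_one by simp
    finally show ?thesis using L by (simp add: vec_star_def Let_def vec_box_eq)
  qed
  ultimately show ?thesis unfolding sub_cuntz_state_def by blast
qed

theorem proposition1p12:
  fixes n n' m l :: nat and z y :: "nat list \<Rightarrow> complex"
  assumes "2 \<le> n" and "2 \<le> n'" and "1 \<le> m" and "1 \<le> l"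
    and "z \<in> unit_vecs n m" and "nonperiodic n z"
    and "y \<in> unit_vecs n' l" and "nonperiodic n' y"
  shows "nonperiodic (n * n') (vec_star n n' m l z y) \<and>
    state_tensor_phi n n' (omega_tilde n m z) (omega_tilde n' l y) =
      omega_tilde (n * n') (lcm m l) (vec_star n n' m l z y) \<and>
    (m = l \<longrightarrow> state_tensor_phi n n' (omega_tilde n m z) (omega_tilde n' l y) =
      omega_tilde (n * n') m (vec_box n n' m z y))"
proof -
  have np: "nonperiodic (n * n') (vec_star n n' m l z y)"
    using assms unit_vecs_vecs unit_vecs_nonzero by (intro nonperiodic_vec_star) auto
  have d: "1 \<le> lcm m l" using assms by (simp add: Suc_le_eq lcm_pos_nat)
  have "sub_cuntz_state (n * n') (lcm m l) (vec_star n n' m l z y)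
      (state_tensor_phi n n' (omega_tilde n m z) (omega_tilde n' l y))"
    using assms by (intro state_tensor_phi_sub_cuntz omega_tilde_sub_cuntz)
  then have eq: "state_tensor_phi n n' (omega_tilde n m z) (omega_tilde n' l y) =
      omega_tilde (n * n') (lcm m l) (vec_star n n' m l z y)"
    using omega_tilde_eqI[OF d vec_star_unit[OF assms(3,4,5,7)] np] by simp
  moreover have "vec_star n n' m l z y = vec_box n n' m z y" if "m = l"
    using vec_star_same_order[OF assms(3), of z n y n'] assms unit_vecs_vecs that by blast
  ultimately show ?thesis using np by auto
qed

end
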